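(* Let $\mathbb{F}$ be algebraically closed and $G=\mathrm{SL}(m,\mathbb{F})$. There is a polynomial $p$ such that the following holds. Suppose $f\in\mathbb{F}[x_1,\dots,x_m]$ belongs to the unique closed $G$-orbit in the $G$-orbit closure of $g\in\mathbb{F}[x_1,\dots,x_m]$. Then there exists a one-parameter subgroup $\lambda(t)\subseteq G$ such that (1) $\lim_{t\to0}\lambda(t)\cdot g=f$, and (2) the total degree of $\lambda$ is at most $2^{p(m,b)}$, where $b$ is the bit-length of $\deg(g)$. Consequently, if $\{f_n\}$ is a stable degeneration of $\{g_n\}\in\mathrm{VP}$, then $\{f_n\}$ is a p-definable one-parameter degeneration of $\{g_n\}$.
   Context: $G=\mathrm{SL}(m,\mathbb{F})$ acts on $\mathbb{F}[x_1,\dots,x_m]$ by $(\sigma\cdot f)(\mathbf{x})=f(\sigma^{-1}\mathbf{x})$; the Zariski closure of any orbit contains a unique closed orbit. A one-parameter subgroup $\lambda:\mathbb{F}^\times\to G$ can be written $\lambda(t)=A\,\mathrm{diag}(t^{k_1},\dots,t^{k_m})A^{-1}$ with $A\in G$, $k_j\in\mathbb{Z}$; its total degree is $\sum_j|k_j|$. $\lim_{t\to0}\lambda(t)\cdot g=f$ means the polynomial $\lambda(t)\cdot g$ (coefficients in $\mathbb{F}[t,t^{-1}]$) has no negative powers of $t$ and equals $f$ at $t=0$. $\mathrm{VP}$: families with $\mathsf{poly}(n)$ variables and degree computed by $\mathsf{poly}(n)$-size arithmetic circuits. $\{f_n\}$ is a stable degeneration of $\{g_n\}$ if each $f_n$ lies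 in the unique closed $\mathrm{SL}(m_n,\mathbb{F})$-orbit in the orbit closure of $g_n$, $m_n$ being the number of variables of $f_n$ and $g_n$. p-definable one-parameter degeneration: $\{f_n(x_1,\dots,x_{m_n})\}$ is one of $\{g_n(y_1,\dots,y_{l_n})\}$ if for some $K(n)=O(2^{\mathsf{poly}(n)})$ there is a $\mathsf{poly}(n)$-size circuit family $\{C_n\}$ over $\mathbb{F}$ such that substituting $y_i=a^i_0+\sum_{j}a^i_jx_j$, $a^i_j=\sum_{k=-K(n)}^{K(n)}C_n(i,j,k)t^k$, into $g_n$ gives $g_n(t)$ without negative powers of $t$ with $g_n(t)|_{t=0}=f_n$; $C_n$ receives $(i,j,k)$ in binary as $0$-$1$ elements of $\mathbb{F}$.
   Formalization: In (1) the limit of λ(t)·g is σ·f for some σ in SL(m), a point of the closed orbit, rather than the prescribed f; the literal claim fails, e.g. for g=xy, f=(x+y)(cx+(1+c)y) with c≠0,-1. *)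

theory Defs
  imports
    "HOL-Library.Poly_Mapping"
    "HOL-Library.Log_Nat"
    "HOL-Library.Landau_Symbols"
    "HOL-Computational_Algebra.Polynomial"
    "Jordan_Normal_Form.Determinant"
begin

abbreviation lookup :: "('k \<Rightarrow>\<^sub>0 'c::zero) \<Rightarrow> 'k \<Rightarrow> 'c" where
  "lookup \<equiv> Poly_Mapping.lookup"

abbreviation keys :: "('k \<Rightarrow>\<^sub>0 'c::zero) \<Rightarrow> 'k set" where
  "keys \<equiv> Poly_Mapping.keys"


section \<open>Multivariate polynomials\<close>

text \<open>
  Finitely supported maps carry the convolution product, so \<open>('v, 'r) mpol\<close> is the polynomial
  ring over \<open>'r\<close> in commuting variables indexed by \<open>'v\<close>.  The variables
  \<open>x\<^sub>1, \<dots>, x\<^sub>m\<close> of the mathematics are the indices \<open>0, \<dots>, m - 1\<close>.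
\<close>

type_synonym ('v, 'r) mpol = "('v \<Rightarrow>\<^sub>0 nat) \<Rightarrow>\<^sub>0 'r"

definition Cst :: "'r::zero \<Rightarrow> ('v, 'r) mpol" where
  "Cst c = Poly_Mapping.single 0 c"

definition Var :: "'v \<Rightarrow> ('v, 'r::zero_neq_one) mpol" where
  "Var v = Poly_Mapping.single (Poly_Mapping.single v 1) 1"

text \<open>Substitution of \<open>\<rho> v\<close> for the variable \<open>v\<close>, with \<open>\<kappa>\<close> applied to the coefficients.\<close>

definition mp_subst ::
  "('r::zero \<Rightarrow> 's::comm_semiring_1) \<Rightarrow> ('v \<Rightarrow> 's) \<Rightarrow> ('v, 'r) mpol \<Rightarrow> 's" where
  "mp_subst \<kappa> \<rho> f =
     (\<Sum>\<mu>\<in>keys f. \<kappa> (lookup f \<mu>) * (\<Prod>v\<in>keys \<mu>. \<rho> v ^ lookup \<mu> v))"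

definition mpols :: "nat \<Rightarrow> (nat, 'r::zero) mpol set" where
  "mpols m = {f. \<forall>\<mu>\<in>keys f. keys \<mu> \<subseteq> {..<m}}"

definition mdeg :: "('v, 'r::zero) mpol \<Rightarrow> nat" where
  "mdeg f = Max (insert 0 ((\<lambda>\<mu>. \<Sum>v\<in>keys \<mu>. lookup \<mu> v) ` keys f))"


section \<open>The action of the special linear group\<close>

definition SL :: "nat \<Rightarrow> 'r::comm_ring_1 mat set" where
  "SL m = {A \<in> carrier_mat m m. det A = 1}"

definition minv :: "'r::comm_ring_1 mat \<Rightarrow> 'r mat" where
  "minv A = (THE B. B \<in> carrier_mat (dim_row A) (dim_row A) \<and> inverts_mat A B \<and> inverts_mat B A)"

text \<open>\<open>(\<sigma> \<cdot> f)(x) = f(\<sigma>\<^sup>-\<^sup>1 x)\<close>: the variable \<open>x\<^sub>i\<close> is replaced by the \<open>i\<close>-th entry of \<open>\<sigma>\<^sup>-\<^sup>1 x\<close>.\<close>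

definition act :: "nat \<Rightarrow> 'r::comm_ring_1 mat \<Rightarrow> (nat, 'r) mpol \<Rightarrow> (nat, 'r) mpol" where
  "act m \<sigma> f = mp_subst Cst (\<lambda>i. \<Sum>j<m. Cst (minv \<sigma> $$ (i, j)) * Var j) f"

definition orbit :: "nat \<Rightarrow> (nat, 'a::field) mpol \<Rightarrow> (nat, 'a) mpol set" where
  "orbit m f = (\<lambda>\<sigma>. act m \<sigma> f) ` SL m"

text \<open>
  Regular functions on the space of polynomials are the polynomials in the coefficients, i.e. the
  elements of the polynomial ring whose variables are indexed by monomials.  On the space of
  polynomials in \<open>m\<close> variables of degree at most \<open>d\<close>, which is closed and contains the
  orbits of its elements, this induces the usual Zariski topology of affine space.
\<close>

definition zariski_closure :: "(nat, 'a::field) mpol set \<Rightarrow> (nat, 'a) mpol set" where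
  "zariski_closure S =
     {f. \<forall>P :: (nat \<Rightarrow>\<^sub>0 nat, 'a) mpol.
           (\<forall>h\<in>S. mp_subst id (lookup h) P = 0) \<longrightarrow> mp_subst id (lookup f) P = 0}"

text \<open>
  There is exactly one closed orbit in an orbit closure, so membership in \<^emph>\<open>the\<close> closed orbit
  is membership in \<^emph>\<open>some\<close> closed orbit contained in the orbit closure.
\<close>

definition in_closed_orbit ::
  "nat \<Rightarrow> (nat, 'a::field) mpol \<Rightarrow> (nat, 'a) mpol \<Rightarrow> bool" where
  "in_closed_orbit m g f \<longleftrightarrow>
     (\<exists>h\<in>mpols m. orbit m h \<subseteq> zariski_closure (orbit m g) \<and>
        zariski_closure (orbit m h) = orbit m h \<and> f \<in> orbit m h)"


section \<open>One-parameter subgroups and limits\<close>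

text \<open>
  The group ring of the integers is the ring \<open>\<bbbF>[t, t\<^sup>-\<^sup>1]\<close> of Laurent polynomials; the key
  \<open>k\<close> stands for \<open>t\<^sup>k\<close>.
\<close>

type_synonym 'a laurent = "int \<Rightarrow>\<^sub>0 'a"

definition lconst :: "'a::zero \<Rightarrow> 'a laurent" where
  "lconst c = Poly_Mapping.single 0 c"

definition tpow :: "int \<Rightarrow> 'a::zero_neq_one laurent" where
  "tpow k = Poly_Mapping.single k 1"

definition leval :: "'a::field \<Rightarrow> 'a laurent \<Rightarrow> 'a" where
  "leval t p = (\<Sum>k\<in>keys p. lookup p k * t powi k)"

text \<open>A regular map from \<open>\<bbbF>\<^sup>\<times>\<close> to the special linear group is a matrix over the Laurent polynomials.\<close>

definition one_param_subgroup :: "nat \<Rightarrow> 'a::field laurent mat \<Rightarrow> bool" where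
  "one_param_subgroup m \<Lambda> \<longleftrightarrow> \<Lambda> \<in> SL m \<and>
     (\<forall>s t. s \<noteq> 0 \<longrightarrow> t \<noteq> 0 \<longrightarrow>
        map_mat (leval (s * t)) \<Lambda> = map_mat (leval s) \<Lambda> * map_mat (leval t) \<Lambda>)"

definition has_total_degree :: "nat \<Rightarrow> 'a::field laurent mat \<Rightarrow> nat \<Rightarrow> bool" where
  "has_total_degree m \<Lambda> d \<longleftrightarrow>
     (\<exists>A\<in>SL m. \<exists>k :: nat \<Rightarrow> int.
        \<Lambda> = map_mat lconst A * mat_diag m (\<lambda>j. tpow (k j)) * map_mat lconst (minv A) \<and>
        int d = (\<Sum>j<m. \<bar>k j\<bar>))"

definition to_laurent :: "(nat, 'a::zero) mpol \<Rightarrow> (nat, 'a laurent) mpol" where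
  "to_laurent f = Poly_Mapping.map lconst f"

text \<open>No negative powers of \<open>t\<close> occur in \<open>F\<close>, and \<open>F\<close> equals \<open>f\<close> at \<open>t = 0\<close>.\<close>

definition has_limit :: "(nat, 'a::zero) mpol \<Rightarrow> (nat, 'a laurent) mpol \<Rightarrow> bool" where
  "has_limit f F \<longleftrightarrow>
     (\<forall>\<mu>. (\<forall>k<0. lookup (lookup F \<mu>) k = 0) \<and> lookup (lookup F \<mu>) 0 = lookup f \<mu>)"

text \<open>
  In the main statement \<open>\<lambda>(t) \<cdot> g\<close> tends to \<open>\<sigma> \<cdot> f\<close> for some \<open>\<sigma>\<close> in the special linear group,
  or equivalently \<open>\<sigma>\<^sup>-\<^sup>1 \<lambda>(t) \<cdot> g\<close> tends to \<open>f\<close>: the point \<open>f\<close> only represents its orbit.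
  This is what the theorem of Hilbert, Mumford and Kempf provides.

  One cannot in general take \<open>\<sigma> = 1\<close>, that is, prescribe the point \<open>f\<close> of the closed orbit.
  Let \<open>m = 2\<close>, \<open>g = x y\<close> and \<open>f = u v\<close> with \<open>u = x + y\<close>, \<open>v = c x + (1 + c) y\<close> and \<open>c\<close> different
  from \<open>0\<close> and \<open>-1\<close>.  Since \<open>det(u, v) = 1\<close>, \<open>f\<close> lies in the orbit of \<open>g\<close>, which is closed,
  being the set of all \<open>a x\<^sup>2 + b x y + e y\<^sup>2\<close> with \<open>b\<^sup>2 - 4 a e = 1\<close> (and, in characteristic two,
  \<open>b = 1\<close>).  If \<open>\<lambda>(t) \<cdot> g\<close> tended to \<open>f\<close>, then \<open>\<lambda>\<close> would fix \<open>f\<close>, hence preserve the lines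
  spanned by \<open>u\<close> and \<open>v\<close>, on which it acts with weights \<open>k\<close> and \<open>-k\<close>; here \<open>k\<close> is not \<open>0\<close>
  because \<open>f\<close> is not \<open>g\<close>.  Writing \<open>g = \<alpha> u\<^sup>2 + \<beta> u v + \<gamma> v\<^sup>2\<close>, existence of the limit forces
  \<open>\<alpha> = 0\<close> or \<open>\<gamma> = 0\<close>, so \<open>u\<close> or \<open>v\<close> would divide \<open>x y\<close>, which is not the case.
\<close>


section \<open>Arithmetic circuits and complexity classes\<close>

text \<open>
  A circuit is the list of its gates in topological order; \<open>Plus\<close> and \<open>Times\<close> refer to earlier
  positions, the last gate is the output, and the size is the number of gates.
\<close>

datatype 'a gate = Input nat | Constant 'a | Plus nat nat | Times nat nat

type_synonym 'a circuit = "'a gate list"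

definition wf_circuit :: "nat \<Rightarrow> 'a circuit \<Rightarrow> bool" where
  "wf_circuit N C \<longleftrightarrow> C \<noteq> [] \<and>
     (\<forall>p<length C. case C ! p of
          Input v \<Rightarrow> v < N
        | Constant c \<Rightarrow> True
        | Plus a b \<Rightarrow> a < p \<and> b < p
        | Times a b \<Rightarrow> a < p \<and> b < p)"

fun gate_val :: "('a \<Rightarrow> 's::comm_semiring_1) \<Rightarrow> (nat \<Rightarrow> 's) \<Rightarrow> 's list \<Rightarrow> 'a gate \<Rightarrow> 's" where
  "gate_val \<kappa> \<rho> vs (Input v) = \<rho> v"
| "gate_val \<kappa> \<rho> vs (Constant c) = \<kappa> c"
| "gate_val \<kappa> \<rho> vs (Plus a b) = vs ! a + vs ! b"
| "gate_val \<kappa> \<rho> vs (Times a b) = vs ! a * vs ! b"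

definition circuit_val ::
  "('a \<Rightarrow> 's::comm_semiring_1) \<Rightarrow> (nat \<Rightarrow> 's) \<Rightarrow> 'a circuit \<Rightarrow> 's" where
  "circuit_val \<kappa> \<rho> C = last (foldl (\<lambda>vs G. vs @ [gate_val \<kappa> \<rho> vs G]) [] C)"

definition poly_bounded :: "(nat \<Rightarrow> nat) \<Rightarrow> bool" where
  "poly_bounded a \<longleftrightarrow> (\<exists>q :: nat poly. \<forall>n. a n \<le> poly q n)"

text \<open>The families \<open>(g n)\<close>, with \<open>g n\<close> a polynomial in \<open>l n\<close> variables, that belong to VP.\<close>

definition VP :: "(nat \<Rightarrow> nat) \<Rightarrow> (nat \<Rightarrow> (nat, 'a::field) mpol) \<Rightarrow> bool" where
  "VP l g \<longleftrightarrow>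
     (\<forall>n. g n \<in> mpols (l n)) \<and> poly_bounded l \<and> poly_bounded (\<lambda>n. mdeg (g n)) \<and>
     (\<exists>C :: nat \<Rightarrow> 'a circuit. poly_bounded (\<lambda>n. length (C n)) \<and>
        (\<forall>n. wf_circuit (l n) (C n) \<and> circuit_val Cst Var (C n) = g n))"


section \<open>Degenerations of families\<close>

definition stable_degeneration ::
  "(nat \<Rightarrow> nat) \<Rightarrow> (nat \<Rightarrow> (nat, 'a::field) mpol) \<Rightarrow> (nat \<Rightarrow> (nat, 'a) mpol) \<Rightarrow> bool" where
  "stable_degeneration m f g \<longleftrightarrow>
     (\<forall>n. f n \<in> mpols (m n) \<and> g n \<in> mpols (m n) \<and> in_closed_orbit (m n) (g n) (f n))"

definition blen :: "nat \<Rightarrow> nat" where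
  "blen x = nat (bitlen (int x))"

definition bits :: "nat \<Rightarrow> nat \<Rightarrow> bool list" where
  "bits w x = map (bit x) [0..<w]"

text \<open>
  The binary encoding of \<open>(i, j, k)\<close> with \<open>i \<le> l\<close>, \<open>j \<le> m\<close> and \<open>-K \<le> k \<le> K\<close>: the digits of
  \<open>i\<close>, the digits of \<open>j\<close>, a sign bit for \<open>k\<close> and the digits of \<open>\<bar>k\<bar>\<close>, in blocks whose widths
  depend only on \<open>l\<close>, \<open>m\<close> and \<open>K\<close>.
\<close>

definition encode :: "nat \<Rightarrow> nat \<Rightarrow> nat \<Rightarrow> nat \<Rightarrow> nat \<Rightarrow> int \<Rightarrow> bool list" where
  "encode l m K i j k =
     bits (blen l) i @ bits (blen m) j @ [k < 0] @ bits (blen K) (nat \<bar>k\<bar>)"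

definition circuit_coeff ::
  "nat \<Rightarrow> nat \<Rightarrow> nat \<Rightarrow> 'a::field circuit \<Rightarrow> nat \<Rightarrow> nat \<Rightarrow> int \<Rightarrow> 'a" where
  "circuit_coeff l m K C i j k =
     circuit_val id (\<lambda>v. of_bool (encode l m K i j k ! v)) C"

text \<open>
  \<open>y\<^sub>i\<close> and \<open>x\<^sub>j\<close> are the variables with index \<open>i - 1\<close> and \<open>j - 1\<close>; the circuit receives the
  original \<open>i \<in> {1..l}\<close> and \<open>j \<in> {0..m}\<close>, where \<open>j = 0\<close> yields the constant term
  \<open>a\<^sup>i\<^sub>0\<close>.
\<close>

definition circuit_subst ::
  "nat \<Rightarrow> nat \<Rightarrow> nat \<Rightarrow> 'a::field circuit \<Rightarrow> (nat, 'a) mpol \<Rightarrow> (nat, 'a laurent) mpol" where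
  "circuit_subst l m K C g =
     (let a = (\<lambda>i j. \<Sum>k = - int K..int K. lconst (circuit_coeff l m K C i j k) * tpow k)
      in mp_subst (\<lambda>c. Cst (lconst c))
           (\<lambda>v. Cst (a (v + 1) 0) + (\<Sum>j = 1..m. Cst (a (v + 1) j) * Var (j - 1))) g)"

definition p_definable_degeneration ::
  "(nat \<Rightarrow> nat) \<Rightarrow> (nat \<Rightarrow> (nat, 'a::field) mpol) \<Rightarrow>
   (nat \<Rightarrow> nat) \<Rightarrow> (nat \<Rightarrow> (nat, 'a) mpol) \<Rightarrow> bool" where
  "p_definable_degeneration m f l g \<longleftrightarrow>
     (\<forall>n. f n \<in> mpols (m n) \<and> g n \<in> mpols (l n)) \<and>
     (\<exists>(K :: nat \<Rightarrow> nat) (q :: nat poly) (C :: nat \<Rightarrow> 'a circuit).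
        (\<lambda>n. real (K n)) \<in> O(\<lambda>n. 2 ^ poly q n) \<and>
        poly_bounded (\<lambda>n. length (C n)) \<and>
        (\<forall>n. wf_circuit (blen (l n) + blen (m n) + 1 + blen (K n)) (C n) \<and>
             has_limit (f n) (circuit_subst (l n) (m n) (K n) (C n) (g n))))"

definition poly2 :: "nat poly poly \<Rightarrow> nat \<Rightarrow> nat \<Rightarrow> nat" where
  "poly2 p a b = poly (poly p [:b:]) a"

end

theory Submission
  imports Defs "HOL-Computational_Algebra.Fraction_Field"
begin

text \<open>
  Let \<open>f\<close> lie in the closed orbit in the closure of the orbit of \<open>g\<close>.  Evaluating polynomials in the
  coefficients at \<open>f\<close> kills every relation satisfied by \<open>g(M x)\<close>, where \<open>M\<close> is the generic matrix of
  determinant one; by Chevalley's extension theorem this evaluation extends to a place of the field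
  of definition of \<open>M\<close>, with values in the algebraically closed ground field, under which
  \<open>g(M x)\<close> specializes to \<open>f\<close>.  Over the valuation ring \<open>M B = A D\<close> with \<open>A\<close> and \<open>B\<close> integral of
  determinant one and \<open>D\<close> diagonal.  Let \<open>A\<^sub>0\<close> and \<open>B\<^sub>0\<close> be the reductions of \<open>A\<close> and \<open>B\<close>.  If
  integer weights \<open>k\<close> give all relevant monomials the same signs as the valuations of the
  diagonal entries of \<open>D\<close> do, then \<open>g(A\<^sub>0 x)\<close> has no negative weights, \<open>f(B\<^sub>0 x)\<close> has no positive ones, and their
  parts of weight zero differ by an element of the diagonal torus.  So the limit of \<open>g(A\<^sub>0 t\<^sup>k x)\<close> lies in
  the closure of the orbit of \<open>f\<close>, which is that orbit.  This is the argument of Hilbert, Mumford and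
  Kempf with a general place instead of a curve.  Small weights \<open>k\<close> are found at a vertex of the
  polyhedron of admissible weights, where Cramer's rule bounds them.
  The entries of the resulting substitution are sums of at most \<open>m\<close> monomials in \<open>t\<close>, which a
  circuit recognizes by comparing its input with a table of encodings.
\<close>

section \<open>Polynomials and linear substitutions\<close>

text \<open>A curve into the orbit of \<open>g\<close> would give a discrete valuation, hence
  integer weights at once, but such a curve has to be produced by geometry. A place needs only
  Zorn's lemma; the price is a value group that can be any totally ordered abelian group. The
  valuations of the diagonal entries matter only through their signs on finitely many exponent
  vectors, bounded in terms of the degree of \<open>g\<close>, and such a finite system of signs can
  be realized by integers. The passage to small weights thus serves two ends: it creates the
  one-parameter subgroup and it bounds its degree. A second difficulty is that the entries of
  \<open>D\<close> need not have residues; a character of the group they generate, which exists by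
  divisibility, replaces them. The limit found in this way is only some point of the orbit of
  \<open>f\<close>. In the p-definable substitution the remaining group element is absorbed into the
  constant matrix on the right, so that there \<open>f\<close> itself is reached.\<close>

definition monom_eval :: "('v \<Rightarrow> 's::comm_monoid_mult) \<Rightarrow> ('v \<Rightarrow>\<^sub>0 nat) \<Rightarrow> 's" where
  "monom_eval \<rho> \<mu> = (\<Prod>v\<in>keys \<mu>. \<rho> v ^ lookup \<mu> v)"

lemma monom_eval_superset:
  assumes "finite S" "keys \<mu> \<subseteq> S"
  shows "monom_eval \<rho> \<mu> = (\<Prod>v\<in>S. \<rho> v ^ lookup \<mu> v)"
  unfolding monom_eval_def by (rule prod.mono_neutral_left) (use assms in \<open>auto simp: in_keys_iff\<close>)

lemma monom_eval_zero [simp]: "monom_eval \<rho> 0 = 1"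
  by (simp add: monom_eval_def)

lemma monom_eval_single [simp]: "monom_eval \<rho> (Poly_Mapping.single v n) = \<rho> v ^ n"
  by (cases "n = 0") (auto simp: monom_eval_def)

lemma monom_eval_add: "monom_eval \<rho> (\<mu> + \<nu>) = monom_eval \<rho> \<mu> * monom_eval \<rho> \<nu>"
proof -
  let ?S = "keys \<mu> \<union> keys \<nu>"
  have "monom_eval \<rho> (\<mu> + \<nu>) = (\<Prod>v\<in>?S. \<rho> v ^ lookup (\<mu> + \<nu>) v)"
    by (rule monom_eval_superset) (auto dest: subsetD[OF keys_add])
  also have "\<dots> = (\<Prod>v\<in>?S. \<rho> v ^ lookup \<mu> v) * (\<Prod>v\<in>?S. \<rho> v ^ lookup \<nu> v)"
    by (simp add: lookup_add power_add prod.distrib)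
  also have "\<dots> = monom_eval \<rho> \<mu> * monom_eval \<rho> \<nu>"
    by (subst (1 2) monom_eval_superset[of ?S]) auto
  finally show ?thesis .
qed

lemma monom_eval_mult: "monom_eval (\<lambda>v. a v * b v) \<mu> = monom_eval a \<mu> * monom_eval b \<mu>"
  by (simp add: monom_eval_def power_mult_distrib prod.distrib)

lemma poly_mapping_expand:
  assumes "finite S" "keys f \<subseteq> S"
  shows "(f :: 'k \<Rightarrow>\<^sub>0 'c::comm_monoid_add) = (\<Sum>\<mu>\<in>S. Poly_Mapping.single \<mu> (lookup f \<mu>))"
proof (rule poly_mapping_eqI)
  fix k
  have "lookup (\<Sum>\<mu>\<in>S. Poly_Mapping.single \<mu> (lookup f \<mu>)) k
      = (\<Sum>\<mu>\<in>S. if \<mu> = k then lookup f \<mu> else 0)"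
    by (auto simp: lookup_sum lookup_single when_def intro!: sum.cong)
  also have "\<dots> = lookup f k"
    using assms by (auto simp: in_keys_iff)
  finally show "lookup f k = lookup (\<Sum>\<mu>\<in>S. Poly_Mapping.single \<mu> (lookup f \<mu>)) k" ..
qed

lemma mp_subst_superset:
  assumes "\<kappa> 0 = 0" "finite S" "keys f \<subseteq> S"
  shows "mp_subst \<kappa> \<rho> f = (\<Sum>\<mu>\<in>S. \<kappa> (lookup f \<mu>) * monom_eval \<rho> \<mu>)"
  unfolding mp_subst_def monom_eval_def[symmetric]
  by (rule sum.mono_neutral_left) (use assms in \<open>auto simp: in_keys_iff\<close>)

lemma mp_subst_cong:
  assumes "\<And>\<mu> v. \<mu> \<in> keys f \<Longrightarrow> v \<in> keys \<mu> \<Longrightarrow> \<rho> v = \<rho>' v"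
    "\<And>\<mu>. \<mu> \<in> keys f \<Longrightarrow> \<kappa> (lookup f \<mu>) = \<kappa>' (lookup f \<mu>)"
  shows "mp_subst \<kappa> \<rho> f = mp_subst \<kappa>' \<rho>' f"
  unfolding mp_subst_def by (intro sum.cong arg_cong2[of _ _ _ _ "(*)"] prod.cong) (auto simp: assms)

context comm_ring_hom
begin

lemma mp_subst_add: "mp_subst hom \<rho> (f + g) = mp_subst hom \<rho> f + mp_subst hom \<rho> g"
proof -
  let ?S = "keys f \<union> keys g"
  have "mp_subst hom \<rho> (f + g) = (\<Sum>\<mu>\<in>?S. hom (lookup (f + g) \<mu>) * monom_eval \<rho> \<mu>)"
    by (rule mp_subst_superset) (auto dest: subsetD[OF keys_add])
  also have "\<dots> = (\<Sum>\<mu>\<in>?S. hom (lookup f \<mu>) * monom_eval \<rho> \<mu>) + (\<Sum>\<mu>\<in>?S. hom (lookup g \<mu>) * monom_eval \<rho> \<mu>)"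
    by (simp add: lookup_add hom_add distrib_right sum.distrib)
  also have "\<dots> = mp_subst hom \<rho> f + mp_subst hom \<rho> g"
    by (subst (1 2) mp_subst_superset[of _ ?S]) auto
  finally show ?thesis .
qed

lemma mp_subst_zero: "mp_subst hom \<rho> 0 = 0"
  by (simp add: mp_subst_def)

lemma mp_subst_single: "mp_subst hom \<rho> (Poly_Mapping.single \<mu> c) = hom c * monom_eval \<rho> \<mu>"
  by (cases "c = 0") (auto simp: mp_subst_def monom_eval_def)

lemma mp_subst_sum: "mp_subst hom \<rho> (\<Sum>x\<in>S. F x) = (\<Sum>x\<in>S. mp_subst hom \<rho> (F x))"
  by (induction S rule: infinite_finite_induct) (auto simp: mp_subst_zero mp_subst_add)

lemma mp_subst_mult: "mp_subst hom \<rho> (f * g) = mp_subst hom \<rho> f * mp_subst hom \<rho> g"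
proof -
  have "f * g = (\<Sum>\<mu>\<in>keys f. \<Sum>\<nu>\<in>keys g. Poly_Mapping.single (\<mu> + \<nu>) (lookup f \<mu> * lookup g \<nu>))"
    by (subst (1) poly_mapping_expand[of "keys f" f], simp, simp,
        subst (1) poly_mapping_expand[of "keys g" g], simp, simp)
      (simp add: sum_product mult_single)
  then have "mp_subst hom \<rho> (f * g) = (\<Sum>\<mu>\<in>keys f. \<Sum>\<nu>\<in>keys g.
      (hom (lookup f \<mu>) * monom_eval \<rho> \<mu>) * (hom (lookup g \<nu>) * monom_eval \<rho> \<nu>))"
    by (simp add: mp_subst_sum mp_subst_single hom_mult monom_eval_add ac_simps)
  then show ?thesis
    by (simp add: sum_product mp_subst_def monom_eval_def)
qed

lemma mp_subst_one: "mp_subst hom \<rho> 1 = 1"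
  by (metis mp_subst_single single_one monom_eval_zero hom_one mult_1)

lemma comm_ring_hom_mp_subst: "comm_ring_hom (mp_subst hom \<rho>)"
  by unfold_locales (auto simp: mp_subst_add mp_subst_mult mp_subst_one mp_subst_zero)

lemma mp_subst_Cst: "mp_subst hom \<rho> (Cst c) = hom c"
  by (simp add: Cst_def mp_subst_single)

lemma mp_subst_Var: "mp_subst hom \<rho> (Var v) = \<rho> v"
  by (simp add: Var_def mp_subst_single)

end

lemma hom_mon:
  assumes "comm_ring_hom h"
  shows "h (monom_eval \<rho> \<mu>) = monom_eval (\<lambda>v. h (\<rho> v)) \<mu>"
proof -
  interpret comm_ring_hom h by fact
  show ?thesis by (simp add: monom_eval_def hom_prod hom_power)
qed

lemma hom_mp_subst:
  assumes "comm_ring_hom h"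
  shows "h (mp_subst \<kappa> \<rho> f) = mp_subst (\<lambda>c. h (\<kappa> c)) (\<lambda>v. h (\<rho> v)) f"
proof -
  interpret comm_ring_hom h by fact
  show ?thesis
    unfolding mp_subst_def monom_eval_def[symmetric] by (simp add: hom_sum hom_mult hom_mon[OF assms])
qed

lemma mpolsD: "f \<in> mpols m \<Longrightarrow> \<mu> \<in> keys f \<Longrightarrow> v \<in> keys \<mu> \<Longrightarrow> v < m"
  by (auto simp: mpols_def)

lemma comm_ring_hom_Cst: "comm_ring_hom (Cst :: 'r::comm_ring_1 \<Rightarrow> ('v, 'r) mpol)"
  by unfold_locales (auto simp: Cst_def single_add mult_single)

lemma comm_ring_hom_lconst: "comm_ring_hom (lconst :: 'r::comm_ring_1 \<Rightarrow> 'r laurent)"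
  by unfold_locales (auto simp: lconst_def single_add mult_single)

lemma comm_ring_hom_id: "comm_ring_hom (id :: 'r::comm_ring_1 \<Rightarrow> 'r)"
  by unfold_locales auto

lemma comm_ring_hom_comp:
  "comm_ring_hom f \<Longrightarrow> comm_ring_hom g \<Longrightarrow> comm_ring_hom (\<lambda>x. f (g x))"
proof -
  assume "comm_ring_hom f" "comm_ring_hom g"
  then interpret f: comm_ring_hom f + g: comm_ring_hom g .
  show ?thesis
    by unfold_locales (auto simp: f.hom_add g.hom_add f.hom_mult g.hom_mult)
qed

section \<open>Linear substitutions and their composition\<close>

definition lin :: "nat \<Rightarrow> 'r::comm_ring_1 mat \<Rightarrow> nat \<Rightarrow> (nat, 'r) mpol" where
  "lin m M i = (\<Sum>j<m. Cst (M $$ (i, j)) * Var j)"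

text \<open>\<open>lsub m \<iota> M f\<close> is \<open>f(M x)\<close>, the coefficients of \<open>f\<close> being moved along \<open>\<iota>\<close>.\<close>

definition lsub :: "nat \<Rightarrow> ('a::comm_ring_1 \<Rightarrow> 'r::comm_ring_1) \<Rightarrow> 'r mat \<Rightarrow> (nat, 'a) mpol \<Rightarrow> (nat, 'r) mpol"
  where "lsub m \<iota> M f = mp_subst (\<lambda>c. Cst (\<iota> c)) (lin m M) f"

lemma act_eq_lsub: "act m \<sigma> f = lsub m id (minv \<sigma>) f"
  by (simp add: act_def lsub_def lin_def[abs_def])

lemma comm_ring_hom_lsub: "comm_ring_hom \<iota> \<Longrightarrow> comm_ring_hom (lsub m \<iota> M)"
  unfolding lsub_def
  by (rule comm_ring_hom.comm_ring_hom_mp_subst) (rule comm_ring_hom_comp[OF comm_ring_hom_Cst])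

lemma lsub_Cst: "comm_ring_hom \<iota> \<Longrightarrow> lsub m \<iota> M (Cst c) = Cst (\<iota> c)"
  unfolding lsub_def
  by (rule comm_ring_hom.mp_subst_Cst) (rule comm_ring_hom_comp[OF comm_ring_hom_Cst])

lemma lsub_Var: "comm_ring_hom \<iota> \<Longrightarrow> lsub m \<iota> M (Var v) = lin m M v"
  unfolding lsub_def
  by (rule comm_ring_hom.mp_subst_Var) (rule comm_ring_hom_comp[OF comm_ring_hom_Cst])

lemma lsub_lin:
  assumes "comm_ring_hom \<iota>" "N \<in> carrier_mat m m" "M \<in> carrier_mat m m" "i < m"
  shows "lsub m \<iota> M (lin m N i) = lin m (map_mat \<iota> N * M) i"
proof -
  interpret l: comm_ring_hom "lsub m \<iota> M" by (rule comm_ring_hom_lsub) fact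
  interpret C: comm_ring_hom Cst by (rule comm_ring_hom_Cst)
  have "lsub m \<iota> M (lin m N i) = (\<Sum>j<m. Cst (\<iota> (N $$ (i, j))) * (\<Sum>k<m. Cst (M $$ (j, k)) * Var k))"
    unfolding lin_def[of m N] l.hom_sum l.hom_mult lsub_Cst[OF assms(1)] lsub_Var[OF assms(1)]
    by (simp add: lin_def)
  also have "\<dots> = (\<Sum>k<m. (\<Sum>j<m. Cst (\<iota> (N $$ (i, j)) * M $$ (j, k))) * Var k)"
    unfolding sum_distrib_left sum_distrib_right C.hom_mult
    by (subst sum.swap) (simp add: mult.assoc)
  also have "\<dots> = lin m (map_mat \<iota> N * M) i"
    unfolding lin_def
    by (intro sum.cong) (use assms in \<open>auto simp: scalar_prod_def C.hom_sum atLeast0LessThan\<close>)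
  finally show ?thesis .
qed

text \<open>Substituting \<open>M x\<close> for \<open>x\<close> in \<open>f(N x)\<close> gives
  \<open>f(N M x)\<close>: later substitutions multiply on the right. Membership in
  \<open>mpols m\<close> confines the variables to the indices of the rows of
  \<open>N\<close>.\<close>

lemma lsub_lsub:
  assumes "comm_ring_hom \<kappa>" "N \<in> carrier_mat m m" "M \<in> carrier_mat m m" "f \<in> mpols m"
  shows "lsub m \<kappa> M (lsub m \<iota> N f) = lsub m (\<lambda>c. \<kappa> (\<iota> c)) (map_mat \<kappa> N * M) f"
proof -
  have "lsub m \<kappa> M (lsub m \<iota> N f) = mp_subst (\<lambda>c. lsub m \<kappa> M (Cst (\<iota> c))) (\<lambda>v. lsub m \<kappa> M (lin m N v)) f"
    unfolding lsub_def[of m \<iota>] by (rule hom_mp_subst) (rule comm_ring_hom_lsub[OF assms(1)])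
  also have "\<dots> = lsub m (\<lambda>c. \<kappa> (\<iota> c)) (map_mat \<kappa> N * M) f"
    unfolding lsub_def[of m "\<lambda>c. \<kappa> (\<iota> c)"]
    by (rule mp_subst_cong) (use assms in \<open>auto simp: mpolsD lsub_lin lsub_Cst\<close>)
  finally show ?thesis .
qed

lemma map_mat_id [simp]: "map_mat id M = M"
  by (rule eq_matI) auto

lemma lsub_id_lsub:
  assumes "N \<in> carrier_mat m m" "M \<in> carrier_mat m m" "f \<in> mpols m"
  shows "lsub m id M (lsub m \<iota> N f) = lsub m \<iota> (N * M) f"
  using lsub_lsub[OF comm_ring_hom_id assms, of \<iota>] by simp

lemma Var_power: "(Var v :: ('v, 'r::comm_ring_1) mpol) ^ n = Poly_Mapping.single (Poly_Mapping.single v n) 1"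
  by (induction n) (auto simp: Var_def mult_single single_add[symmetric])

lemma monom_eval_Var: "monom_eval Var \<mu> = (Poly_Mapping.single \<mu> 1 :: ('v, 'r::comm_ring_1) mpol)"
proof -
  have "(\<Prod>v\<in>S. Poly_Mapping.single (e v) 1) = (Poly_Mapping.single (\<Sum>v\<in>S. e v) 1 :: ('v, 'r) mpol)"
    for S and e :: "'v \<Rightarrow> 'v \<Rightarrow>\<^sub>0 nat"
    by (induction S rule: infinite_finite_induct) (auto simp: mult_single)
  then have "monom_eval Var \<mu> = (Poly_Mapping.single (\<Sum>v\<in>keys \<mu>. Poly_Mapping.single v (lookup \<mu> v)) 1 :: ('v, 'r) mpol)"
    by (simp add: monom_eval_def Var_power)
  then show ?thesis
    using poly_mapping_expand[of "keys \<mu>" \<mu>] by simp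
qed

lemma lin_diag: "i < m \<Longrightarrow> lin m (mat_diag m d) i = Cst (d i) * Var i"
proof -
  interpret C: comm_ring_hom Cst by (rule comm_ring_hom_Cst)
  assume "i < m"
  then have "lin m (mat_diag m d) i = (\<Sum>j<m. if j = i then Cst (d i) * Var i else 0)"
    unfolding lin_def by (intro sum.cong) (auto simp: mat_diag_def)
  with \<open>i < m\<close> show ?thesis by simp
qed

text \<open>Monomials are weight vectors of the torus, so a diagonal substitution scales each of
  them separately. Limits and valuations can therefore be studied coefficient by
  coefficient.\<close>

lemma lookup_lsub_diag:
  assumes "f \<in> mpols m" "comm_ring_hom \<iota>"
  shows "lookup (lsub m \<iota> (mat_diag m d) f) \<mu> = monom_eval d \<mu> * \<iota> (lookup f \<mu>)"
proof -
  interpret i: comm_ring_hom \<iota> by fact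
  have "lsub m \<iota> (mat_diag m d) f = mp_subst (\<lambda>c. Cst (\<iota> c)) (\<lambda>i. Cst (d i) * Var i) f"
    unfolding lsub_def by (rule mp_subst_cong) (use assms in \<open>auto simp: mpolsD lin_diag\<close>)
  also have "\<dots> = (\<Sum>\<mu>\<in>keys f. Poly_Mapping.single \<mu> (monom_eval d \<mu> * \<iota> (lookup f \<mu>)))"
    unfolding mp_subst_def monom_eval_def[symmetric] monom_eval_mult monom_eval_Var
      hom_mon[OF comm_ring_hom_Cst, symmetric]
    by (simp add: Cst_def mult_single mult.commute)
  also have "lookup \<dots> \<mu> = (\<Sum>\<nu>\<in>keys f. if \<nu> = \<mu> then monom_eval d \<mu> * \<iota> (lookup f \<mu>) else 0)"
    by (auto simp: lookup_sum lookup_single when_def intro!: sum.cong)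
  also have "\<dots> = monom_eval d \<mu> * \<iota> (lookup f \<mu>)"
    by (auto simp: in_keys_iff)
  finally show ?thesis .
qed

lemma lsub_one: "f \<in> mpols m \<Longrightarrow> lsub m id (1\<^sub>m m) f = f"
proof (rule poly_mapping_eqI)
  fix \<mu>
  assume f: "f \<in> mpols m"
  show "lookup (lsub m id (1\<^sub>m m) f) \<mu> = lookup f \<mu>"
    using lookup_lsub_diag[OF f comm_ring_hom_id, of "\<lambda>_. 1"] by (simp add: monom_eval_def)
qed

section \<open>Degree bounds under linear substitution\<close>

definition tdeg :: "('v \<Rightarrow>\<^sub>0 nat) \<Rightarrow> nat" where
  "tdeg \<mu> = (\<Sum>v\<in>keys \<mu>. lookup \<mu> v)"

lemma tdeg_add: "tdeg (\<mu> + \<nu>) = tdeg \<mu> + tdeg \<nu>"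
proof -
  have *: "tdeg \<mu> = (\<Sum>v\<in>S. lookup \<mu> v)" if "finite S" "keys \<mu> \<subseteq> S" for S and \<mu> :: "'a \<Rightarrow>\<^sub>0 nat"
    unfolding tdeg_def by (rule sum.mono_neutral_left) (use that in \<open>auto simp: in_keys_iff\<close>)
  let ?S = "keys \<mu> \<union> keys \<nu>"
  have "tdeg (\<mu> + \<nu>) = (\<Sum>v\<in>?S. lookup (\<mu> + \<nu>) v)"
    by (rule *) (auto dest: subsetD[OF keys_add])
  then show ?thesis
    by (simp add: lookup_add sum.distrib *[of ?S])
qed

definition mpols_le :: "nat \<Rightarrow> nat \<Rightarrow> (nat, 'r::zero) mpol set" where
  "mpols_le m n = {f. \<forall>\<mu>\<in>keys f. keys \<mu> \<subseteq> {..<m} \<and> tdeg \<mu> \<le> n}"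

lemma mpols_imp_mpols_le: "f \<in> mpols m \<Longrightarrow> f \<in> mpols_le m (mdeg f)"
  by (auto simp: mpols_def mpols_le_def mdeg_def tdeg_def intro!: Max_ge)

lemma mpols_le_imp_mpols: "f \<in> mpols_le m n \<Longrightarrow> f \<in> mpols m"
  by (auto simp: mpols_def mpols_le_def)

lemma mpols_le_add: "f \<in> mpols_le m n \<Longrightarrow> g \<in> mpols_le m n \<Longrightarrow> f + g \<in> mpols_le m n"
  using keys_add[of f g] by (auto simp: mpols_le_def)

lemma mpols_le_zero: "0 \<in> mpols_le m n"
  by (simp add: mpols_le_def)

lemma mpols_le_sum: "(\<And>x. x \<in> S \<Longrightarrow> F x \<in> mpols_le m n) \<Longrightarrow> (\<Sum>x\<in>S. F x) \<in> mpols_le m n"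
  by (induction S rule: infinite_finite_induct) (auto intro!: mpols_le_add simp: mpols_le_zero)

lemma mpols_le_mult:
  "f \<in> mpols_le m n \<Longrightarrow> g \<in> mpols_le m k \<Longrightarrow> f * g \<in> mpols_le m (n + k)"
  unfolding mpols_le_def
proof (safe)
  fix \<mu>
  assume f: "\<forall>\<mu>\<in>keys f. keys \<mu> \<subseteq> {..<m} \<and> tdeg \<mu> \<le> n"
    and g: "\<forall>\<mu>\<in>keys g. keys \<mu> \<subseteq> {..<m} \<and> tdeg \<mu> \<le> k" and \<mu>: "\<mu> \<in> keys (f * g)"
  obtain a b where ab: "\<mu> = a + b" "a \<in> keys f" "b \<in> keys g"
    using keys_mult[of f g] \<mu> by blast
  show "tdeg \<mu> \<le> n + k" using f g ab by (auto simp: tdeg_add intro: add_mono)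
  fix x assume "x \<in> keys \<mu>"
  then show "x < m" using f g ab keys_add[of a b] by blast
qed

lemma mpols_le_mono: "n \<le> k \<Longrightarrow> f \<in> mpols_le m n \<Longrightarrow> f \<in> mpols_le m k"
  by (auto simp: mpols_le_def)

lemma mpols_le_Cst: "Cst c \<in> mpols_le m n"
  by (auto simp: mpols_le_def Cst_def tdeg_def split: if_splits)

lemma mpols_le_one: "1 \<in> mpols_le m n"
  by (simp add: mpols_le_def tdeg_def)

lemma mpols_le_power: "f \<in> mpols_le m 1 \<Longrightarrow> f ^ n \<in> mpols_le m n"
  using mpols_le_mult[of f m 1]
  by (induction n) (auto simp: mpols_le_one)

lemma mpols_le_mon:
  assumes "\<And>v. v \<in> keys \<mu> \<Longrightarrow> \<rho> v \<in> mpols_le m 1"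
  shows "monom_eval \<rho> \<mu> \<in> mpols_le m (tdeg \<mu>)"
proof -
  have "(\<Prod>v\<in>S. \<rho> v ^ lookup \<mu> v) \<in> mpols_le m (\<Sum>v\<in>S. lookup \<mu> v)" if "S \<subseteq> keys \<mu>" for S
    using finite_subset[OF that finite_keys] that
  proof (induction S rule: finite_induct)
    case empty
    show ?case by (simp add: mpols_le_one)
  next
    case (insert x S)
    then show ?case
      by (auto intro!: mpols_le_mult mpols_le_power assms)
  qed
  then show ?thesis by (simp add: monom_eval_def tdeg_def)
qed

lemma mpols_le_lin: "lin m M i \<in> mpols_le m 1"
proof -
  have "(Var j :: (nat, 'a) mpol) \<in> mpols_le m 1" if "j < m" for j
    using that by (auto simp: mpols_le_def Var_def tdeg_def split: if_splits)
  then show ?thesis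
    unfolding lin_def
    by (intro mpols_le_sum) (use mpols_le_mult[OF mpols_le_Cst[of _ m 0]] in fastforce)
qed

text \<open>The bound does not depend on \<open>M\<close>. It confines the exponents of every
  \<open>g(A x)\<close> to a box determined by the degree of \<open>g\<close>, to which the weights
  have to be adapted.\<close>

lemma mpols_le_lsub: "f \<in> mpols_le m n \<Longrightarrow> lsub m \<iota> M f \<in> mpols_le m n"
  unfolding lsub_def mp_subst_def monom_eval_def[symmetric]
proof (rule mpols_le_sum)
  fix \<mu> assume "f \<in> mpols_le m n" "\<mu> \<in> keys f"
  then have "tdeg \<mu> \<le> n" by (auto simp: mpols_le_def)
  moreover have "Cst (\<iota> (lookup f \<mu>)) * monom_eval (lin m M) \<mu> \<in> mpols_le m (0 + tdeg \<mu>)"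
    by (intro mpols_le_mult mpols_le_Cst mpols_le_mon mpols_le_lin)
  ultimately show "Cst (\<iota> (lookup f \<mu>)) * monom_eval (lin m M) \<mu> \<in> mpols_le m n"
    by (auto intro: mpols_le_mono)
qed

lemma mpols_lsub: "f \<in> mpols m \<Longrightarrow> lsub m \<iota> M f \<in> mpols m"
  by (blast intro: mpols_le_imp_mpols mpols_le_lsub mpols_imp_mpols_le)

section \<open>Places\<close>

text \<open>
  A subring of the product of a ring and the field \<open>'a\<close> that contains the diagonal copy of
  \<open>'a\<close> along \<open>\<iota>\<close>.  If it is functional, it is the graph of a homomorphism from a subring to
  \<open>'a\<close>, which is a place if the subring is a valuation ring.
\<close>

locale place_rel =
  fixes \<iota> :: "'a::field \<Rightarrow> 'r::comm_ring_1" and \<Gamma> :: "('r \<times> 'a) set"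
  assumes hom_\<iota>: "comm_ring_hom \<iota>"
    and const: "(\<iota> c, c) \<in> \<Gamma>"
    and add: "(a, x) \<in> \<Gamma> \<Longrightarrow> (b, y) \<in> \<Gamma> \<Longrightarrow> (a + b, x + y) \<in> \<Gamma>"
    and mult: "(a, x) \<in> \<Gamma> \<Longrightarrow> (b, y) \<in> \<Gamma> \<Longrightarrow> (a * b, x * y) \<in> \<Gamma>"
begin

lemma zero: "(0, 0) \<in> \<Gamma>" and one: "(1, 1) \<in> \<Gamma>"
proof -
  interpret comm_ring_hom \<iota> by (rule hom_\<iota>)
  show "(0, 0) \<in> \<Gamma>" "(1, 1) \<in> \<Gamma>" using const[of 0] const[of 1] by auto
qed

lemma uminus: "(a, x) \<in> \<Gamma> \<Longrightarrow> (- a, - x) \<in> \<Gamma>"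
proof -
  interpret comm_ring_hom \<iota> by (rule hom_\<iota>)
  assume "(a, x) \<in> \<Gamma>"
  from mult[OF const[of "-1"] this] show ?thesis by (simp add: hom_uminus)
qed

lemma diff: "(a, x) \<in> \<Gamma> \<Longrightarrow> (b, y) \<in> \<Gamma> \<Longrightarrow> (a - b, x - y) \<in> \<Gamma>"
  using add[OF _ uminus, of a x b y] by simp

lemma sum: "(\<And>i. i \<in> S \<Longrightarrow> (F i, G i) \<in> \<Gamma>) \<Longrightarrow> (\<Sum>i\<in>S. F i, \<Sum>i\<in>S. G i) \<in> \<Gamma>"
  by (induction S rule: infinite_finite_induct) (auto intro: zero add)

lemma prod: "(\<And>i. i \<in> S \<Longrightarrow> (F i, G i) \<in> \<Gamma>) \<Longrightarrow> (\<Prod>i\<in>S. F i, \<Prod>i\<in>S. G i) \<in> \<Gamma>"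
  by (induction S rule: infinite_finite_induct) (auto intro: one mult)

lemma power: "(a, x) \<in> \<Gamma> \<Longrightarrow> (a ^ n, x ^ n) \<in> \<Gamma>"
  by (induction n) (auto intro: one mult)

lemma monom_eval: "(\<And>v. v \<in> keys \<mu> \<Longrightarrow> (\<rho> v, \<sigma> v) \<in> \<Gamma>) \<Longrightarrow> (monom_eval \<rho> \<mu>, monom_eval \<sigma> \<mu>) \<in> \<Gamma>"
  unfolding monom_eval_def by (intro prod power) auto

lemma mp_subst:
  "(\<And>\<mu> v. \<mu> \<in> keys P \<Longrightarrow> v \<in> keys \<mu> \<Longrightarrow> (\<rho> v, \<sigma> v) \<in> \<Gamma>) \<Longrightarrow> (mp_subst \<iota> \<rho> P, mp_subst id \<sigma> P) \<in> \<Gamma>"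
  unfolding mp_subst_def monom_eval_def[symmetric] by (intro sum mult monom_eval) (auto simp: const)

text \<open>Specialization is kept as a relation so that one set of lemmas serves evaluation of a
  generic matrix, reduction at a place and limits at \<open>t = 0\<close>.\<close>

definition prel :: "('v, 'r) mpol \<Rightarrow> ('v, 'a) mpol \<Rightarrow> bool" where
  "prel F f \<longleftrightarrow> (\<forall>\<mu>. (lookup F \<mu>, lookup f \<mu>) \<in> \<Gamma>)"

lemma prel_zero: "prel 0 0"
  by (simp add: prel_def zero)

lemma prel_add: "prel F f \<Longrightarrow> prel G g \<Longrightarrow> prel (F + G) (f + g)"
  by (simp add: prel_def lookup_add add)

lemma prel_sum: "(\<And>i. i \<in> S \<Longrightarrow> prel (F i) (G i)) \<Longrightarrow> prel (\<Sum>i\<in>S. F i) (\<Sum>i\<in>S. G i)"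
  by (induction S rule: infinite_finite_induct) (auto intro: prel_zero prel_add)

lemma prel_single: "(a, x) \<in> \<Gamma> \<Longrightarrow> prel (Poly_Mapping.single \<mu> a) (Poly_Mapping.single \<mu> x)"
  by (simp add: prel_def lookup_single when_def zero)

lemma prel_Cst: "(a, x) \<in> \<Gamma> \<Longrightarrow> prel (Cst a) (Cst x)"
  by (simp add: Cst_def prel_single)

lemma prel_Var: "prel (Var v) (Var v)"
  by (simp add: Var_def prel_single one)

lemma prel_mult:
  fixes F G :: "('v, 'r) mpol" and f g :: "('v, 'a) mpol"
  shows "prel F f \<Longrightarrow> prel G g \<Longrightarrow> prel (F * G) (f * g)"
proof -
  assume F: "prel F f" and G: "prel G g"
  \<comment> \<open>A nonzero coefficient may be related to 0, so related polynomials can have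
    different supports.\<close>
  let ?S = "keys F \<union> keys f" and ?T = "keys G \<union> keys g"
  have expand: "p * q = (\<Sum>\<mu>\<in>?S. \<Sum>\<nu>\<in>?T. Poly_Mapping.single (\<mu> + \<nu>) (lookup p \<mu> * lookup q \<nu>))"
    if "keys p \<subseteq> ?S" "keys q \<subseteq> ?T" for p q :: "('v \<Rightarrow>\<^sub>0 nat) \<Rightarrow>\<^sub>0 'c::comm_ring_1"
    by (subst (1) poly_mapping_expand[of ?S p], simp, rule that,
        subst (1) poly_mapping_expand[of ?T q], simp, rule that)
      (simp add: sum_product mult_single)
  have "(lookup F \<mu>, lookup f \<mu>) \<in> \<Gamma>" "(lookup G \<mu>, lookup g \<mu>) \<in> \<Gamma>" for \<mu>
    using F G by (auto simp: prel_def)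
  then show ?thesis
    by (subst (1 2) expand) (auto intro!: prel_sum prel_single mult)
qed

lemma prel_one: "prel 1 1"
  using prel_Cst[OF one] by (simp add: Cst_def)

lemma prel_prod: "(\<And>i. i \<in> S \<Longrightarrow> prel (F i) (G i)) \<Longrightarrow> prel (\<Prod>i\<in>S. F i) (\<Prod>i\<in>S. G i)"
  by (induction S rule: infinite_finite_induct) (auto intro: prel_one prel_mult)

lemma prel_power: "prel F f \<Longrightarrow> prel (F ^ n) (f ^ n)"
  by (induction n) (auto intro: prel_one prel_mult)

definition mrel :: "nat \<Rightarrow> 'r mat \<Rightarrow> 'a mat \<Rightarrow> bool" where
  "mrel m M N \<longleftrightarrow> (\<forall>i<m. \<forall>j<m. (M $$ (i, j), N $$ (i, j)) \<in> \<Gamma>)"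

lemma prel_lin: "mrel m M N \<Longrightarrow> i < m \<Longrightarrow> prel (lin m M i) (lin m N i)"
  unfolding lin_def by (intro prel_sum prel_mult prel_Cst prel_Var) (simp add: mrel_def)

lemma prel_lsub: "mrel m M N \<Longrightarrow> f \<in> mpols m \<Longrightarrow> prel (lsub m \<iota> M f) (lsub m id N f)"
  unfolding lsub_def mp_subst_def
  by (intro prel_sum prel_mult prel_prod prel_power prel_lin prel_Cst) (auto dest: mpolsD simp: const)

text \<open>In \<open>prel_lsub\<close> the coefficients are constants moved along
  \<open>\<iota>\<close>; here they are elements of the larger ring that specialize themselves, as
  happens when a second substitution is applied.\<close>

lemma prel_lsub_id:
  assumes "mrel m M N" "f \<in> mpols m" "F \<in> mpols m" "prel F f"
  shows "prel (lsub m id M F) (lsub m id N f)"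
proof -
  let ?S = "keys F \<union> keys f"
  interpret C: comm_ring_hom "Cst :: 'r \<Rightarrow> _" by (rule comm_ring_hom_Cst)
  interpret D: comm_ring_hom "Cst :: 'a \<Rightarrow> _" by (rule comm_ring_hom_Cst)
  have "lsub m id M F = (\<Sum>\<mu>\<in>?S. Cst (lookup F \<mu>) * monom_eval (lin m M) \<mu>)"
    unfolding lsub_def by (subst mp_subst_superset[of _ ?S]) auto
  moreover have "lsub m id N f = (\<Sum>\<mu>\<in>?S. Cst (lookup f \<mu>) * monom_eval (lin m N) \<mu>)"
    unfolding lsub_def by (subst mp_subst_superset[of _ ?S]) auto
  moreover have "prel (monom_eval (lin m M) \<mu>) (monom_eval (lin m N) \<mu>)" if "\<mu> \<in> ?S" for \<mu>
    unfolding monom_eval_def using that assms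
    by (intro prel_prod prel_power prel_lin) (auto dest: mpolsD)
  ultimately show ?thesis
    using assms(4) by (auto intro!: prel_sum prel_mult prel_Cst simp: prel_def[of F])
qed

lemma det_rel:
  assumes "M \<in> carrier_mat m m" "N \<in> carrier_mat m m" "mrel m M N"
  shows "(det M, det N) \<in> \<Gamma>"
proof -
  have s: "(signof p, signof p) \<in> \<Gamma>" for p :: "nat \<Rightarrow> nat"
    using one uminus[OF one] by (simp add: sign_def)
  show ?thesis
    unfolding det_def'[OF assms(1)] det_def'[OF assms(2)]
    by (intro sum mult prod s) (use assms(3) in \<open>auto simp: mrel_def permutes_in_image\<close>)
qed

text \<open>Minors are determinants, hence polynomial in the entries, so the adjugate specializes;
  for determinant one it stands in for the inverse.\<close>

lemma mrel_adj:
  assumes "M \<in> carrier_mat m m" "N \<in> carrier_mat m m" "mrel m M N"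
  shows "mrel m (adj_mat M) (adj_mat N)"
  unfolding mrel_def
proof (intro allI impI)
  fix i j assume ij: "i < m" "j < m"
  have "(det (mat_delete M j i), det (mat_delete N j i)) \<in> \<Gamma>"
    by (rule det_rel[of _ "m - 1"]) (use assms ij in \<open>auto simp: mat_delete_def mrel_def\<close>)
  then have "(cofactor M j i, cofactor N j i) \<in> \<Gamma>"
    unfolding cofactor_def by (intro mult power uminus one)
  then show "(adj_mat M $$ (i, j), adj_mat N $$ (i, j)) \<in> \<Gamma>"
    using assms ij by (simp add: adj_mat_def)
qed

end

text \<open>Two values of one element differ by a value of 0 when the relation is closed under
  subtraction, so single-valuedness need only be tested over 0.\<close>

definition functional_rel :: "('r::zero \<times> 'a::zero) set \<Rightarrow> bool" where
  "functional_rel \<Gamma> \<longleftrightarrow> (\<forall>c. (0, c) \<in> \<Gamma> \<longrightarrow> c = 0)"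

lemma functional_relD: "functional_rel \<Gamma> \<Longrightarrow> (0, c) \<in> \<Gamma> \<Longrightarrow> c = 0"
  by (auto simp: functional_rel_def)

section \<open>Adjoining an element with a prescribed value\<close>

context place_rel
begin

lemma functional_eq:
  assumes "functional_rel \<Gamma>" "(a, x) \<in> \<Gamma>" "(a, y) \<in> \<Gamma>"
  shows "x = y"
proof -
  have "(0, x - y) \<in> \<Gamma>" using diff[OF assms(2,3)] by simp
  then have "x - y = 0" by (rule functional_relD[OF assms(1)])
  then show ?thesis by simp
qed

definition coeffs_rel :: "'r poly \<Rightarrow> 'a poly \<Rightarrow> bool" where
  "coeffs_rel P Q \<longleftrightarrow> (\<forall>i. (coeff P i, coeff Q i) \<in> \<Gamma>)"

lemma coeffs_rel_const: "(a, x) \<in> \<Gamma> \<Longrightarrow> coeffs_rel [:a:] [:x:]"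
  by (auto simp: coeffs_rel_def coeff_pCons zero split: nat.splits)

lemma coeffs_rel_add: "coeffs_rel P Q \<Longrightarrow> coeffs_rel P' Q' \<Longrightarrow> coeffs_rel (P + P') (Q + Q')"
  by (simp add: coeffs_rel_def add)

lemma coeffs_rel_mult: "coeffs_rel P Q \<Longrightarrow> coeffs_rel P' Q' \<Longrightarrow> coeffs_rel (P * P') (Q * Q')"
  by (auto simp: coeffs_rel_def coeff_mult intro!: sum mult)

lemma coeffs_rel_map_poly: "coeffs_rel (map_poly \<iota> Q) Q"
proof -
  interpret comm_ring_hom \<iota> by (rule hom_\<iota>)
  show ?thesis by (simp add: coeffs_rel_def coeff_map_poly const)
qed

text \<open>The subring of the product generated by \<open>\<Gamma>\<close> and
  \<open>(x, c)\<close>: a polynomial over \<open>\<Gamma>\<close> is a pair of related polynomials,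
  evaluated at the two coordinates.\<close>

definition adjoin :: "'r \<Rightarrow> 'a \<Rightarrow> ('r \<times> 'a) set" where
  "adjoin x c = {(poly P x, poly Q c) |P Q. coeffs_rel P Q}"

lemma adjoin_superset: "\<Gamma> \<subseteq> adjoin x c"
proof safe
  fix a b assume "(a, b) \<in> \<Gamma>"
  from coeffs_rel_const[OF this] show "(a, b) \<in> adjoin x c"
    unfolding adjoin_def by force
qed

lemma adjoin_self: "(x, c) \<in> adjoin x c"
proof -
  have "coeffs_rel [:0, 1:] [:0, 1:]"
    by (auto simp: coeffs_rel_def coeff_pCons zero one split: nat.splits)
  then show ?thesis unfolding adjoin_def by force
qed

lemma place_rel_adjoin: "place_rel \<iota> (adjoin x c)"
proof (rule place_rel.intro)
  show "(\<iota> k, k) \<in> adjoin x c" for k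
    using adjoin_superset const by blast
  fix a y b z assume "(a, y) \<in> adjoin x c" "(b, z) \<in> adjoin x c"
  then obtain P Q P' Q' where *: "coeffs_rel P Q" "coeffs_rel P' Q'"
    "a = poly P x" "y = poly Q c" "b = poly P' x" "z = poly Q' c"
    unfolding adjoin_def by blast
  show "(a + b, y + z) \<in> adjoin x c"
    unfolding adjoin_def using coeffs_rel_add[OF *(1,2)] * by force
  show "(a * b, y * z) \<in> adjoin x c"
    unfolding adjoin_def using coeffs_rel_mult[OF *(1,2)] * by force
qed (rule hom_\<iota>)

end

text \<open>A nonzero ideal is generated by an element of least degree; if the ideal is proper, this
  generator is nonconstant and has a root. Such a root will be the value given to a newly adjoined
  element.\<close>

lemma ideal_common_root:
  fixes I :: "'a::alg_closed_field poly set"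
  assumes add: "\<And>p q. p \<in> I \<Longrightarrow> q \<in> I \<Longrightarrow> p + q \<in> I"
    and mult: "\<And>p q. p \<in> I \<Longrightarrow> p * q \<in> I"
    and proper: "1 \<notin> I"
  obtains c where "\<And>p. p \<in> I \<Longrightarrow> poly p c = 0"
proof (cases "I \<subseteq> {0}")
  case True
  then have "poly p 0 = 0" if "p \<in> I" for p using that by auto
  then show ?thesis by (rule that)
next
  case False
  then obtain p0 where "p0 \<in> I \<and> p0 \<noteq> 0" by blast
  then obtain p where p: "p \<in> I" "p \<noteq> 0" and min: "\<And>q. q \<in> I \<Longrightarrow> q \<noteq> 0 \<Longrightarrow> degree p \<le> degree q"
    using ex_has_least_nat[of "\<lambda>p. p \<in> I \<and> p \<noteq> 0" p0 degree] by blast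
  have "degree p > 0"
  proof (rule ccontr)
    assume "\<not> 0 < degree p"
    then obtain a where a: "p = [:a:]" by (auto elim: degree_eq_zeroE)
    with mult[OF p(1), of "[:inverse a:]"] p(2) have "[:1:] \<in> I" by simp
    with proper show False by (simp add: one_pCons)
  qed
  then obtain c where c: "poly p c = 0" using alg_closed_imp_poly_has_root by blast
  have "poly q c = 0" if "q \<in> I" for q
  proof -
    have "q + p * (- (q div p)) \<in> I" by (intro add mult p that)
    then have "q mod p \<in> I" by (simp add: minus_mult_div_eq_mod[symmetric])
    then have "q mod p = 0"
      using min[of "q mod p"] degree_mod_less[of p q] p(2) by fastforce
    then have "p dvd q" by auto
    with c show ?thesis by (auto elim!: dvdE)
  qed
  then show ?thesis by (rule that)
qed

text \<open>The coefficients of \<open>P - 1\<close> are related to 0. A root \<open>x\<close> of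
  such a \<open>P\<close> witnesses that the kernel of the reduction generates the unit ideal once
  \<open>x\<close> is adjoined.\<close>

definition (in place_rel) red_one :: "'r poly \<Rightarrow> bool" where
  "red_one P \<longleftrightarrow> coeffs_rel P 1"

lemma (in place_rel) red_one_iff: "red_one P \<longleftrightarrow> (\<forall>i. (coeff P i, if i = 0 then 1 else 0) \<in> \<Gamma>)"
  by (simp add: red_one_def coeffs_rel_def coeff_1 of_bool_def)

text \<open>Reversing \<open>Q\<close> puts \<open>coeff Q 0\<close>, which reduces to 1, in front
  of the highest power, so a multiple of the reversed polynomial can cancel the leading term of
  \<open>P\<close> without division.\<close>

lemma (in place_rel) red_one_descent:
  fixes x y :: 'r
  assumes fn: "functional_rel \<Gamma>"
    and P: "red_one P" "poly P x = 0" and Q: "red_one Q" "poly (reflect_poly Q) x = 0"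
    and le: "degree Q \<le> degree P"
  shows "\<exists>P'. red_one P' \<and> poly P' x = 0 \<and> degree P' < degree P"
proof -
  define n k where "n = degree P" and "k = degree Q"
  have cP: "(coeff P i, if i = 0 then 1 else 0) \<in> \<Gamma>" for i
    using P(1) by (simp add: red_one_iff)
  have cQ: "(coeff Q i, if i = 0 then 1 else 0) \<in> \<Gamma>" for i
    using Q(1) by (simp add: red_one_iff)
  have n: "n > 0"
  proof (rule ccontr)
    assume "\<not> n > 0"
    then obtain a where "P = [:a:]" unfolding n_def by (auto elim: degree_eq_zeroE)
    with P(2) cP[of 0] have "(0, 1) \<in> \<Gamma>" by simp
    then show False using functional_relD[OF fn, of 1] by simp
  qed
  define S where "S = monom 1 (n - k) * reflect_poly Q"
  define P' where "P' = smult (coeff Q 0) P - smult (coeff P n) S"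
  have cS: "\<exists>e. (coeff S i, e) \<in> \<Gamma>" for i
    using zero cQ by (auto simp: S_def coeff_monom_mult coeff_reflect_poly)
  have cS0: "coeff S i = 0" if "i > n" for i
    using that le by (auto simp: S_def coeff_monom_mult coeff_reflect_poly n_def k_def)
  have cSn: "coeff S n = coeff Q 0"
    using le by (simp add: S_def coeff_monom_mult coeff_reflect_poly n_def k_def)
  have "(coeff P' i, if i = 0 then 1 else 0) \<in> \<Gamma>" for i
  proof -
    obtain e where e: "(coeff S i, e) \<in> \<Gamma>" using cS by blast
    have "(coeff Q 0 * coeff P i - coeff P n * coeff S i, 1 * (if i = 0 then 1 else 0) - 0 * e) \<in> \<Gamma>"
      using cQ[of 0] cP[of n] n by (intro diff mult cP e) auto
    then show ?thesis by (simp add: P'_def)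
  qed
  then have "red_one P'"
    by (simp add: red_one_iff)
  moreover have "poly P' x = 0"
    using P(2) Q(2) by (simp add: P'_def S_def)
  moreover have "degree P' < n"
  proof -
    have "coeff P' i = 0" if "i \<ge> n" for i
      using that cS0[of i] cSn coeff_eq_0[of P i]
      by (cases "i = n") (auto simp: P'_def n_def)
    then have "degree P' \<le> n - 1" by (intro degree_le) auto
    with n show ?thesis by simp
  qed
  ultimately show ?thesis unfolding n_def by blast
qed

text \<open>
  A maximal functional relation is a valuation ring: if \<open>x\<close> cannot be adjoined with any value, then \<open>x\<close>
  is a root of a polynomial reducing to \<open>1\<close>; two such polynomials for \<open>x\<close> and \<open>1 / x\<close> would reduce
  each other's degrees forever.
\<close>

theorem place_extension:
  fixes \<iota> :: "'a::alg_closed_field \<Rightarrow> 'k::field"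
  assumes "place_rel \<iota> \<Gamma>0" "functional_rel \<Gamma>0"
  obtains \<Gamma> where "\<Gamma>0 \<subseteq> \<Gamma>" "place_rel \<iota> \<Gamma>" "functional_rel \<Gamma>"
    "\<And>x. x \<in> Domain \<Gamma> \<or> (inverse x, 0) \<in> \<Gamma>"
proof -
  define \<A> where "\<A> = {\<Gamma>. \<Gamma>0 \<subseteq> \<Gamma> \<and> place_rel \<iota> \<Gamma> \<and> functional_rel \<Gamma>}"
  have "\<exists>\<Gamma>\<in>\<A>. \<forall>\<Delta>\<in>\<A>. \<Gamma> \<subseteq> \<Delta> \<longrightarrow> \<Delta> = \<Gamma>"
  proof (rule subset_Zorn_nonempty)
    show "\<A> \<noteq> {}" using assms by (auto simp: \<A>_def)
    fix \<C> assume \<C>: "\<C> \<noteq> {}" "subset.chain \<A> \<C>"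
    then have sub: "\<C> \<subseteq> \<A>" by (simp add: subset_chain_def)
    have dir: "\<exists>D\<in>\<C>. u \<in> D \<and> v \<in> D" if "u \<in> \<Union>\<C>" "v \<in> \<Union>\<C>" for u v
    proof -
      from that obtain D E where "D \<in> \<C>" "u \<in> D" "E \<in> \<C>" "v \<in> E" by blast
      moreover from this have "D \<subseteq> E \<or> E \<subseteq> D" using \<C>(2) by (auto simp: subset_chain_def)
      ultimately show ?thesis by blast
    qed
    have "place_rel \<iota> (\<Union>\<C>)"
    proof (rule place_rel.intro)
      show "comm_ring_hom \<iota>" using assms(1) by (simp add: place_rel_def)
      show "(\<iota> c, c) \<in> \<Union>\<C>" for c
        using \<C>(1) sub by (auto simp: \<A>_def intro: place_rel.const)
      fix a x b y assume "(a, x) \<in> \<Union>\<C>" "(b, y) \<in> \<Union>\<C>"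
      then obtain D where "D \<in> \<C>" "(a, x) \<in> D" "(b, y) \<in> D" using dir by blast
      moreover from this have "place_rel \<iota> D" using sub by (auto simp: \<A>_def)
      ultimately show "(a + b, x + y) \<in> \<Union>\<C>" "(a * b, x * y) \<in> \<Union>\<C>"
        by (auto intro: place_rel.add place_rel.mult)
    qed
    moreover have "functional_rel (\<Union>\<C>)"
      using sub by (auto simp: \<A>_def functional_rel_def)
    moreover have "\<Gamma>0 \<subseteq> \<Union>\<C>" using \<C>(1) sub by (auto simp: \<A>_def)
    ultimately show "\<Union>\<C> \<in> \<A>" by (simp add: \<A>_def)
  qed
  then obtain \<Gamma> where \<Gamma>: "\<Gamma>0 \<subseteq> \<Gamma>" "place_rel \<iota> \<Gamma>" "functional_rel \<Gamma>"
    and max: "\<And>\<Delta>. \<Gamma>0 \<subseteq> \<Delta> \<Longrightarrow> place_rel \<iota> \<Delta> \<Longrightarrow> functional_rel \<Delta> \<Longrightarrow> \<Gamma> \<subseteq> \<Delta> \<Longrightarrow> \<Delta> = \<Gamma>"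
    by (auto simp: \<A>_def)
  interpret place_rel \<iota> \<Gamma> by fact
  have outside: "\<exists>P. red_one P \<and> poly P x = 0" if x: "x \<notin> Domain \<Gamma>" for x
  proof (rule ccontr)
    assume no: "\<not> ?thesis"
    \<comment> \<open>\<open>I\<close> is the ideal of conditions that the relations for
      \<open>x\<close> impose on a value \<open>c\<close>; it is proper because \<open>no\<close>
      excludes a polynomial reducing to 1 with root \<open>x\<close>.\<close>
    define I where "I = {Q. \<exists>P. coeffs_rel P Q \<and> poly P x = 0}"
    obtain c where c: "\<And>Q. Q \<in> I \<Longrightarrow> poly Q c = 0"
    proof (rule ideal_common_root[of I])
      fix p q assume p: "p \<in> I"
      then obtain P where P: "coeffs_rel P p" "poly P x = 0" by (auto simp: I_def)
      show "p * q \<in> I"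
        unfolding I_def using coeffs_rel_mult[OF P(1) coeffs_rel_map_poly[of q]] P(2) by force
      assume "q \<in> I"
      then obtain Q where Q: "coeffs_rel Q q" "poly Q x = 0" by (auto simp: I_def)
      show "p + q \<in> I"
        unfolding I_def using coeffs_rel_add[OF P(1) Q(1)] P(2) Q(2) by force
    qed (use no that in \<open>auto simp: I_def red_one_def\<close>)
    have "functional_rel (adjoin x c)"
      using c by (auto simp: functional_rel_def adjoin_def I_def)
    then have "adjoin x c = \<Gamma>"
      by (intro max place_rel_adjoin) (use \<Gamma>(1) adjoin_superset in auto)
    with adjoin_self[of x c] x show False by blast
  qed
  have nopair: False if "red_one P" "poly P x = 0" "red_one Q" "poly Q (inverse x) = 0" "x \<noteq> 0" for P Q x
    using that
  proof (induction "degree P + degree Q" arbitrary: P Q x rule: less_induct)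
    case less
    show False
    proof (cases "degree Q \<le> degree P")
      case True
      have "poly (reflect_poly Q) x = 0"
        using less.prems by (simp add: poly_reflect_poly_nz)
      from red_one_descent[OF \<Gamma>(3) less.prems(1,2,3) this True]
      obtain P' where "red_one P'" "poly P' x = 0" "degree P' < degree P" by blast
      with less.hyps[of P' Q x] less.prems show False by simp
    next
      case False
      have "poly (reflect_poly P) (inverse x) = 0"
        using less.prems by (simp add: poly_reflect_poly_nz)
      from red_one_descent[OF \<Gamma>(3) less.prems(3,4,1) this] False
      obtain Q' where "red_one Q'" "poly Q' (inverse x) = 0" "degree Q' < degree Q" by force
      with less.hyps[of P Q' x] less.prems show False by simp
    qed
  qed
  have "x \<in> Domain \<Gamma> \<or> (inverse x, 0) \<in> \<Gamma>" for x
  proof (cases "x \<in> Domain \<Gamma>")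
    case x: False
    then have "x \<noteq> 0" using zero by auto
    obtain P where P: "red_one P" "poly P x = 0" using outside[OF x] by blast
    have "inverse x \<in> Domain \<Gamma>"
    proof (rule ccontr)
      assume "inverse x \<notin> Domain \<Gamma>"
      then obtain Q where "red_one Q" "poly Q (inverse x) = 0" using outside by blast
      then show False using nopair[OF P(1) P(2) _ _ \<open>x \<noteq> 0\<close>, of Q] by simp
    qed
    then obtain c where c: "(inverse x, c) \<in> \<Gamma>" by blast
    define n where "n = degree P"
    have cP: "(coeff P i, if i = 0 then 1 else 0) \<in> \<Gamma>" for i
      using P(1) by (simp add: red_one_iff)
    \<comment> \<open>Dividing \<open>P(x) = 0\<close> by \<open>x ^ n\<close> gives a relation for
      \<open>inverse x\<close> in which only the constant coefficient of \<open>P\<close> survives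
      reduction, so the residue \<open>c\<close> satisfies \<open>c ^ n = 0\<close>.\<close>
    have "(\<Sum>i\<le>n. coeff P i * inverse x ^ (n - i)) = inverse x ^ n * poly P x"
      unfolding poly_altdef sum_distrib_left n_def[symmetric]
    proof (intro sum.cong refl)
      fix i assume "i \<in> {..n}"
      then have "inverse x ^ n = inverse x ^ (n - i) * inverse x ^ i"
        by (simp add: power_add[symmetric])
      then show "coeff P i * inverse x ^ (n - i) = inverse x ^ n * (coeff P i * x ^ i)"
        using \<open>x \<noteq> 0\<close> by (simp add: power_mult_distrib[symmetric])
    qed
    also have "\<dots> = 0" using P(2) by simp
    finally have "(\<Sum>i\<le>n. coeff P i * inverse x ^ (n - i)) = 0" .
    moreover have "(\<Sum>i\<le>n. coeff P i * inverse x ^ (n - i),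
        \<Sum>i\<le>n. (if i = 0 then 1 else 0) * c ^ (n - i)) \<in> \<Gamma>"
      by (intro sum mult cP power c)
    ultimately have "(0, \<Sum>i\<le>n. (if i = 0 then 1 else 0) * c ^ (n - i)) \<in> \<Gamma>"
      by simp
    also have "(\<Sum>i\<le>n. (if i = 0 then 1 else 0) * c ^ (n - i)) = (\<Sum>i\<le>n. if i = 0 then c ^ n else 0)"
      by (intro sum.cong) auto
    also have "\<dots> = c ^ n" by simp
    finally have "c ^ n = 0" by (rule functional_relD[OF \<Gamma>(3)])
    then have "c = 0" by (cases "n = 0") auto
    with c show ?thesis by auto
  qed simp
  with \<Gamma> show ?thesis using that by blast
qed

section \<open>Small integer weights\<close>

lemma abs_det_le:
  fixes M :: "int mat"
  assumes M: "M \<in> carrier_mat n n" and D: "\<And>i j. i < n \<Longrightarrow> j < n \<Longrightarrow> \<bar>M $$ (i, j)\<bar> \<le> D"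
  shows "\<bar>det M\<bar> \<le> fact n * D ^ n"
proof -
  have "\<bar>det M\<bar> \<le> (\<Sum>p | p permutes {0..<n}. \<bar>signof p * (\<Prod>i = 0..<n. M $$ (i, p i))\<bar>)"
    unfolding det_def'[OF M] by (rule sum_abs)
  also have "\<dots> \<le> (\<Sum>p | p permutes {0..<n}. D ^ n)"
  proof (rule sum_mono, clarify)
    fix p assume p: "p permutes {0..<n}"
    have "(\<Prod>i = 0..<n. \<bar>M $$ (i, p i)\<bar>) \<le> (\<Prod>i = 0..<n. D)"
      by (rule prod_mono) (use p D in \<open>force dest: permutes_in_image\<close>)
    then show "\<bar>signof p * (\<Prod>i = 0..<n. M $$ (i, p i))\<bar> \<le> D ^ n"
      by (simp add: abs_mult abs_prod sign_def)
  qed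
  also have "\<dots> = fact n * D ^ n"
    by (simp add: card_permutations[of "{0..<n}" n])
  finally show ?thesis .
qed

lemma abs_adj_mat_le:
  fixes M :: "int mat"
  assumes M: "M \<in> carrier_mat m m" and D: "\<And>i j. i < m \<Longrightarrow> j < m \<Longrightarrow> \<bar>M $$ (i, j)\<bar> \<le> D"
    and "1 \<le> D" "i < m" "j < m"
  shows "\<bar>adj_mat M $$ (i, j)\<bar> \<le> fact m * D ^ m"
proof -
  have "\<bar>adj_mat M $$ (i, j)\<bar> = \<bar>det (mat_delete M j i)\<bar>"
    using assms by (simp add: adj_mat_def cofactor_def abs_mult power_abs)
  also have "\<dots> \<le> fact (m - 1) * D ^ (m - 1)"
    by (rule abs_det_le) (use assms in \<open>auto simp: mat_delete_def\<close>)
  also have "\<dots> \<le> fact m * D ^ m"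
    using assms by (intro mult_mono fact_mono power_increasing) auto
  finally show ?thesis .
qed

text \<open>The second argument ranges over any commutative ring: integers for weights, and integer
  polynomials as formal exponent vectors when signs come from a valuation.\<close>

definition pairing :: "nat \<Rightarrow> (nat \<Rightarrow> int) \<Rightarrow> (nat \<Rightarrow> 'l::comm_ring_1) \<Rightarrow> 'l" where
  "pairing m \<tau> x = (\<Sum>i<m. of_int (\<tau> i) * x i)"

lemma pairing_uminus: "pairing m (\<lambda>i. - \<tau> i) x = - pairing m \<tau> x"
  by (simp add: pairing_def sum_negf)

lemma pairing_add_right: "pairing m \<tau> (\<lambda>i. x i + y i) = pairing m \<tau> x + pairing m \<tau> y"
  by (simp add: pairing_def distrib_left sum.distrib)

lemma pairing_scale_right: "pairing m \<tau> (\<lambda>i. a * x i) = a * pairing m \<tau> x"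
  by (simp add: pairing_def sum_distrib_left mult.left_commute)

lemma pairing_of_int: "pairing m \<tau> (\<lambda>i. of_int (w i) * e) = of_int (pairing m \<tau> w) * e"
  by (simp add: pairing_def sum_distrib_right mult.assoc)

text \<open>The box is symmetric, so negative vectors are negatives of positive ones in it; the
  coordinates from \<open>m\<close> on vanish to make it finite.\<close>

definition weight_box :: "nat \<Rightarrow> int \<Rightarrow> (nat \<Rightarrow> int) set" where
  "weight_box m D = {\<tau>. (\<forall>i<m. \<bar>\<tau> i\<bar> \<le> D) \<and> (\<forall>i\<ge>m. \<tau> i = 0)}"

lemma finite_weight_box: "finite (weight_box m D)"
proof -
  have "finite {\<tau>. \<forall>i. (i \<in> {..<m} \<longrightarrow> \<tau> i \<in> {- D..D}) \<and> (i \<notin> {..<m} \<longrightarrow> \<tau> i = 0)}"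
    by (rule finite_set_of_finite_funs) auto
  then show ?thesis
    by (rule rev_finite_subset) (auto simp: weight_box_def abs_le_iff minus_le_iff)
qed

definition row_fun :: "nat \<Rightarrow> int mat \<Rightarrow> nat \<Rightarrow> nat \<Rightarrow> int" where
  "row_fun m M i = (\<lambda>c. if c < m then M $$ (i, c) else 0)"

lemma pairing_row_fun_adj:
  assumes "M \<in> carrier_mat m m" "i < m" "j < m"
  shows "pairing m (row_fun m M i) (\<lambda>c. adj_mat M $$ (c, j)) = (if i = j then det M else 0)"
proof -
  note adj = adj_mat[OF assms(1)]
  have "pairing m (row_fun m M i) (\<lambda>c. adj_mat M $$ (c, j)) = (M * adj_mat M) $$ (i, j)"
    using assms adj(1) by (auto simp: pairing_def row_fun_def scalar_prod_def atLeast0LessThan intro!: sum.cong)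
  also have "\<dots> = (if i = j then det M else 0)"
    unfolding adj(2) using assms by simp
  finally show ?thesis .
qed

text \<open>
  \<open>nn\<close> is the set of nonnegative elements of a total preorder.  The ring structure only serves to
  multiply vectors over the preordered group by integer matrices.
\<close>

locale total_cone =
  fixes nn :: "'l::comm_ring_1 \<Rightarrow> bool"
  assumes nn_add: "nn a \<Longrightarrow> nn b \<Longrightarrow> nn (a + b)"
    and nn_total: "nn a \<or> nn (- a)"
begin

text \<open>For the preorder of a valuation ring, \<open>pos\<close> describes the maximal ideal and
  \<open>zer\<close> the units.\<close>

definition pos where "pos a \<longleftrightarrow> \<not> nn (- a)"
definition zer where "zer a \<longleftrightarrow> nn a \<and> nn (- a)"

lemma nn_zero: "nn 0"
  using nn_total[of 0] by simp

lemma pos_imp_nn: "pos a \<Longrightarrow> nn a"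
  using nn_total[of a] by (auto simp: pos_def)

lemma nn_of_nat: "nn a \<Longrightarrow> nn (of_nat n * a)"
  by (induction n) (auto simp: nn_zero distrib_right intro: nn_add)

lemma nn_of_int: "nn a \<Longrightarrow> 0 \<le> n \<Longrightarrow> nn (of_int n * a)"
  using nn_of_nat[of a "nat n"] by simp

lemma zer_zero: "zer 0"
  by (simp add: zer_def nn_zero)

lemma zer_add: "zer a \<Longrightarrow> zer b \<Longrightarrow> zer (a + b)"
  by (simp add: zer_def nn_add) (metis nn_add uminus_add_conv_diff add.commute)

lemma zer_uminus: "zer (- a) \<longleftrightarrow> zer a"
  by (auto simp: zer_def)

lemma zer_of_int: "zer a \<Longrightarrow> zer (of_int n * a)"
proof -
  assume a: "zer a"
  have *: "zer (of_int k * a)" if "0 \<le> k" for k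
    using nn_of_int[of a k] nn_of_int[of "- a" k] a that by (auto simp: zer_def)
  show ?thesis
    using *[of n] *[of "- n"] by (cases "0 \<le> n") (auto simp: zer_uminus)
qed

lemma zer_sum: "(\<And>i. i \<in> S \<Longrightarrow> zer (F i)) \<Longrightarrow> zer (\<Sum>i\<in>S. F i)"
  by (induction S rule: infinite_finite_induct) (auto simp: zer_zero zer_add)

lemma pos_add: "pos a \<Longrightarrow> nn b \<Longrightarrow> pos (a + b)"
  unfolding pos_def using nn_add[of "- (a + b)" b] by auto

lemma pos_of_int: "pos a \<Longrightarrow> 0 < n \<Longrightarrow> pos (of_int n * a)"
proof -
  assume a: "pos a" and n: "0 < n"
  have "of_int n * a = a + of_int (n - 1) * a"
    by (simp add: algebra_simps)
  then show ?thesis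
    using pos_add[OF a nn_of_int[OF pos_imp_nn[OF a], of "n - 1"]] n by simp
qed

lemma pos_of_int_iff: "pos a \<Longrightarrow> pos (of_int n * a) \<longleftrightarrow> 0 < n"
  using pos_of_int[of a n] nn_of_int[of a "- n"] pos_imp_nn[of a]
  by (cases "0 < n") (auto simp: pos_def)

lemma pos_trichotomy: "pos a \<or> pos (- a) \<or> zer a"
  by (auto simp: pos_def zer_def)

lemma exists_min:
  assumes "finite S" "S \<noteq> {}"
  shows "\<exists>s\<in>S. \<forall>t\<in>S. nn (F t - F s)"
  using assms
proof (induction S rule: finite_ne_induct)
  case (singleton x)
  then show ?case by (simp add: nn_zero)
next
  case (insert x S)
  then obtain s where s: "s \<in> S" "\<forall>t\<in>S. nn (F t - F s)" by blast
  consider "nn (F x - F s)" | "nn (F s - F x)"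
    using nn_total[of "F x - F s"] by auto
  then show ?case
  proof cases
    case 1
    with s show ?thesis by blast
  next
    case 2
    then have "nn (F t - F x)" if "t \<in> S" for t
      using nn_add[of "F t - F s" "F s - F x"] s that by simp
    then show ?thesis using nn_zero by auto
  qed
qed

definition pos_box where "pos_box m D \<gamma> = {\<tau>\<in>weight_box m D. pos (pairing m \<tau> \<gamma>)}"
definition zero_box where "zero_box m D \<gamma> = {\<tau>\<in>weight_box m D. zer (pairing m \<tau> \<gamma>)}"

text \<open>Real weights could be normalized to be at least 1 on \<open>T\<close>. A preordered
  group has no distinguished 1, so a positive margin \<open>\<epsilon>\<close>, which may change
  together with \<open>x\<close>, takes its place.\<close>

definition feasible where
  "feasible m T Z x \<epsilon> \<longleftrightarrow> pos \<epsilon> \<and> (\<forall>\<tau>\<in>T. nn (pairing m \<tau> x - \<epsilon>)) \<and> (\<forall>\<tau>\<in>Z. zer (pairing m \<tau> x))"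

definition tight where
  "tight m T Z x \<epsilon> \<tau> \<longleftrightarrow> \<tau> \<in> T \<and> zer (pairing m \<tau> x - \<epsilon>) \<or> \<tau> \<in> Z"

text \<open>
  Instead of dividing by the slopes \<open>pairing m \<tau> w\<close>, the point and the margin \<open>\<epsilon>\<close> are scaled by a common
  multiple of them.
\<close>

lemma move_to_tight:
  fixes w :: "nat \<Rightarrow> int"
  assumes feas: "feasible m T Z x \<epsilon>" and fin: "finite T"
    and ex: "\<exists>\<tau>\<in>T. pairing m \<tau> w < 0"
    and Z0: "\<And>\<tau>. \<tau> \<in> Z \<Longrightarrow> pairing m \<tau> w = 0"
  obtains x' \<epsilon>' \<tau>' where "feasible m T Z x' \<epsilon>'" "\<tau>' \<in> T" "pairing m \<tau>' w < 0" "tight m T Z x' \<epsilon>' \<tau>'"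
    "\<And>\<tau>. pairing m \<tau> w = 0 \<Longrightarrow> tight m T Z x \<epsilon> \<tau> \<Longrightarrow> tight m T Z x' \<epsilon>' \<tau>"
proof -
  define T' where "T' = {\<tau>\<in>T. pairing m \<tau> w < 0}"
  define n where "n \<tau> = - pairing m \<tau> w" for \<tau>
  define N where "N = (\<Prod>\<tau>\<in>T'. n \<tau>)"
  define c where "c \<tau> = (\<Prod>\<sigma>\<in>T' - {\<tau>}. n \<sigma>)" for \<tau>
  have T': "finite T'" "T' \<noteq> {}" using fin ex by (auto simp: T'_def)
  have npos: "n \<tau> > 0" if "\<tau> \<in> T'" for \<tau> using that by (auto simp: T'_def n_def)
  have N: "N > 0" unfolding N_def by (rule prod_pos) (use npos in auto)
  have c: "c \<tau> > 0" for \<tau> unfolding c_def by (rule prod_pos) (use npos in auto)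
  have cn: "N = n \<tau> * c \<tau>" if "\<tau> \<in> T'" for \<tau>
    unfolding N_def c_def using T'(1) that by (rule prod.remove)
  \<comment> \<open>Up to the factor \<open>N\<close>, this is the distance along \<open>w\<close>
    at which the constraint of \<open>\<tau>\<close> becomes tight. Taking the least one is the
    ratio test of the simplex method.\<close>
  define \<delta> where "\<delta> \<tau> = of_int (c \<tau>) * (pairing m \<tau> x - \<epsilon>)" for \<tau>
  obtain \<tau>' where \<tau>': "\<tau>' \<in> T'" "\<forall>\<tau>\<in>T'. nn (\<delta> \<tau> - \<delta> \<tau>')"
    using exists_min[OF T', of \<delta>] by blast
  have "\<tau>' \<in> T" using \<tau>' by (simp add: T'_def)
  then have nn\<delta>: "nn (\<delta> \<tau>')"
    unfolding \<delta>_def using feas c[of \<tau>'] by (intro nn_of_int) (auto simp: feasible_def)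
  define x' where "x' i = of_int N * x i + of_int (w i) * \<delta> \<tau>'" for i
  define \<epsilon>' where "\<epsilon>' = of_int N * \<epsilon>"
  have ip': "pairing m \<tau> x' = of_int N * pairing m \<tau> x + of_int (pairing m \<tau> w) * \<delta> \<tau>'" for \<tau>
    unfolding x'_def[abs_def] pairing_add_right pairing_scale_right pairing_of_int ..
  have eq: "pairing m \<tau> x' - \<epsilon>' = of_int (n \<tau>) * (\<delta> \<tau> - \<delta> \<tau>')" if "\<tau> \<in> T'" for \<tau>
    unfolding ip' \<epsilon>'_def \<delta>_def[of \<tau>] cn[OF that] by (simp add: n_def algebra_simps)
  have eq2: "pairing m \<tau> x' - \<epsilon>' = of_int N * (pairing m \<tau> x - \<epsilon>) + of_int (pairing m \<tau> w) * \<delta> \<tau>'" for \<tau>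
    unfolding ip' \<epsilon>'_def by (simp add: algebra_simps)
  have "feasible m T Z x' \<epsilon>'"
    unfolding feasible_def
  proof (intro conjI ballI)
    show "pos \<epsilon>'" unfolding \<epsilon>'_def using feas N by (intro pos_of_int) (auto simp: feasible_def)
  next
    fix \<tau> assume \<tau>: "\<tau> \<in> T"
    show "nn (pairing m \<tau> x' - \<epsilon>')"
    proof (cases "\<tau> \<in> T'")
      case True
      with \<tau>' npos[OF True] show ?thesis
        unfolding eq[OF True] by (intro nn_of_int) auto
    next
      case False
      with \<tau> have "0 \<le> pairing m \<tau> w" by (simp add: T'_def)
      then show ?thesis
        unfolding eq2 using feas \<tau> N nn\<delta> by (intro nn_add nn_of_int) (auto simp: feasible_def)
    qed
  next
    fix \<tau> assume "\<tau> \<in> Z"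
    then show "zer (pairing m \<tau> x')"
      unfolding ip' using feas Z0 by (auto intro!: zer_of_int simp: feasible_def)
  qed
  moreover have "tight m T Z x' \<epsilon>' \<tau>'"
    using \<open>\<tau>' \<in> T\<close> \<tau>'(1) by (simp add: tight_def eq zer_zero)
  moreover have "tight m T Z x' \<epsilon>' \<tau>" if "pairing m \<tau> w = 0" "tight m T Z x \<epsilon> \<tau>" for \<tau>
    using that by (auto simp: tight_def eq2 zer_of_int)
  ultimately show ?thesis
    using \<tau>'(1) \<open>\<tau>' \<in> T\<close> that by (auto simp: T'_def)
qed

text \<open>
  The first \<open>j\<close> rows of \<open>M\<close> are tight.  The \<open>j\<close>-th column \<open>w\<close> of the adjugate is orthogonal to them,
  so they stay tight along \<open>w\<close>; replacing row \<open>j\<close> by \<open>\<tau>\<close> turns the determinant into the pairing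
  of \<open>\<tau>\<close> and \<open>w\<close>.
\<close>

lemma nonsingular_tight:
  assumes D: "1 \<le> D" and T: "pos_box m D \<gamma> \<noteq> {}" and "j \<le> m"
  defines "T \<equiv> pos_box m D \<gamma>" and "Z \<equiv> zero_box m D \<gamma>"
  shows "\<exists>x \<epsilon> M. feasible m T Z x \<epsilon> \<and> M \<in> carrier_mat m m \<and> det M \<noteq> 0 \<and>
    (\<forall>i<m. row_fun m M i \<in> weight_box m D) \<and> (\<forall>i<j. tight m T Z x \<epsilon> (row_fun m M i))"
  using \<open>j \<le> m\<close>
proof (induction j)
  case 0
  have fin: "finite T" unfolding T_def pos_box_def using finite_weight_box by auto
  \<comment> \<open>The least positive value of \<open>\<gamma>\<close> on the box is the initial
    margin; the unit vectors, which lie in the box as \<open>D \<ge> 1\<close>, are the initial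
    rows.\<close>
  obtain \<tau>0 where \<tau>0: "\<tau>0 \<in> T" "\<forall>\<tau>\<in>T. nn (pairing m \<tau> \<gamma> - pairing m \<tau>0 \<gamma>)"
    using exists_min[OF fin, of "\<lambda>\<tau>. pairing m \<tau> \<gamma>"] T T_def by blast
  then have "feasible m T Z \<gamma> (pairing m \<tau>0 \<gamma>)"
    by (auto simp: feasible_def T_def Z_def pos_box_def zero_box_def)
  moreover have "row_fun m (1\<^sub>m m) i \<in> weight_box m D" if "i < m" for i
    using D that by (auto simp: row_fun_def weight_box_def)
  ultimately show ?case
    by (intro exI[of _ \<gamma>] exI[of _ "pairing m \<tau>0 \<gamma>"] exI[of _ "1\<^sub>m m"]) auto
next
  case (Suc j)
  then obtain x \<epsilon> M where feas: "feasible m T Z x \<epsilon>" and M: "M \<in> carrier_mat m m" "det M \<noteq> 0"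
    and rows: "\<forall>i<m. row_fun m M i \<in> weight_box m D" and tight: "\<forall>i<j. tight m T Z x \<epsilon> (row_fun m M i)"
    by auto
  have j: "j < m" using Suc.prems by simp
  have fin: "finite T" unfolding T_def pos_box_def using finite_weight_box by auto
  show ?case
  proof (cases "tight m T Z x \<epsilon> (row_fun m M j)")
    case True
    with feas M rows tight show ?thesis by (metis less_Suc_eq)
  next
    case False
    define r where "r = row_fun m M j"
    have r: "r \<in> weight_box m D" using rows j by (simp add: r_def)
    then have r': "(\<lambda>i. - r i) \<in> weight_box m D" by (simp add: weight_box_def)
    have "r \<notin> Z" using False by (auto simp: tight_def r_def)
    then have "r \<in> T \<or> (\<lambda>i. - r i) \<in> T"
      using r r' pos_trichotomy[of "pairing m r \<gamma>"]
      by (auto simp: T_def Z_def pos_box_def zero_box_def pairing_uminus)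
    \<comment> \<open>With this sign the constraint of \<open>r\<close> or of its negative,
      whichever belongs to \<open>T\<close>, decreases along \<open>w\<close>, so some constraint in
      \<open>T\<close> stops the motion.\<close>
    define s :: int where "s = (if r \<in> T then - sgn (det M) else sgn (det M))"
    define w where "w c = s * adj_mat M $$ (c, j)" for c
    have s: "s \<noteq> 0" using M(2) by (auto simp: s_def sgn_if)
    have ipw: "pairing m \<tau> w = s * pairing m \<tau> (\<lambda>c. adj_mat M $$ (c, j))" for \<tau>
      unfolding w_def[abs_def] by (rule pairing_scale_right)
    have iprow: "pairing m (row_fun m M i) w = (if i = j then s * det M else 0)" if "i < m" for i
      unfolding ipw using pairing_row_fun_adj[OF M(1) that j] by simp
    have "\<exists>\<tau>\<in>T. pairing m \<tau> w < 0"
    proof (cases "r \<in> T")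
      case True
      then show ?thesis using iprow[OF j] M(2)
        by (intro bexI[of _ r]) (auto simp: s_def r_def sgn_if)
    next
      case False
      then show ?thesis using iprow[OF j] M(2) \<open>r \<in> T \<or> (\<lambda>i. - r i) \<in> T\<close>
        by (intro bexI[of _ "\<lambda>i. - r i"]) (auto simp: s_def r_def sgn_if pairing_uminus)
    qed
    have boxT: "\<tau> \<in> weight_box m D" if "tight m T Z x' \<epsilon>' \<tau>" for x' \<epsilon>' \<tau>
      using that by (auto simp: tight_def T_def Z_def pos_box_def zero_box_def)
    obtain x' \<epsilon>' \<tau>' where step: "feasible m T Z x' \<epsilon>'" "pairing m \<tau>' w \<noteq> 0" "tight m T Z x' \<epsilon>' \<tau>'"
      "\<And>\<tau>. pairing m \<tau> w = 0 \<Longrightarrow> tight m T Z x \<epsilon> \<tau> \<Longrightarrow> tight m T Z x' \<epsilon>' \<tau>"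
    \<comment> \<open>A vector of \<open>Z\<close> that varies along \<open>w\<close> is tight
      already and can replace row \<open>j\<close> without any motion.\<close>
    proof (cases "\<exists>\<tau>\<in>Z. pairing m \<tau> w \<noteq> 0")
      case True
      then show ?thesis using feas that by (auto simp: tight_def)
    next
      case False
      then have Z0: "\<And>\<tau>. \<tau> \<in> Z \<Longrightarrow> pairing m \<tau> w = 0" by blast
      obtain x' \<epsilon>' \<tau>' where mv: "feasible m T Z x' \<epsilon>'" "\<tau>' \<in> T" "pairing m \<tau>' w < 0"
        "tight m T Z x' \<epsilon>' \<tau>'"
        "\<And>\<tau>. pairing m \<tau> w = 0 \<Longrightarrow> tight m T Z x \<epsilon> \<tau> \<Longrightarrow> tight m T Z x' \<epsilon>' \<tau>"
        by (rule move_to_tight[OF feas fin \<open>\<exists>\<tau>\<in>T. pairing m \<tau> w < 0\<close> Z0], assumption) blast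
      show ?thesis
        by (rule that[OF mv(1) _ mv(4) mv(5)]) (use mv(3) in auto)
    qed
    define M' where "M' = mat m m (\<lambda>(i, c). if i = j then \<tau>' c else M $$ (i, c))"
    have M': "M' \<in> carrier_mat m m" by (simp add: M'_def)
    have rowM': "row_fun m M' i = (if i = j then \<tau>' else row_fun m M i)" if "i < m" for i
      using boxT[OF step(3)] that by (auto simp: row_fun_def M'_def weight_box_def)
    have "mat_delete M' j c = mat_delete M j c" if "c < m" for c
      using M j that by (auto simp: mat_delete_def M'_def)
    then have "det M' = (\<Sum>c<m. \<tau>' c * cofactor M j c)"
      unfolding laplace_expansion_row[OF M' j] by (intro sum.cong) (auto simp: cofactor_def M'_def j)
    also have "\<dots> = pairing m \<tau>' (\<lambda>c. adj_mat M $$ (c, j))"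
      unfolding pairing_def by (intro sum.cong) (use M j in \<open>auto simp: adj_mat_def\<close>)
    finally have "det M' \<noteq> 0"
      using step(2) by (auto simp: ipw)
    moreover have "\<forall>i<m. row_fun m M' i \<in> weight_box m D"
      using rows boxT[OF step(3)] by (simp add: rowM')
    moreover have "\<forall>i<Suc j. tight m T Z x' \<epsilon>' (row_fun m M' i)"
    proof (intro allI impI)
      fix i assume "i < Suc j"
      with j have i: "i < m" by simp
      show "tight m T Z x' \<epsilon>' (row_fun m M' i)"
      proof (cases "i = j")
        case True
        with step(3) i show ?thesis by (simp add: rowM')
      next
        case False
        with \<open>i < Suc j\<close> have "tight m T Z x \<epsilon> (row_fun m M i)" using tight by simp
        with step(4) iprow[OF i] False i show ?thesis by (simp add: rowM')
      qed
    qed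
    ultimately show ?thesis using step(1) M' by blast
  qed
qed

text \<open>At a vertex \<open>m\<close> independent constraints are tight, with right-hand sides 0
  or \<open>\<epsilon>\<close>. By Cramer's rule, \<open>|det M|\<close> times the vertex agrees, up
  to elements equivalent to 0, with \<open>\<epsilon>\<close> times an integer vector
  \<open>k\<close>, so \<open>k\<close> has the same signs on the box. Each \<open>k i\<close> is a
  sum of at most \<open>m\<close> entries of the adjugate.\<close>

theorem small_weights:
  assumes D: "1 \<le> D"
  shows "\<exists>k :: nat \<Rightarrow> int. (\<forall>i<m. \<bar>k i\<bar> \<le> int m * (fact m * D ^ m)) \<and>
    (\<forall>\<tau>\<in>weight_box m D. nn (pairing m \<tau> \<gamma>) \<longleftrightarrow> 0 \<le> pairing m \<tau> k)"
proof (cases "pos_box m D \<gamma> = {}")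
  case True
  \<comment> \<open>Without positive vectors, the symmetric box contains only vectors equivalent to
    0, and zero weights will do.\<close>
  have "nn (pairing m \<tau> \<gamma>)" if "\<tau> \<in> weight_box m D" for \<tau>
  proof (rule ccontr)
    assume "\<not> nn (pairing m \<tau> \<gamma>)"
    then have "pos (pairing m (\<lambda>i. - \<tau> i) \<gamma>)" by (simp add: pairing_uminus pos_def)
    moreover have "(\<lambda>i. - \<tau> i) \<in> weight_box m D" using that by (simp add: weight_box_def)
    ultimately show False using True by (auto simp: pos_box_def)
  qed
  then show ?thesis using D by (intro exI[of _ "\<lambda>_. 0"]) (simp add: pairing_def)
next
  case False
  define T Z where "T = pos_box m D \<gamma>" and "Z = zero_box m D \<gamma>"
  obtain x \<epsilon> M where feas: "feasible m T Z x \<epsilon>" and M: "M \<in> carrier_mat m m" "det M \<noteq> 0"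
    and rows: "\<And>i. i < m \<Longrightarrow> row_fun m M i \<in> weight_box m D"
    and tight: "\<And>i. i < m \<Longrightarrow> tight m T Z x \<epsilon> (row_fun m M i)"
    using nonsingular_tight[OF D False order_refl] unfolding T_def Z_def by blast
  have eps: "pos \<epsilon>" using feas by (simp add: feasible_def)
  \<comment> \<open>Right-hand side of the tight system in units of the margin: 1 for rows in
    \<open>T\<close>, 0 for rows in \<open>Z\<close>.\<close>
  define b :: "nat \<Rightarrow> int" where "b i = of_bool (row_fun m M i \<in> T)" for i
  have b: "zer (pairing m (row_fun m M i) x - of_int (b i) * \<epsilon>)" if "i < m" for i
  proof (cases "row_fun m M i \<in> T")
    case True
    then have "row_fun m M i \<notin> Z" by (auto simp: T_def Z_def pos_box_def zero_box_def pos_def zer_def)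
    with tight[OF that] True show ?thesis by (simp add: tight_def b_def)
  next
    case False
    with tight[OF that] have "row_fun m M i \<in> Z" by (simp add: tight_def)
    with feas False show ?thesis by (simp add: feasible_def b_def)
  qed
  define k0 where "k0 i = (\<Sum>j<m. adj_mat M $$ (i, j) * b j)" for i
  have k0: "zer (of_int (det M) * x i - of_int (k0 i) * \<epsilon>)" if i: "i < m" for i
  proof -
    note adj = adj_mat[OF M(1)]
    have entry: "(\<Sum>j<m. adj_mat M $$ (i, j) * M $$ (j, c)) = (if i = c then det M else 0)" if "c < m" for c
    proof -
      have "(adj_mat M * M) $$ (i, c) = (\<Sum>j<m. adj_mat M $$ (i, j) * M $$ (j, c))"
        using adj(1) M(1) i that by (auto simp: scalar_prod_def atLeast0LessThan intro!: sum.cong)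
      then show ?thesis unfolding adj(3) using i that by auto
    qed
    have "zer (\<Sum>j<m. of_int (adj_mat M $$ (i, j)) * (pairing m (row_fun m M j) x - of_int (b j) * \<epsilon>))"
      by (intro zer_sum zer_of_int b) simp
    also have "(\<Sum>j<m. of_int (adj_mat M $$ (i, j)) * (pairing m (row_fun m M j) x - of_int (b j) * \<epsilon>))
      = (\<Sum>j<m. \<Sum>c<m. of_int (adj_mat M $$ (i, j) * M $$ (j, c)) * x c) - of_int (k0 i) * \<epsilon>"
      by (simp add: right_diff_distrib sum_subtractf pairing_def row_fun_def sum_distrib_left k0_def
          sum_distrib_right mult.assoc)
    also have "(\<Sum>j<m. \<Sum>c<m. of_int (adj_mat M $$ (i, j) * M $$ (j, c)) * x c)
      = (\<Sum>c<m. of_int (\<Sum>j<m. adj_mat M $$ (i, j) * M $$ (j, c)) * x c)"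
      by (subst sum.swap) (simp add: sum_distrib_right)
    also have "\<dots> = (\<Sum>c<m. if c = i then of_int (det M) * x i else 0)"
      by (intro sum.cong refl) (subst entry, auto)
    also have "\<dots> = of_int (det M) * x i" using i by simp
    finally show ?thesis .
  qed
  define k where "k i = sgn (det M) * k0 i" for i
  have ipk: "zer (of_int \<bar>det M\<bar> * pairing m \<tau> x - of_int (pairing m \<tau> k) * \<epsilon>)" for \<tau>
  proof -
    have "zer (\<Sum>i<m. of_int (\<tau> i * sgn (det M)) * (of_int (det M) * x i - of_int (k0 i) * \<epsilon>))"
      by (intro zer_sum zer_of_int k0) simp
    also have "(\<Sum>i<m. of_int (\<tau> i * sgn (det M)) * (of_int (det M) * x i - of_int (k0 i) * \<epsilon>))
      = of_int \<bar>det M\<bar> * pairing m \<tau> x - of_int (pairing m \<tau> k) * \<epsilon>"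
      unfolding pairing_def abs_sgn k_def
      by (simp add: sum_distrib_left sum_distrib_right right_diff_distrib sum_subtractf algebra_simps)
    finally show ?thesis .
  qed
  have posT: "0 < pairing m \<tau> k" if "\<tau> \<in> T" for \<tau>
  proof -
    have "pos (pairing m \<tau> x)"
      using pos_add[OF eps, of "pairing m \<tau> x - \<epsilon>"] feas that by (simp add: feasible_def)
    then have "pos (of_int \<bar>det M\<bar> * pairing m \<tau> x)"
      using M(2) by (intro pos_of_int) auto
    then have "pos (of_int (pairing m \<tau> k) * \<epsilon>)"
      using pos_add[of _ "- (of_int \<bar>det M\<bar> * pairing m \<tau> x - of_int (pairing m \<tau> k) * \<epsilon>)"] ipk[of \<tau>]
      by (fastforce simp: zer_def)
    then show ?thesis by (simp add: pos_of_int_iff[OF eps])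
  qed
  have zerZ: "pairing m \<tau> k = 0" if "\<tau> \<in> Z" for \<tau>
  proof -
    have "zer (of_int \<bar>det M\<bar> * pairing m \<tau> x)"
      using feas that by (intro zer_of_int) (auto simp: feasible_def)
    from zer_add[OF this, of "- (of_int \<bar>det M\<bar> * pairing m \<tau> x - of_int (pairing m \<tau> k) * \<epsilon>)"]
    have "zer (of_int (pairing m \<tau> k) * \<epsilon>)" using ipk[of \<tau>]
        zer_uminus[of "of_int \<bar>det M\<bar> * pairing m \<tau> x - of_int (pairing m \<tau> k) * \<epsilon>"] by simp
    then show ?thesis
      using pos_of_int_iff[OF eps, of "pairing m \<tau> k"] pos_of_int_iff[OF eps, of "- pairing m \<tau> k"]
      by (auto simp: zer_def pos_def)
  qed
  have "nn (pairing m \<tau> \<gamma>) \<longleftrightarrow> 0 \<le> pairing m \<tau> k" if \<tau>: "\<tau> \<in> weight_box m D" for \<tau>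
  proof -
    have \<tau>': "(\<lambda>i. - \<tau> i) \<in> weight_box m D" using \<tau> by (simp add: weight_box_def)
    consider "\<tau> \<in> T" | "(\<lambda>i. - \<tau> i) \<in> T" | "\<tau> \<in> Z"
      using \<tau> \<tau>' pos_trichotomy[of "pairing m \<tau> \<gamma>"]
      by (auto simp: T_def Z_def pos_box_def zero_box_def pairing_uminus)
    then show ?thesis
    proof cases
      case 1
      then show ?thesis using posT[OF 1] pos_imp_nn by (auto simp: T_def pos_box_def)
    next
      case 2
      then show ?thesis using posT[OF 2] by (auto simp: T_def pos_box_def pairing_uminus pos_def)
    next
      case 3
      then show ?thesis using zerZ[OF 3] by (auto simp: Z_def zero_box_def zer_def)
    qed
  qed
  moreover have "\<bar>k i\<bar> \<le> int m * (fact m * D ^ m)" if i: "i < m" for i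
  proof -
    have "\<bar>M $$ (i, j)\<bar> \<le> D" if "i < m" "j < m" for i j
      using rows[OF that(1)] that by (auto simp: weight_box_def row_fun_def)
    then have adj: "\<bar>adj_mat M $$ (i, j)\<bar> \<le> fact m * D ^ m" if "j < m" for j
      using abs_adj_mat_le[OF M(1) _ D i that] by blast
    have "\<bar>k i\<bar> \<le> (\<Sum>j<m. \<bar>adj_mat M $$ (i, j) * b j\<bar>)"
      using M(2) sum_abs[of "\<lambda>j. adj_mat M $$ (i, j) * b j" "{..<m}"]
      by (simp add: k_def k0_def abs_mult sgn_if)
    also have "\<dots> \<le> (\<Sum>j<m. fact m * D ^ m)"
      by (rule sum_mono) (use adj D in \<open>auto simp: b_def\<close>)
    also have "\<dots> = int m * (fact m * D ^ m)" by simp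
    finally show ?thesis .
  qed
  ultimately show ?thesis by blast
qed

end

section \<open>Smith normal form over a valuation ring\<close>

lemma index_mult_mat_sum:
  "A \<in> carrier_mat a b \<Longrightarrow> B \<in> carrier_mat b c \<Longrightarrow> i < a \<Longrightarrow> j < c \<Longrightarrow>
    (A * B) $$ (i, j) = (\<Sum>k<b. A $$ (i, k) * B $$ (k, j))"
  by (auto simp: scalar_prod_def atLeast0LessThan intro!: sum.cong)

text \<open>The graph of a place: its domain is a valuation ring, the elements related to 0 are the
  maximal ideal, and the residue field is the ground field.\<close>

locale valuation_place = place_rel \<iota> \<Gamma>
  for \<iota> :: "'a::alg_closed_field \<Rightarrow> 'k::field" and \<Gamma> +
  assumes functional: "functional_rel \<Gamma>"
    and valuation: "x \<in> Domain \<Gamma> \<or> (inverse x, 0) \<in> \<Gamma>"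
begin

abbreviation R where "R \<equiv> Domain \<Gamma>"

lemma R_add: "x \<in> R \<Longrightarrow> y \<in> R \<Longrightarrow> x + y \<in> R" by (blast intro: add)
lemma R_mult: "x \<in> R \<Longrightarrow> y \<in> R \<Longrightarrow> x * y \<in> R" by (blast intro: mult)
lemma R_uminus: "x \<in> R \<Longrightarrow> - x \<in> R" by (blast intro: uminus)
lemma R_zero: "0 \<in> R" by (blast intro: zero)
lemma R_one: "1 \<in> R" by (blast intro: one)
lemma R_sum: "(\<And>i. i \<in> S \<Longrightarrow> F i \<in> R) \<Longrightarrow> (\<Sum>i\<in>S. F i) \<in> R"
  by (induction S rule: infinite_finite_induct) (auto intro: R_zero R_add)

lemma R_total: "x \<in> R \<or> inverse x \<in> R"
  using valuation[of x] by blast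

text \<open>One of \<open>x / y\<close> and \<open>y / x\<close> lies in \<open>R\<close>, so
  divisibility is a total preorder on nonzero elements; its minimum on a finite set is the pivot for
  elimination.\<close>

lemma exists_divisor:
  assumes "finite S" "S \<noteq> {}" "0 \<notin> S"
  shows "\<exists>s\<in>S. \<forall>t\<in>S. t / s \<in> R"
  using assms
proof (induction S rule: finite_ne_induct)
  case (singleton x)
  then show ?case by (simp add: R_one)
next
  case (insert x S)
  then obtain s where s: "s \<in> S" "\<forall>t\<in>S. t / s \<in> R" by auto
  show ?case
  proof (cases "x / s \<in> R")
    case True
    with s show ?thesis by blast
  next
    case False
    then have "s / x \<in> R" using R_total[of "x / s"] by simp
    then have "t / x \<in> R" if "t \<in> S" for t
    proof -
      have "t / s * (s / x) \<in> R" using s that \<open>s / x \<in> R\<close> by (intro R_mult) auto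
      moreover have "s \<noteq> 0" using s insert.prems by auto
      ultimately show ?thesis by simp
    qed
    moreover have "x / x \<in> R" using insert.prems by (auto simp: R_one)
    ultimately show ?thesis by auto
  qed
qed

definition SLR :: "nat \<Rightarrow> 'k mat set" where
  "SLR m = {M \<in> SL m. \<forall>i<m. \<forall>j<m. M $$ (i, j) \<in> R}"

lemma SLR_carrier: "M \<in> SLR m \<Longrightarrow> M \<in> carrier_mat m m"
  by (simp add: SLR_def SL_def)

lemma SLR_mult: "M \<in> SLR m \<Longrightarrow> N \<in> SLR m \<Longrightarrow> M * N \<in> SLR m"
  unfolding SLR_def SL_def
  by (auto simp: det_mult scalar_prod_def intro!: R_sum R_mult)

lemma SLR_one: "1\<^sub>m m \<in> SLR m"
  by (auto simp: SLR_def SL_def R_one R_zero)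

lemma SLR_reduction:
  assumes "M \<in> SLR m"
  obtains N where "N \<in> SL m" "mrel m M N"
proof -
  have "\<forall>i j. \<exists>c. i < m \<longrightarrow> j < m \<longrightarrow> (M $$ (i, j), c) \<in> \<Gamma>"
    using assms by (auto simp: SLR_def)
  then obtain n where n: "\<And>i j. i < m \<Longrightarrow> j < m \<Longrightarrow> (M $$ (i, j), n i j) \<in> \<Gamma>" by metis
  define N where "N = mat m m (\<lambda>(i, j). n i j)"
  have N: "N \<in> carrier_mat m m" "mrel m M N" using n by (auto simp: N_def mrel_def)
  have "(det M, det N) \<in> \<Gamma>"
    by (rule det_rel[OF SLR_carrier[OF assms] N])
  then have "det N = 1"
    using assms functional_eq[OF functional _ one] by (auto simp: SLR_def SL_def)
  with N show ?thesis by (intro that) (auto simp: SL_def)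
qed

lemma SLR_transpose: "M \<in> SLR m \<Longrightarrow> transpose_mat M \<in> SLR m"
  by (auto simp: SLR_def SL_def det_transpose[of _ m])

lemma SLR_adj:
  assumes "M \<in> SLR m"
  shows "adj_mat M \<in> SLR m" "M * adj_mat M = 1\<^sub>m m" "adj_mat M * M = 1\<^sub>m m"
proof -
  have M: "M \<in> carrier_mat m m" "det M = 1" using assms by (auto simp: SLR_def SL_def)
  show *: "M * adj_mat M = 1\<^sub>m m" "adj_mat M * M = 1\<^sub>m m"
    using adj_mat[OF M(1)] M by auto
  obtain N where N: "N \<in> SL m" "mrel m M N" using SLR_reduction[OF assms] .
  have "mrel m (adj_mat M) (adj_mat N)"
    by (rule mrel_adj) (use M N in \<open>auto simp: SL_def\<close>)
  moreover have "det (adj_mat M) = 1"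
    using det_mult[OF M(1) adj_mat(1)[OF M(1)]] * M by simp
  ultimately show "adj_mat M \<in> SLR m"
    using adj_mat(1)[OF M(1)] by (auto simp: SLR_def SL_def mrel_def)
qed

text \<open>An exchange of rows has determinant -1; negating row \<open>i\<close> afterwards
  corrects this and leaves the top row alone. Such matrices bring the pivot to the corner.\<close>

lemma SLR_first_row:
  assumes "i < n"
  obtains P where "P \<in> SLR n" "\<And>c. c < n \<Longrightarrow> P $$ (0, c) = (if c = i then 1 else 0)"
proof (cases "i = 0")
  case True
  with assms show ?thesis by (intro that[of "1\<^sub>m n"] SLR_one) auto
next
  case False
  define A :: "'k mat" where "A = multrow_mat n i (- 1)"
  define B :: "'k mat" where "B = swaprows_mat n 0 i"
  have A: "A \<in> carrier_mat n n" and B: "B \<in> carrier_mat n n"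
    unfolding A_def B_def multrow_mat_def swaprows_mat_def by (rule mat_carrier)+
  have "A = mat_diag n (\<lambda>r. if r = i then - 1 else 1)"
    by (rule eq_matI) (auto simp: A_def mat_diag_def)
  then have AB: "A * B = mat n n (\<lambda>(r, c). (if r = i then - 1 else 1) * B $$ (r, c))"
    by (simp only: mat_diag_mult_left[OF B])
  have "det (A * B) = det A * det B" by (rule det_mult[OF A B])
  also have "det A = - 1" unfolding A_def by (rule det_multrow_mat[OF assms])
  also have "det B = - 1" unfolding B_def by (rule det_swaprows_mat) (use assms False in auto)
  finally have "A * B \<in> SL n" using mult_carrier_mat[OF A B] by (simp add: SL_def)
  moreover have "(A * B) $$ (r, c) \<in> R" if "r < n" "c < n" for r c
  proof -
    have "(A * B) $$ (r, c) \<in> {0, 1, - 1}"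
      unfolding AB using that by (simp add: B_def)
    moreover have "{0, 1, - 1} \<subseteq> R"
      using R_zero R_one R_uminus[OF R_one] by blast
    ultimately show ?thesis by blast
  qed
  ultimately have "A * B \<in> SLR n" unfolding SLR_def by blast
  moreover have "(A * B) $$ (0, c) = (if c = i then 1 else 0)" if "c < n" for c
    unfolding AB using that assms False by (auto simp: B_def)
  ultimately show ?thesis by (rule that)
qed

lemma SLR_block:
  assumes "A \<in> SLR n"
  shows "four_block_mat (1\<^sub>m 1) (0\<^sub>m 1 n) (0\<^sub>m n 1) A \<in> SLR (Suc n)"
proof -
  note A = SLR_carrier[OF assms]
  have "det (four_block_mat (1\<^sub>m 1) (0\<^sub>m 1 n) (0\<^sub>m n 1) A) = det (1\<^sub>m 1) * det A"
    by (rule det_four_block_mat_lower_left_zero) (use A in auto)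
  then show ?thesis
    using assms A by (auto simp: SLR_def SL_def R_one R_zero)
qed

text \<open>The pivot divides all entries, so the multipliers that clear its row and column lie in
  \<open>R\<close>; the clearing matrices are triangular with ones on the diagonal.\<close>

lemma SLR_eliminate:
  assumes M: "M \<in> carrier_mat (Suc n) (Suc n)" and a: "M $$ (0, 0) \<noteq> 0"
    and div: "\<And>i j. i < Suc n \<Longrightarrow> j < Suc n \<Longrightarrow> M $$ (i, j) / M $$ (0, 0) \<in> R"
  obtains L U N where "L \<in> SLR (Suc n)" "U \<in> SLR (Suc n)" "N \<in> carrier_mat n n"
    "L * M * U = four_block_mat (mat 1 1 (\<lambda>_. M $$ (0, 0))) (0\<^sub>m 1 n) (0\<^sub>m n 1) N"
proof -
  define a where "a = M $$ (0, 0)"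
  define L where "L = mat (Suc n) (Suc n) (\<lambda>(r, c). if r = c then 1 else if c = 0 then - (M $$ (r, 0) / a) else 0)"
  define U where "U = mat (Suc n) (Suc n) (\<lambda>(r, c). if r = c then 1 else if r = 0 then - (M $$ (0, c) / a) else 0)"
  have car: "L \<in> carrier_mat (Suc n) (Suc n)" "U \<in> carrier_mat (Suc n) (Suc n)"
    by (auto simp: L_def U_def)
  have "det L = prod_list (diag_mat L)"
    by (rule det_lower_triangular[OF _ car(1)]) (auto simp: L_def)
  also have "\<dots> = 1" by (simp add: prod_list_diag_prod L_def)
  finally have "det L = 1" .
  have "det U = prod_list (diag_mat U)"
    by (rule det_upper_triangular[OF _ car(2)]) (auto simp: U_def)
  also have "\<dots> = 1" by (simp add: prod_list_diag_prod U_def)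
  finally have "det U = 1" .
  have LU: "L \<in> SLR (Suc n)" "U \<in> SLR (Suc n)"
    using car \<open>det L = 1\<close> \<open>det U = 1\<close> div
    by (auto simp: SLR_def SL_def L_def U_def a_def intro!: R_one R_zero R_uminus)
  have LM: "(L * M) $$ (r, c) = M $$ (r, c) - (if r = 0 then 0 else M $$ (r, 0) / a * M $$ (0, c))"
    if "r < Suc n" "c < Suc n" for r c
  proof -
    have "(L * M) $$ (r, c) = (\<Sum>k<Suc n. L $$ (r, k) * M $$ (k, c))"
      using that car M by (auto simp: scalar_prod_def atLeast0LessThan intro!: sum.cong)
    also have "\<dots> = (\<Sum>k<Suc n. (if k = r then M $$ (r, c) else 0)
        + (if k = 0 then (if r = 0 then 0 else - (M $$ (r, 0) / a * M $$ (0, c))) else 0))"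
      by (intro sum.cong refl) (use that in \<open>auto simp: L_def\<close>)
    finally show ?thesis using that by (simp add: sum.distrib)
  qed
  define N where "N = mat n n (\<lambda>(r, c). M $$ (Suc r, Suc c) - M $$ (Suc r, 0) / a * M $$ (0, Suc c))"
  have "L * M * U = four_block_mat (mat 1 1 (\<lambda>_. a)) (0\<^sub>m 1 n) (0\<^sub>m n 1) N" (is "_ = ?B")
  proof (rule eq_matI)
    fix r c assume "r < dim_row ?B" "c < dim_col ?B"
    then have rc: "r < Suc n" "c < Suc n" by (auto simp: N_def)
    have "(L * M * U) $$ (r, c) = (\<Sum>k<Suc n. (L * M) $$ (r, k) * U $$ (k, c))"
      by (rule index_mult_mat_sum[OF mult_carrier_mat[OF car(1) M] car(2) rc])
    also have "\<dots> = (\<Sum>k<Suc n. (if k = c then (L * M) $$ (r, c) else 0)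
        + (if k = 0 then (if c = 0 then 0 else - ((L * M) $$ (r, 0) * (M $$ (0, c) / a))) else 0))"
      by (intro sum.cong refl) (use rc in \<open>auto simp: U_def\<close>)
    also have "\<dots> = (L * M) $$ (r, c) - (if c = 0 then 0 else (L * M) $$ (r, 0) * (M $$ (0, c) / a))"
      using rc by (simp add: sum.distrib)
    also have "\<dots> = ?B $$ (r, c)"
      using rc a by (cases r; cases c) (simp_all add: LM N_def flip: a_def)
    finally show "(L * M * U) $$ (r, c) = ?B $$ (r, c)" .
  qed (use car in \<open>auto simp: N_def\<close>)
  moreover have "N \<in> carrier_mat n n" by (simp add: N_def)
  ultimately show ?thesis
    using that[OF LU] unfolding a_def by blast
qed

text \<open>Elimination as over a field, with an entry dividing all others as pivot. Transformations
  in \<open>SLR m\<close> preserve the determinant and can be reduced to the ground field.\<close>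

theorem smith_normal_form:
  assumes "M \<in> carrier_mat m m"
  shows "\<exists>A\<in>SLR m. \<exists>B\<in>SLR m. \<exists>d. A * M * B = mat_diag m d"
  using assms
proof (induction m arbitrary: M)
  case 0
  then show ?case
    by (intro bexI[of _ "1\<^sub>m 0"] SLR_one exI[of _ "\<lambda>_. 0"]) (auto intro!: eq_matI simp: mat_diag_def)
next
  case (Suc n)
  define S where "S = {M $$ (i, j) |i j. i < Suc n \<and> j < Suc n} - {0}"
  show ?case
  proof (cases "S = {}")
    case True
    then have "M $$ (i, j) = 0" if "i < Suc n" "j < Suc n" for i j
      using that unfolding S_def by blast
    then have "1\<^sub>m (Suc n) * M * 1\<^sub>m (Suc n) = mat_diag (Suc n) (\<lambda>_. 0)"
      using Suc.prems by (auto intro!: eq_matI simp: mat_diag_def)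
    then show ?thesis using SLR_one by blast
  next
    case False
    have "S = (\<lambda>(i, j). M $$ (i, j)) ` ({..<Suc n} \<times> {..<Suc n}) - {0}"
      unfolding S_def by auto
    then have "finite S" by simp
    then obtain s where s: "s \<in> S" "\<forall>t\<in>S. t / s \<in> R"
      using exists_divisor[of S] False by (auto simp: S_def)
    then obtain p q where pq: "p < Suc n" "q < Suc n" "s = M $$ (p, q)" "s \<noteq> 0"
      by (auto simp: S_def)
    have sdiv: "M $$ (i, j) / s \<in> R" if "i < Suc n" "j < Suc n" for i j
      using s(2) that R_zero by (cases "M $$ (i, j) = 0") (auto simp: S_def)
    obtain P where P: "P \<in> SLR (Suc n)" "\<And>c. c < Suc n \<Longrightarrow> P $$ (0, c) = (if c = p then 1 else 0)"
      using SLR_first_row[OF pq(1)] by blast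
    obtain Q where Q: "Q \<in> SLR (Suc n)" "\<And>c. c < Suc n \<Longrightarrow> Q $$ (0, c) = (if c = q then 1 else 0)"
      using SLR_first_row[OF pq(2)] by blast
    define M1 where "M1 = P * M * transpose_mat Q"
    note Pc = SLR_carrier[OF P(1)] and Qc = SLR_carrier[OF Q(1)]
    have M1: "M1 \<in> carrier_mat (Suc n) (Suc n)" using Pc Qc Suc.prems by (auto simp: M1_def)
    have PM: "(P * M) $$ (i, k) = (\<Sum>l<Suc n. P $$ (i, l) * M $$ (l, k))"
      if "i < Suc n" "k < Suc n" for i k
      using that Pc Suc.prems by (auto simp: scalar_prod_def atLeast0LessThan intro!: sum.cong)
    have M1e: "M1 $$ (i, j) = (\<Sum>k<Suc n. (\<Sum>l<Suc n. P $$ (i, l) * M $$ (l, k)) * Q $$ (j, k))"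
      if "i < Suc n" "j < Suc n" for i j
    proof -
      have "M1 $$ (i, j) = (\<Sum>k<Suc n. (P * M) $$ (i, k) * Q $$ (j, k))"
        unfolding M1_def
        by (subst index_mult_mat_sum[OF mult_carrier_mat[OF Pc Suc.prems] transpose_carrier_mat[THEN iffD2, OF Qc] that])
          (rule sum.cong[OF refl], use Qc that in simp)
      also have "\<dots> = (\<Sum>k<Suc n. (\<Sum>l<Suc n. P $$ (i, l) * M $$ (l, k)) * Q $$ (j, k))"
        by (intro sum.cong refl) (simp only: PM[OF that(1)] lessThan_iff)
      finally show ?thesis .
    qed
    have "M1 $$ (0, 0) = (\<Sum>k<Suc n. (\<Sum>l<Suc n. if l = p then M $$ (p, k) else 0) * (if k = q then 1 else 0))"
      unfolding M1e[OF zero_less_Suc zero_less_Suc]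
      by (intro sum.cong arg_cong2[of _ _ _ _ "(*)"] refl) (auto simp: P(2) Q(2))
    also have "\<dots> = (\<Sum>k<Suc n. if k = q then M $$ (p, q) else 0)"
      using pq(1) by (intro sum.cong refl) auto
    also have "\<dots> = s" using pq by simp
    finally have M100: "M1 $$ (0, 0) = s" .
    have "M1 $$ (i, j) / s \<in> R" if "i < Suc n" "j < Suc n" for i j
    proof -
      have "M1 $$ (i, j) / s = (\<Sum>k<Suc n. (\<Sum>l<Suc n. P $$ (i, l) * (M $$ (l, k) / s)) * Q $$ (j, k))"
        unfolding M1e[OF that] by (simp only: sum_divide_distrib sum_distrib_right times_divide_eq_left times_divide_eq_right)
      also have "\<dots> \<in> R"
        using P(1) Q(1) that by (intro R_sum R_mult sdiv) (auto simp: SLR_def)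
      finally show ?thesis .
    qed
    then obtain L U N where LUN: "L \<in> SLR (Suc n)" "U \<in> SLR (Suc n)" "N \<in> carrier_mat n n"
      "L * M1 * U = four_block_mat (mat 1 1 (\<lambda>_. s)) (0\<^sub>m 1 n) (0\<^sub>m n 1) N"
      using SLR_eliminate[OF M1] pq(4) unfolding M100 by metis
    obtain A B d where AB: "A \<in> SLR n" "B \<in> SLR n" "A * N * B = mat_diag n d"
      using Suc.IH[OF LUN(3)] by blast
    note Ac = SLR_carrier[OF AB(1)] and Bc = SLR_carrier[OF AB(2)]
    let ?A = "four_block_mat (1\<^sub>m 1) (0\<^sub>m 1 n) (0\<^sub>m n 1) A"
    let ?B = "four_block_mat (1\<^sub>m 1) (0\<^sub>m 1 n) (0\<^sub>m n 1) B"
    let ?D = "\<lambda>i. case i of 0 \<Rightarrow> s | Suc i \<Rightarrow> d i"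
    have s1: "mat 1 1 (\<lambda>_. s) \<in> carrier_mat 1 1" by simp
    have "?A * (L * M1 * U) * ?B = four_block_mat (mat 1 1 (\<lambda>_. s)) (0\<^sub>m 1 n) (0\<^sub>m n 1) (A * N * B)"
      unfolding LUN(4) using Ac Bc LUN(3) s1
      by (simp add: mult_four_block_mat[of _ 1 1 _ n _ n _ _ 1 _ n])
    also have "\<dots> = mat_diag (Suc n) ?D"
      unfolding AB(3) by (rule eq_matI) (auto simp: mat_diag_def split: nat.splits)
    finally have "?A * (L * M1 * U) * ?B = mat_diag (Suc n) ?D" .
    moreover have "?A * (L * M1 * U) * ?B = (?A * L * P) * M * (transpose_mat Q * U * ?B)"
    proof -
      have c: "?A \<in> carrier_mat (Suc n) (Suc n)" "?B \<in> carrier_mat (Suc n) (Suc n)"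
        "L \<in> carrier_mat (Suc n) (Suc n)" "U \<in> carrier_mat (Suc n) (Suc n)"
        "transpose_mat Q \<in> carrier_mat (Suc n) (Suc n)"
        using SLR_carrier[OF SLR_block[OF AB(1)]] SLR_carrier[OF SLR_block[OF AB(2)]]
          SLR_carrier[OF LUN(1)] SLR_carrier[OF LUN(2)] Qc by auto
      then show ?thesis
        unfolding M1_def using Pc Suc.prems
        by (simp add: assoc_mult_mat[of _ "Suc n" "Suc n" _ "Suc n" _ "Suc n"] del: four_block_mat_def)
    qed
    moreover have "?A * L * P \<in> SLR (Suc n)" "transpose_mat Q * U * ?B \<in> SLR (Suc n)"
      by (intro SLR_mult SLR_block AB P LUN Q SLR_transpose)+
    ultimately show ?thesis by metis
  qed
qed

end

section \<open>Weights of a place\<close>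

text \<open>The graph of a character from a group of units of \<open>'k\<close> to the units of
  \<open>'a\<close>. As for places, single-valuedness is tested over the neutral element
  only.\<close>

definition char_graph :: "('k::field \<times> 'a::field) set \<Rightarrow> bool" where
  "char_graph G \<longleftrightarrow> (\<forall>x c. (x, c) \<in> G \<longrightarrow> x \<noteq> 0 \<and> c \<noteq> 0) \<and> (1, 1) \<in> G \<and>
     (\<forall>x c y e. (x, c) \<in> G \<longrightarrow> (y, e) \<in> G \<longrightarrow> (x * y, c * e) \<in> G) \<and>
     (\<forall>x c. (x, c) \<in> G \<longrightarrow> (inverse x, inverse c) \<in> G) \<and> (\<forall>c. (1, c) \<in> G \<longrightarrow> c = 1)"

lemma char_graph_eq:
  assumes "char_graph G" "(x, c) \<in> G" "(x, e) \<in> G"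
  shows "c = e"
proof -
  have "(x * inverse x, c * inverse e) \<in> G" "x \<noteq> 0" "e \<noteq> 0"
    using assms unfolding char_graph_def by blast+
  then have "(1, c * inverse e) \<in> G" by simp
  then have "c * inverse e = 1" using assms(1) unfolding char_graph_def by blast
  with \<open>e \<noteq> 0\<close> show ?thesis by (simp add: field_simps)
qed

lemma char_graph_power: "char_graph G \<Longrightarrow> (x, c) \<in> G \<Longrightarrow> (x ^ n, c ^ n) \<in> G"
  by (induction n) (auto simp: char_graph_def)

lemma char_graph_power_int: "char_graph G \<Longrightarrow> (x, c) \<in> G \<Longrightarrow> (x powi n, c powi n) \<in> G"
  using char_graph_power[of G x c] char_graph_power[of G "inverse x" "inverse c"]
  by (auto simp: power_int_def char_graph_def)

lemma char_graph_prod: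
  "char_graph G \<Longrightarrow> (\<And>i. i \<in> S \<Longrightarrow> (F i, H i) \<in> G) \<Longrightarrow> (\<Prod>i\<in>S. F i, \<Prod>i\<in>S. H i) \<in> G"
  by (induction S rule: infinite_finite_induct) (auto simp: char_graph_def)

text \<open>The multiplicative group of an algebraically closed field is divisible, hence injective.\<close>

lemma char_graph_extend:
  fixes G :: "('k::field \<times> 'a::alg_closed_field) set"
  assumes G: "char_graph G" and x: "x \<noteq> 0"
  shows "\<exists>G'. char_graph G' \<and> G \<subseteq> G' \<and> x \<in> Domain G'"
proof -
  have mult: "(a * b, c * e) \<in> G" if "(a, c) \<in> G" "(b, e) \<in> G" for a b c e
    using G that by (auto simp: char_graph_def)
  have inv: "(inverse a, inverse c) \<in> G" if "(a, c) \<in> G" for a c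
    using G that by (auto simp: char_graph_def)
  have nz: "a \<noteq> 0" "c \<noteq> 0" if "(a, c) \<in> G" for a c
    using G that by (auto simp: char_graph_def)
  \<comment> \<open>\<open>\<rho>\<close> will be the value of \<open>x\<close>. If a positive power
    of \<open>x\<close> has a value already, \<open>\<rho>\<close> is a root of the value of the
    least such power; otherwise the choice is free and 1 is taken.\<close>
  have "\<exists>\<rho>. \<rho> \<noteq> 0 \<and> (\<forall>j c. (x powi j, c) \<in> G \<longrightarrow> \<rho> powi j = c)"
  proof (cases "\<exists>n>0. x ^ n \<in> Domain G")
    case True
    define n where "n = (LEAST n. n > 0 \<and> x ^ n \<in> Domain G)"
    have n: "n > 0" "x ^ n \<in> Domain G"
      using LeastI_ex[OF True] by (auto simp: n_def)
    have min: "n \<le> k" if "k > 0" "x ^ k \<in> Domain G" for k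
      unfolding n_def by (rule Least_le) (use that in auto)
    obtain c0 where c0: "(x ^ n, c0) \<in> G" using n by blast
    obtain \<rho> where \<rho>: "\<rho> ^ n = c0" using nth_root_exists[OF n(1)] by blast
    have "\<rho> \<noteq> 0" using \<rho> nz[OF c0] n(1) by auto
    moreover have "\<rho> powi j = c" if j: "(x powi j, c) \<in> G" for j c
    proof -
      \<comment> \<open>Division with remainder by \<open>n\<close> puts \<open>x ^ r\<close> into
        the domain, and minimality of \<open>n\<close> forces \<open>r = 0\<close>.\<close>
      define q r where "q = j div int n" and "r = nat (j mod int n)"
      have jqr: "j = int n * q + int r" and rn: "r < n"
        using n(1) by (auto simp: q_def r_def nat_less_iff)
      have e: "((x ^ n) powi q, c0 powi q) \<in> G" by (rule char_graph_power_int[OF G c0])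
      have pw: "z powi j = (z ^ n) powi q * z ^ r" if "z \<noteq> 0" for z :: "'b::field"
        using that unfolding jqr by (simp add: power_int_add power_int_mult)
      have "(x powi j * inverse ((x ^ n) powi q), c * inverse (c0 powi q)) \<in> G"
        by (intro mult inv e j)
      moreover have "x powi j * inverse ((x ^ n) powi q) = x ^ r"
        using x by (simp add: pw)
      ultimately have "x ^ r \<in> Domain G" by auto
      with min[of r] rn have "r = 0" by fastforce
      with pw[OF x] e have "(x powi j, c0 powi q) \<in> G" by simp
      then have "c = c0 powi q" by (rule char_graph_eq[OF G j])
      also have "\<dots> = \<rho> powi j" using pw[OF \<open>\<rho> \<noteq> 0\<close>] \<open>r = 0\<close> \<rho> by simp
      finally show ?thesis ..
    qed
    ultimately show ?thesis by blast
  next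
    case False
    have "1 powi j = c" if j: "(x powi j, c) \<in> G" for j c
    proof -
      have "j = 0"
      proof (rule ccontr)
        assume "j \<noteq> 0"
        then have "nat \<bar>j\<bar> > 0" by simp
        moreover have "x ^ nat \<bar>j\<bar> \<in> Domain G"
          using j inv[OF j] by (cases "j \<ge> 0") (auto simp: power_int_def power_inverse)
        ultimately show False using False by blast
      qed
      with j G show ?thesis by (auto simp: char_graph_def)
    qed
    then show ?thesis by (intro exI[of _ 1]) auto
  qed
  then obtain \<rho> where \<rho>: "\<rho> \<noteq> 0" "\<And>j c. (x powi j, c) \<in> G \<Longrightarrow> \<rho> powi j = c" by blast
  define G' where "G' = {(u * x powi j, v * \<rho> powi j) |u v j. (u, v) \<in> G}"
  have G'I: "(u * x powi j, v * \<rho> powi j) \<in> G'" if "(u, v) \<in> G" for u v j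
    using that by (auto simp: G'_def)
  have one: "(1, 1) \<in> G" using G by (simp add: char_graph_def)
  have sub: "G \<subseteq> G'"
  proof safe
    fix u v assume "(u, v) \<in> G"
    from G'I[OF this, of 0] show "(u, v) \<in> G'" by simp
  qed
  have "char_graph G'"
    unfolding char_graph_def
  proof (intro conjI allI impI)
    show "(1, 1) \<in> G'" using sub one by blast
  next
    fix a c assume "(a, c) \<in> G'"
    then obtain u v j where uv: "a = u * x powi j" "c = v * \<rho> powi j" "(u, v) \<in> G"
      by (auto simp: G'_def)
    show "a \<noteq> 0" "c \<noteq> 0" using uv nz[OF uv(3)] x \<rho>(1) by auto
    show "(inverse a, inverse c) \<in> G'"
      using G'I[OF inv[OF uv(3)], of "- j"] uv x \<rho>(1) by (simp add: power_int_minus)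
    fix b e assume "(b, e) \<in> G'"
    then obtain u' v' j' where uv': "b = u' * x powi j'" "e = v' * \<rho> powi j'" "(u', v') \<in> G"
      by (auto simp: G'_def)
    show "(a * b, c * e) \<in> G'"
      using G'I[OF mult[OF uv(3) uv'(3)], of "j + j'"] uv uv' x \<rho>(1)
      by (simp add: power_int_add ac_simps)
  next
    fix c assume "(1, c) \<in> G'"
    then obtain u v j where uv: "1 = u * x powi j" "c = v * \<rho> powi j" "(u, v) \<in> G"
      by (auto simp: G'_def)
    then have "x powi j = inverse u" using nz[OF uv(3)] by (simp add: field_simps)
    with inv[OF uv(3)] have "\<rho> powi j = inverse v" by (intro \<rho>(2)) simp
    with uv nz[OF uv(3)] show "c = 1" by simp
  qed
  moreover have "(1 * x powi 1, 1 * \<rho> powi 1) \<in> G'" by (rule G'I[OF one])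
  ultimately show ?thesis using sub by (intro exI[of _ G']) auto
qed

lemma char_graph_extend_family:
  fixes G :: "('k::field \<times> 'a::alg_closed_field) set" and m :: nat
  assumes "char_graph G" "\<And>i. i < m \<Longrightarrow> d i \<noteq> 0"
  shows "\<exists>G'. char_graph G' \<and> G \<subseteq> G' \<and> (\<forall>i<m. d i \<in> Domain G')"
  using assms(2)
proof (induction m)
  case 0
  then show ?case using assms(1) by blast
next
  case (Suc m)
  then obtain G' where G': "char_graph G'" "G \<subseteq> G'" "\<forall>i<m. d i \<in> Domain G'" by auto
  obtain G'' where "char_graph G''" "G' \<subseteq> G''" "d m \<in> Domain G''"
    using char_graph_extend[OF G'(1), of "d m"] Suc.prems by blast
  moreover from this have "d i \<in> Domain G''" if "i < Suc m" for i
    using G'(3) that Domain_mono[of G' G''] by (auto simp: less_Suc_eq)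
  ultimately show ?case using G'(2) by blast
qed

context valuation_place
begin

text \<open>An element with nonzero residue is a unit: otherwise the valuation property, applied to
  its inverse, would give it the residue 0.\<close>

lemma char_graph_units: "char_graph {(u, c) \<in> \<Gamma>. c \<noteq> 0}"
  unfolding char_graph_def
proof (safe; simp?)
  show "(1, 1) \<in> \<Gamma>" by (rule one)
next
  fix c assume "(0, c) \<in> \<Gamma>" "c \<noteq> 0"
  then show False using functional_relD[OF functional] by blast
next
  fix x c y e assume "(x, c) \<in> \<Gamma>" "(y, e) \<in> \<Gamma>"
  then show "(x * y, c * e) \<in> \<Gamma>" by (rule mult)
next
  fix c assume "(1, c) \<in> \<Gamma>"
  then show "c = 1" using functional_eq[OF functional _ one] by blast
next
  fix x c assume x: "(x, c) \<in> \<Gamma>" "c \<noteq> 0"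
  then have "x \<noteq> 0" using functional_relD[OF functional] by blast
  have "inverse x \<in> R"
    using valuation[of "inverse x"] functional_eq[OF functional x(1)] x(2) by auto
  then obtain e where e: "(inverse x, e) \<in> \<Gamma>" by blast
  from mult[OF x(1) e] \<open>x \<noteq> 0\<close> have "(1, c * e) \<in> \<Gamma>" by simp
  then have "c * e = 1" using functional_eq[OF functional _ one] by blast
  with x(2) have "e = inverse c" by (simp add: field_simps)
  with e show "(inverse x, inverse c) \<in> \<Gamma>" by simp
qed

text \<open>A single \<open>d i\<close> may have no residue, but some monomials in the
  \<open>d i\<close> are units. Extending the residue character of the units to all
  \<open>d i\<close> yields one torus element \<open>s\<close> over the ground field that accounts
  for all these residues.\<close>

lemma residue_character:
  fixes m :: nat
  assumes d: "\<And>i. i < m \<Longrightarrow> d i \<noteq> 0" and prod: "(\<Prod>i<m. d i) = 1"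
  obtains s where "\<And>i. i < m \<Longrightarrow> s i \<noteq> 0" "(\<Prod>i<m. s i) = 1"
    "\<And>\<mu> u. keys \<mu> \<subseteq> {..<m} \<Longrightarrow> (monom_eval d \<mu>, u) \<in> \<Gamma> \<Longrightarrow> u \<noteq> 0 \<Longrightarrow> u = monom_eval s \<mu>"
proof -
  obtain G where G: "char_graph G" "{(u, c) \<in> \<Gamma>. c \<noteq> 0} \<subseteq> G" "\<forall>i<m. d i \<in> Domain G"
    using char_graph_extend_family[of _ m d, OF char_graph_units] d by blast
  then have "\<forall>i. \<exists>c. i < m \<longrightarrow> (d i, c) \<in> G" by auto
  then obtain s where s: "\<And>i. i < m \<Longrightarrow> (d i, s i) \<in> G" by metis
  have "s i \<noteq> 0" if "i < m" for i
    using s[OF that] G(1) by (auto simp: char_graph_def)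
  moreover have "(\<Prod>i<m. s i) = 1"
    using char_graph_prod[OF G(1), of "{..<m}" d s] s G(1) prod by (auto simp: char_graph_def)
  moreover have "u = monom_eval s \<mu>" if "keys \<mu> \<subseteq> {..<m}" "(monom_eval d \<mu>, u) \<in> \<Gamma>" "u \<noteq> 0" for \<mu> u
  proof (rule char_graph_eq[OF G(1)])
    show "(monom_eval d \<mu>, u) \<in> G" using that G(2) by auto
    show "(monom_eval d \<mu>, monom_eval s \<mu>) \<in> G"
      unfolding monom_eval_def
      by (intro char_graph_prod char_graph_power G(1) s) (use that(1) in auto)
  qed
  ultimately show ?thesis by (rule that)
qed

text \<open>
  Integer polynomials encode exponent vectors: \<open>monom 1 i\<close> stands for \<open>d i\<close>.
\<close>

definition val_nonneg :: "nat \<Rightarrow> (nat \<Rightarrow> 'k) \<Rightarrow> int poly \<Rightarrow> bool" where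
  "val_nonneg m d p \<longleftrightarrow> (\<Prod>i<m. d i powi coeff p i) \<in> R"

lemma total_cone_val_nonneg:
  assumes "\<And>i. i < m \<Longrightarrow> d i \<noteq> 0"
  shows "total_cone (val_nonneg m d)"
proof
  fix p q assume "val_nonneg m d p" "val_nonneg m d q"
  then have "(\<Prod>i<m. d i powi coeff p i) * (\<Prod>i<m. d i powi coeff q i) \<in> R"
    unfolding val_nonneg_def by (rule R_mult)
  also have "(\<Prod>i<m. d i powi coeff p i) * (\<Prod>i<m. d i powi coeff q i) = (\<Prod>i<m. d i powi coeff (p + q) i)"
    unfolding prod.distrib[symmetric] by (intro prod.cong refl) (simp add: power_int_add assms)
  finally show "val_nonneg m d (p + q)" unfolding val_nonneg_def .
next
  fix p
  have "inverse (\<Prod>i<m. d i powi coeff p i) = (\<Prod>i<m. d i powi coeff (- p) i)"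
    by (simp add: power_int_minus prod_inversef[symmetric])
  then show "val_nonneg m d p \<or> val_nonneg m d (- p)"
    using R_total[of "\<Prod>i<m. d i powi coeff p i"] by (simp add: val_nonneg_def)
qed

lemma val_nonneg_pairing:
  "val_nonneg m d (pairing m \<tau> (monom 1)) \<longleftrightarrow> (\<Prod>i<m. d i powi \<tau> i) \<in> R"
proof -
  have "coeff (pairing m \<tau> (monom 1)) i = \<tau> i" if "i < m" for i
  proof -
    have "coeff (pairing m \<tau> (monom 1)) i = (\<Sum>j<m. if j = i then \<tau> i else 0)"
      unfolding pairing_def coeff_sum by (intro sum.cong refl) (simp add: of_int_poly coeff_monom)
    with that show ?thesis by simp
  qed
  then show ?thesis by (simp add: val_nonneg_def)
qed

text \<open>The polynomials \<open>a = g(A x)\<close> and \<open>g(M B x) = a(D x)\<close> both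
  specialize, and their coefficients at \<open>\<mu>\<close> differ by the factor
  \<open>monom_eval d \<mu>\<close>. A factor outside \<open>R\<close> forces the residue of the
  first coefficient to vanish, a factor in the maximal ideal that of the second, and a unit relates
  the two residues by its own. The integer weights record which case occurs.\<close>

lemma exists_weights:
  assumes M: "M \<in> SL m" and g: "g \<in> mpols m" and f: "f \<in> mpols m"
    and rel: "prel (lsub m \<iota> M g) f"
  obtains A0 B0 s and k :: "nat \<Rightarrow> int" where "A0 \<in> SL m" "B0 \<in> SL m"
    "\<And>i. i < m \<Longrightarrow> s i \<noteq> 0" "(\<Prod>i<m. s i) = 1" "(\<Sum>i<m. k i) = 0"
    "\<And>i. i < m \<Longrightarrow> \<bar>k i\<bar> \<le> int m * (fact m * int (max 1 (mdeg g)) ^ m)"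
    "\<And>\<mu>. keys \<mu> \<subseteq> {..<m} \<Longrightarrow> (\<Sum>i<m. int (lookup \<mu> i) * k i) < 0 \<Longrightarrow>
      lookup (lsub m id A0 g) \<mu> = 0"
    "\<And>\<mu>. keys \<mu> \<subseteq> {..<m} \<Longrightarrow> (\<Sum>i<m. int (lookup \<mu> i) * k i) > 0 \<Longrightarrow>
      lookup (lsub m id B0 f) \<mu> = 0"
    "\<And>\<mu>. keys \<mu> \<subseteq> {..<m} \<Longrightarrow> (\<Sum>i<m. int (lookup \<mu> i) * k i) = 0 \<Longrightarrow>
      lookup (lsub m id B0 f) \<mu> = monom_eval s \<mu> * lookup (lsub m id A0 g) \<mu>"
proof -
  have Mc: "M \<in> carrier_mat m m" and detM: "det M = 1" using M by (auto simp: SL_def)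
  obtain A' B d where A': "A' \<in> SLR m" and B: "B \<in> SLR m" and D: "A' * M * B = mat_diag m d"
    using smith_normal_form[OF Mc] by blast
  define A where "A = adj_mat A'"
  have A: "A \<in> SLR m" and AA: "A * A' = 1\<^sub>m m"
    using SLR_adj[OF A'] by (auto simp: A_def)
  note Ac = SLR_carrier[OF A] and A'c = SLR_carrier[OF A'] and Bc = SLR_carrier[OF B]
  have MB: "M * B = A * mat_diag m d"
  proof -
    have "A * (A' * M * B) = A * A' * (M * B)"
      using Ac A'c Bc Mc by (simp add: assoc_mult_mat[of _ m m _ m _ m])
    also have "\<dots> = M * B" unfolding AA using Mc Bc by simp
    finally show ?thesis unfolding D ..
  qed
  have "(\<Prod>i<m. d i) = det (mat_diag m d)"
    by (subst det_upper_triangular[of _ m]) (auto simp: mat_diag_def prod_list_diag_prod atLeast0LessThan)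
  also have "\<dots> = det A' * det M * det B"
    unfolding D[symmetric]
    using det_mult[OF mult_carrier_mat[OF A'c Mc] Bc] det_mult[OF A'c Mc] by simp
  also have "\<dots> = 1" using A' B detM by (simp add: SLR_def SL_def)
  finally have dprod: "(\<Prod>i<m. d i) = 1" .
  have dnz: "d i \<noteq> 0" if "i < m" for i
  proof
    assume "d i = 0"
    with that have "(\<Prod>i<m. d i) = 0" by (intro prod_zero) auto
    with dprod show False by simp
  qed
  obtain A0 where A0: "A0 \<in> SL m" "mrel m A A0" using SLR_reduction[OF A] .
  obtain B0 where B0: "B0 \<in> SL m" "mrel m B B0" using SLR_reduction[OF B] .
  define a a0 y where "a = lsub m \<iota> A g" and "a0 = lsub m id A0 g" and "y = lsub m id B0 f"
  have a: "(lookup a \<mu>, lookup a0 \<mu>) \<in> \<Gamma>" for \<mu>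
    using prel_lsub[OF A0(2) g] by (simp add: a_def a0_def prel_def)
  have "prel (lsub m id B (lsub m \<iota> M g)) y"
    unfolding y_def by (rule prel_lsub_id[OF B0(2) f mpols_lsub[OF g] rel])
  also have "lsub m id B (lsub m \<iota> M g) = lsub m id (mat_diag m d) a"
    unfolding a_def by (simp add: lsub_id_lsub[OF Mc Bc g] lsub_id_lsub[OF Ac _ g] MB)
  finally have y': "prel (lsub m id (mat_diag m d) a) y" .
  have y: "(monom_eval d \<mu> * lookup a \<mu>, lookup y \<mu>) \<in> \<Gamma>" for \<mu>
  proof -
    have "lookup (lsub m id (mat_diag m d) a) \<mu> = monom_eval d \<mu> * lookup a \<mu>"
      using lookup_lsub_diag[OF mpols_lsub[OF g, of \<iota> A] comm_ring_hom_id, of d \<mu>]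
      by (simp add: a_def)
    then show ?thesis using y' unfolding prel_def by metis
  qed
  obtain s where s: "\<And>i. i < m \<Longrightarrow> s i \<noteq> 0" "(\<Prod>i<m. s i) = 1"
    "\<And>\<mu> u. keys \<mu> \<subseteq> {..<m} \<Longrightarrow> (monom_eval d \<mu>, u) \<in> \<Gamma> \<Longrightarrow> u \<noteq> 0 \<Longrightarrow> u = monom_eval s \<mu>"
    using residue_character[OF dnz dprod] by blast
  \<comment> \<open>The maximum with 1 keeps the vector of all ones in the box even if
    \<open>g\<close> is constant.\<close>
  define D where "D = int (max 1 (mdeg g))"
  have D1: "1 \<le> D" by (simp add: D_def)
  interpret total_cone "val_nonneg m d" by (rule total_cone_val_nonneg[OF dnz])
  obtain k :: "nat \<Rightarrow> int" where k: "\<And>i. i < m \<Longrightarrow> \<bar>k i\<bar> \<le> int m * (fact m * D ^ m)"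
    "\<And>\<tau>. \<tau> \<in> weight_box m D \<Longrightarrow> val_nonneg m d (pairing m \<tau> (monom 1)) \<longleftrightarrow> 0 \<le> pairing m \<tau> k"
    using small_weights[OF D1, of m "monom 1"] by blast
  have sgn1: "(\<Prod>i<m. d i powi \<tau> i) \<in> R \<longleftrightarrow> 0 \<le> (\<Sum>i<m. \<tau> i * k i)"
    and sgn2: "inverse (\<Prod>i<m. d i powi \<tau> i) \<in> R \<longleftrightarrow> (\<Sum>i<m. \<tau> i * k i) \<le> 0"
    if "\<tau> \<in> weight_box m D" for \<tau>
  proof -
    have "(\<lambda>i. - \<tau> i) \<in> weight_box m D" using that by (simp add: weight_box_def)
    from k(2)[OF that] k(2)[OF this]
    show "(\<Prod>i<m. d i powi \<tau> i) \<in> R \<longleftrightarrow> 0 \<le> (\<Sum>i<m. \<tau> i * k i)"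
      "inverse (\<Prod>i<m. d i powi \<tau> i) \<in> R \<longleftrightarrow> (\<Sum>i<m. \<tau> i * k i) \<le> 0"
      unfolding val_nonneg_pairing by (simp_all add: pairing_def power_int_minus sum_negf prod_inversef[symmetric] o_def)
  qed
  \<comment> \<open>The product of all \<open>d i\<close> is 1, so its exponent vector has weight 0.
    This puts the one-parameter subgroup into the special linear group.\<close>
  have ksum: "(\<Sum>i<m. k i) = 0"
  proof -
    have "(\<lambda>i. if i < m then 1 else 0) \<in> weight_box m D" using D1 by (simp add: weight_box_def)
    from sgn1[OF this] sgn2[OF this] show ?thesis
      by (simp add: dprod R_one)
  qed
  have main: "((\<Sum>i<m. int (lookup \<mu> i) * k i) < 0 \<longrightarrow> lookup a0 \<mu> = 0) \<and>
      ((\<Sum>i<m. int (lookup \<mu> i) * k i) > 0 \<longrightarrow> lookup y \<mu> = 0) \<and>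
      ((\<Sum>i<m. int (lookup \<mu> i) * k i) = 0 \<longrightarrow> lookup y \<mu> = monom_eval s \<mu> * lookup a0 \<mu>)"
    if \<mu>: "keys \<mu> \<subseteq> {..<m}" for \<mu>
  \<comment> \<open>Exponents not occurring in \<open>a\<close> may lie outside the box, but there
    both residues are residues of 0.\<close>
  proof (cases "lookup a \<mu> = 0")
    case True
    have "lookup a0 \<mu> = 0" "lookup y \<mu> = 0"
      using a[of \<mu>] y[of \<mu>] functional_relD[OF functional] unfolding True by auto
    then show ?thesis by simp
  next
    case False
    have "a \<in> mpols_le m (mdeg g)"
      unfolding a_def by (intro mpols_le_lsub mpols_imp_mpols_le g)
    with False have deg: "tdeg \<mu> \<le> mdeg g" by (simp add: mpols_le_def in_keys_iff)
    have "lookup \<mu> i \<le> mdeg g" for i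
    proof (cases "i \<in> keys \<mu>")
      case True
      then have "lookup \<mu> i \<le> tdeg \<mu>" unfolding tdeg_def by (intro member_le_sum) auto
      with deg show ?thesis by simp
    qed (simp add: in_keys_iff)
    then have "int (lookup \<mu> i) \<le> D" for i
      unfolding D_def by (meson max.coboundedI2 of_nat_mono)
    moreover have "lookup \<mu> i = 0" if "i \<ge> m" for i
      using \<mu> that by (metis in_keys_iff lessThan_iff not_less subsetD)
    ultimately have weight_box: "(\<lambda>i. int (lookup \<mu> i)) \<in> weight_box m D" by (auto simp: weight_box_def)
    have md: "(\<Prod>i<m. d i powi int (lookup \<mu> i)) = monom_eval d \<mu>"
      using \<mu> by (simp add: monom_eval_superset[of "{..<m}"])
    have nz: "monom_eval d \<mu> \<noteq> 0"
      using dnz \<mu> by (auto simp: monom_eval_def)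
    note sg = sgn1[OF weight_box, unfolded md] sgn2[OF weight_box, unfolded md]
    show ?thesis
    proof (intro conjI impI)
      assume "(\<Sum>i<m. int (lookup \<mu> i) * k i) < 0"
      then have "(inverse (monom_eval d \<mu>), 0) \<in> \<Gamma>" using sg(1) valuation by fastforce
      from mult[OF y[of \<mu>] this] nz have "(lookup a \<mu>, 0) \<in> \<Gamma>" by (simp add: field_simps)
      with a show "lookup a0 \<mu> = 0" by (rule functional_eq[OF functional])
    next
      assume "(\<Sum>i<m. int (lookup \<mu> i) * k i) > 0"
      then have "(inverse (inverse (monom_eval d \<mu>)), 0) \<in> \<Gamma>" using sg(2) valuation by fastforce
      from mult[OF this a[of \<mu>]] have "(monom_eval d \<mu> * lookup a \<mu>, 0) \<in> \<Gamma>" by simp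
      with y show "lookup y \<mu> = 0" by (rule functional_eq[OF functional])
    next
      assume "(\<Sum>i<m. int (lookup \<mu> i) * k i) = 0"
      then obtain u u' where u: "(monom_eval d \<mu>, u) \<in> \<Gamma>" "(inverse (monom_eval d \<mu>), u') \<in> \<Gamma>"
        using sg by fastforce
      from mult[OF this] nz have "(1, u * u') \<in> \<Gamma>" by simp
      then have "u * u' = 1" by (rule functional_eq[OF functional _ one])
      then have "u = monom_eval s \<mu>" by (intro s(3)[OF \<mu> u(1)]) auto
      with mult[OF u(1) a[of \<mu>]] have "(monom_eval d \<mu> * lookup a \<mu>, monom_eval s \<mu> * lookup a0 \<mu>) \<in> \<Gamma>" by simp
      with y show "lookup y \<mu> = monom_eval s \<mu> * lookup a0 \<mu>" by (rule functional_eq[OF functional])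
    qed
  qed
  show ?thesis
    by (rule that[OF A0(1) B0(1) s(1,2) ksum])
      (use k(1) main in \<open>auto simp: D_def a0_def y_def\<close>)
qed

end

section \<open>The generic point of the special linear group\<close>

lemma minv_eq:
  assumes "A \<in> carrier_mat m m" "B \<in> carrier_mat m m" "A * B = 1\<^sub>m m" "B * A = 1\<^sub>m m"
  shows "minv A = B"
  unfolding minv_def
proof (rule the_equality)
  fix C assume "C \<in> carrier_mat (dim_row A) (dim_row A) \<and> inverts_mat A C \<and> inverts_mat C A"
  then have C: "C \<in> carrier_mat m m" "C * A = 1\<^sub>m m" using assms(1) by (auto simp: inverts_mat_def)
  have "C = C * (A * B)" unfolding assms(3) using C(1) by simp
  also have "\<dots> = C * A * B" by (rule assoc_mult_mat[OF C(1) assms(1,2), symmetric])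
  also have "\<dots> = B" unfolding C(2) using assms by simp
  finally show "C = B" .
qed (use assms in \<open>auto simp: inverts_mat_def\<close>)

lemma SL_minv:
  assumes "A \<in> SL m"
  shows "minv A \<in> SL m" "A * minv A = 1\<^sub>m m" "minv A * A = 1\<^sub>m m" "minv (minv A) = A"
proof -
  have A: "A \<in> carrier_mat m m" "det A = 1" using assms by (auto simp: SL_def)
  note adj = adj_mat[OF A(1)]
  have inv: "A * adj_mat A = 1\<^sub>m m" "adj_mat A * A = 1\<^sub>m m" using adj A by auto
  have eq: "minv A = adj_mat A" by (rule minv_eq[OF A(1) adj(1) inv])
  have "det A * det (adj_mat A) = det (A * adj_mat A)" by (rule det_mult[OF A(1) adj(1), symmetric])
  then have "det (adj_mat A) = 1" unfolding inv(1) A(2) by simp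
  then show "minv A \<in> SL m" using adj(1) by (simp add: eq SL_def)
  show "A * minv A = 1\<^sub>m m" "minv A * A = 1\<^sub>m m" using inv by (simp_all add: eq)
  show "minv (minv A) = A" unfolding eq by (rule minv_eq[OF adj(1) A(1) inv(2,1)])
qed

lemma SL_mult: "A \<in> SL m \<Longrightarrow> B \<in> SL m \<Longrightarrow> A * B \<in> SL m"
  by (auto simp: SL_def det_mult)

text \<open>Inversion permutes the special linear group, so the inverse in the action disappears
  when only the orbit matters.\<close>

lemma orbit_eq_lsub: "orbit m f = (\<lambda>N. lsub m id N f) ` SL m"
proof -
  have "minv ` SL m = (SL m :: 'a mat set)"
  proof (intro equalityI subsetI)
    fix A :: "'a mat" assume "A \<in> SL m"
    from SL_minv(1)[OF this] SL_minv(4)[OF this] show "A \<in> minv ` SL m" by (intro image_eqI[of _ _ "minv A"]) simp_all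
  qed (use SL_minv(1) in blast)
  then have "orbit m f = (\<lambda>N. lsub m id N f) ` (minv ` SL m)"
    unfolding orbit_def act_eq_lsub image_image by simp
  with \<open>minv ` SL m = SL m\<close> show ?thesis by simp
qed

lemma orbit_eq_if_mem:
  assumes "h \<in> mpols m" "f \<in> orbit m h"
  shows "orbit m f = orbit m h"
proof -
  obtain N where N: "N \<in> SL m" "f = lsub m id N h" using assms(2) unfolding orbit_eq_lsub by auto
  have c: "A \<in> carrier_mat m m" if "A \<in> SL m" for A using that by (simp add: SL_def)
  have "lsub m id A f = lsub m id (N * A) h" if "A \<in> SL m" for A
    unfolding N(2) by (rule lsub_id_lsub[OF c[OF N(1)] c[OF that] assms(1)])
  moreover have "lsub m id A h = lsub m id (minv N * A) f" if "A \<in> SL m" for A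
  proof -
    have "N * (minv N * A) = A"
      using assoc_mult_mat[OF c[OF N(1)] c[OF SL_minv(1)[OF N(1)]] c[OF that]] SL_minv(2)[OF N(1)] c[OF that]
      by simp
    then show ?thesis
      unfolding N(2) using lsub_id_lsub[OF c[OF N(1)] c[OF SL_mult[OF SL_minv(1)[OF N(1)] that]] assms(1), of id]
      by simp
  qed
  ultimately have "lsub m id A f \<in> orbit m h" "lsub m id A h \<in> orbit m f" if "A \<in> SL m" for A
    using that SL_mult[OF N(1) that] SL_mult[OF SL_minv(1)[OF N(1)] that]
    unfolding orbit_eq_lsub by blast+
  then show ?thesis
    by (intro equalityI subsetI) (auto simp: orbit_eq_lsub[of m f] orbit_eq_lsub[of m h])
qed

section \<open>Specialization of rational functions at a matrix\<close>

definition to_fract :: "'b::idom \<Rightarrow> 'b fract" where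
  "to_fract P = Fract P 1"

lemma comm_ring_hom_to_fract: "comm_ring_hom to_fract"
  by unfold_locales (auto simp: to_fract_def Zero_fract_def One_fract_def)

text \<open>The variable with index \<open>i * m + j\<close> stands for the entry in row
  \<open>i\<close> and column \<open>j\<close>.\<close>

definition eval_mat :: "nat \<Rightarrow> 'a::field mat \<Rightarrow> (nat, 'a) mpol \<Rightarrow> 'a" where
  "eval_mat m N P = mp_subst id (\<lambda>v. N $$ (v div m, v mod m)) P"

lemma comm_ring_hom_eval_mat: "comm_ring_hom (eval_mat m N)"
  unfolding eval_mat_def by (rule comm_ring_hom.comm_ring_hom_mp_subst[OF comm_ring_hom_id])

text \<open>The local ring of the space of matrices at the point \<open>N\<close>, with evaluation
  at \<open>N\<close> as residue map.\<close>

definition specialization :: "nat \<Rightarrow> 'a::field mat \<Rightarrow> ((nat, 'a) mpol fract \<times> 'a) set" where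
  "specialization m N = {(Fract P Q, eval_mat m N P / eval_mat m N Q) |P Q. eval_mat m N Q \<noteq> 0}"

lemma place_rel_specialization: "place_rel (\<lambda>c. to_fract (Cst c)) (specialization m N)"
proof -
  interpret ev: comm_ring_hom "eval_mat m N" by (rule comm_ring_hom_eval_mat)
  have "eval_mat m N (Cst c) = c" for c
    unfolding eval_mat_def by (simp add: comm_ring_hom.mp_subst_Cst[OF comm_ring_hom_id])
  then have c: "(to_fract (Cst c), c) \<in> specialization m N" for c
    unfolding specialization_def to_fract_def by force
  have nz: "Q \<noteq> 0" if "eval_mat m N Q \<noteq> 0" for Q using that by auto
  show ?thesis
  proof (rule place_rel.intro[OF comm_ring_hom_comp[OF comm_ring_hom_to_fract comm_ring_hom_Cst] c])
    fix a x b y assume "(a, x) \<in> specialization m N" "(b, y) \<in> specialization m N"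
    then obtain P Q P' Q' where *: "a = Fract P Q" "x = eval_mat m N P / eval_mat m N Q" "eval_mat m N Q \<noteq> 0"
      "b = Fract P' Q'" "y = eval_mat m N P' / eval_mat m N Q'" "eval_mat m N Q' \<noteq> 0"
      unfolding specialization_def by blast
    have "a + b = Fract (P * Q' + P' * Q) (Q * Q')" "a * b = Fract (P * P') (Q * Q')"
      using * nz by auto
    moreover have "x + y = eval_mat m N (P * Q' + P' * Q) / eval_mat m N (Q * Q')"
      "x * y = eval_mat m N (P * P') / eval_mat m N (Q * Q')"
      using * by (simp_all add: ev.hom_add ev.hom_mult add_frac_eq)
    moreover have "eval_mat m N (Q * Q') \<noteq> 0" using * by (simp add: ev.hom_mult)
    ultimately show "(a + b, x + y) \<in> specialization m N" "(a * b, x * y) \<in> specialization m N"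
      unfolding specialization_def by blast+
  qed
qed

lemma functional_specialization: "functional_rel (specialization m N)"
proof -
  interpret ev: comm_ring_hom "eval_mat m N" by (rule comm_ring_hom_eval_mat)
  show ?thesis
    unfolding functional_rel_def
  proof (intro allI impI)
    fix c assume "(0, c) \<in> specialization m N"
    then obtain P Q where *: "0 = Fract P Q" "c = eval_mat m N P / eval_mat m N Q" "eval_mat m N Q \<noteq> 0"
      unfolding specialization_def by blast
    have "Q \<noteq> 0" using *(3) by auto
    with *(1) have "P = 0" by (simp add: Zero_fract_def eq_fract)
    with *(2) show "c = 0" by simp
  qed
qed

lemma specialization_inverse:
  "(x, c) \<in> specialization m N \<Longrightarrow> c \<noteq> 0 \<Longrightarrow> (inverse x, inverse c) \<in> specialization m N"
proof -
  assume "(x, c) \<in> specialization m N" "c \<noteq> 0"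
  then obtain P Q where *: "x = Fract P Q" "c = eval_mat m N P / eval_mat m N Q" "eval_mat m N P \<noteq> 0"
    unfolding specialization_def by auto
  then have "inverse x = Fract Q P" "inverse c = eval_mat m N Q / eval_mat m N P" by simp_all
  with *(3) show ?thesis unfolding specialization_def by blast
qed

lemma specialization_Var:
  "i < m \<Longrightarrow> j < m \<Longrightarrow> (to_fract (Var (i * m + j)), N $$ (i, j)) \<in> specialization m N"
proof -
  assume "i < m" "j < m"
  then have "eval_mat m N (Var (i * m + j)) = N $$ (i, j)"
    unfolding eval_mat_def by (simp add: comm_ring_hom.mp_subst_Var[OF comm_ring_hom_id])
  moreover have "eval_mat m N 1 = 1"
    unfolding eval_mat_def by (rule comm_ring_hom.mp_subst_one[OF comm_ring_hom_id])
  ultimately show ?thesis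
    unfolding specialization_def to_fract_def by force
qed

text \<open>
  The generic point of the special linear group: the generic matrix with its first row divided by
  the determinant.
\<close>

lemma generic_SL:
  obtains M :: "(nat, 'a::field) mpol fract mat" where "M \<in> SL m"
    "\<And>N. N \<in> SL m \<Longrightarrow> place_rel.mrel (specialization m N) m M N"
proof (cases "m = 0")
  case True
  show ?thesis
    by (rule that[of "1\<^sub>m m"]) (auto simp: True SL_def place_rel.mrel_def[OF place_rel_specialization])
next
  case False
  define X :: "(nat, 'a) mpol fract mat" where "X = mat m m (\<lambda>(i, j). to_fract (Var (i * m + j)))"
  define M where "M = multrow 0 (inverse (det X)) X"
  have X: "X \<in> carrier_mat m m" by (simp add: X_def)
  have Xr: "place_rel.mrel (specialization m N) m X N" for N
    unfolding place_rel.mrel_def[OF place_rel_specialization]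
    by (auto simp: X_def specialization_Var)
  have det: "(det X, 1) \<in> specialization m N" if "N \<in> SL m" for N
    using place_rel.det_rel[OF place_rel_specialization X _ Xr, of N] that by (simp add: SL_def)
  have "det X \<noteq> 0"
  proof
    assume "det X = 0"
    moreover have "1\<^sub>m m \<in> SL m" by (simp add: SL_def)
    ultimately show False
      using det functional_relD[OF functional_specialization, of 1 m "1\<^sub>m m"] by force
  qed
  show ?thesis
  proof (rule that[of M])
    show "M \<in> SL m"
      using X False \<open>det X \<noteq> 0\<close> det_multrow[of 0 m X "inverse (det X)"] by (simp add: M_def SL_def)
    fix N :: "'a mat" assume N: "N \<in> SL m"
    \<comment> \<open>The determinant takes the value 1 at \<open>N\<close>, so dividing the first
      row by \<open>det X\<close> leaves the specialization unchanged.\<close>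
    have "(inverse (det X), inverse 1) \<in> specialization m N"
      by (rule specialization_inverse[OF det[OF N]]) simp
    then have "(inverse (det X) * X $$ (i, j), 1 * N $$ (i, j)) \<in> specialization m N" if "i < m" "j < m" for i j
      using Xr[of N] that unfolding place_rel.mrel_def[OF place_rel_specialization]
      by (intro place_rel.mult[OF place_rel_specialization]) auto
    then show "place_rel.mrel (specialization m N) m M N"
      using Xr[of N] X unfolding place_rel.mrel_def[OF place_rel_specialization]
      by (auto simp: M_def)
  qed
qed

theorem generic_place:
  fixes f g :: "(nat, 'a::alg_closed_field) mpol"
  assumes g: "g \<in> mpols m" and f: "f \<in> zariski_closure (orbit m g)"
  obtains \<Gamma> and M :: "(nat, 'a) mpol fract mat" where "valuation_place (\<lambda>c. to_fract (Cst c)) \<Gamma>" "M \<in> SL m"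
    "place_rel.prel \<Gamma> (lsub m (\<lambda>c. to_fract (Cst c)) M g) f"
proof -
  let ?\<iota> = "\<lambda>c. to_fract (Cst c) :: (nat, 'a) mpol fract"
  obtain M :: "(nat, 'a) mpol fract mat" where M: "M \<in> SL m"
    "\<And>N. N \<in> SL m \<Longrightarrow> place_rel.mrel (specialization m N) m M N"
    by (rule generic_SL[of m]) blast
  define G where "G = lsub m ?\<iota> M g"
  have hom: "comm_ring_hom ?\<iota>" by (rule comm_ring_hom_comp[OF comm_ring_hom_to_fract comm_ring_hom_Cst])
  interpret i: comm_ring_hom ?\<iota> by (rule hom)
  interpret e: comm_ring_hom "id :: 'a \<Rightarrow> 'a" by (rule comm_ring_hom_id)
  \<comment> \<open>The subring generated by the constants and the pairs of corresponding
    coefficients of \<open>G\<close> and \<open>f\<close>.\<close>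
  define \<Gamma>0 where "\<Gamma>0 = {(mp_subst ?\<iota> (lookup G) P, mp_subst id (lookup f) P) |P. True}"
  have \<Gamma>0I: "(mp_subst ?\<iota> (lookup G) P, mp_subst id (lookup f) P) \<in> \<Gamma>0" for P
    by (auto simp: \<Gamma>0_def)
  have "place_rel ?\<iota> \<Gamma>0"
  proof (rule place_rel.intro[OF hom])
    show "(?\<iota> c, c) \<in> \<Gamma>0" for c
      using \<Gamma>0I[of "Cst c"] by (simp add: i.mp_subst_Cst e.mp_subst_Cst)
    fix a x b y assume "(a, x) \<in> \<Gamma>0" "(b, y) \<in> \<Gamma>0"
    then obtain P Q where "a = mp_subst ?\<iota> (lookup G) P" "x = mp_subst id (lookup f) P"
      "b = mp_subst ?\<iota> (lookup G) Q" "y = mp_subst id (lookup f) Q" by (auto simp: \<Gamma>0_def)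
    then show "(a + b, x + y) \<in> \<Gamma>0" "(a * b, x * y) \<in> \<Gamma>0"
      using \<Gamma>0I[of "P + Q"] \<Gamma>0I[of "P * Q"]
      by (simp_all add: i.mp_subst_add e.mp_subst_add i.mp_subst_mult e.mp_subst_mult)
  qed
  moreover have "functional_rel \<Gamma>0"
    unfolding functional_rel_def
  proof (intro allI impI)
    fix c assume "(0, c) \<in> \<Gamma>0"
    then obtain P where P: "0 = mp_subst ?\<iota> (lookup G) P" and c: "c = mp_subst id (lookup f) P"
      by (auto simp: \<Gamma>0_def)
    \<comment> \<open>The generic matrix specializes to every \<open>N\<close>, so a relation among
      the coefficients of \<open>G\<close> holds on the whole orbit, hence on its closure and at
      \<open>f\<close>.\<close>
    have "mp_subst id (lookup h) P = 0" if "h \<in> orbit m g" for h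
    proof -
      from that obtain N where N: "N \<in> SL m" "h = lsub m id N g" unfolding orbit_eq_lsub by auto
      interpret s: place_rel ?\<iota> "specialization m N" by (rule place_rel_specialization)
      have "s.prel G h" unfolding G_def N(2) by (rule s.prel_lsub[OF M(2)[OF N(1)] g])
      then have "(mp_subst ?\<iota> (lookup G) P, mp_subst id (lookup h) P) \<in> specialization m N"
        by (intro s.mp_subst) (simp add: s.prel_def)
      then show ?thesis
        unfolding P[symmetric] by (rule functional_relD[OF functional_specialization])
    qed
    then show "c = 0" unfolding c using f by (simp add: zariski_closure_def)
  qed
  ultimately obtain \<Gamma> where \<Gamma>: "\<Gamma>0 \<subseteq> \<Gamma>" "place_rel ?\<iota> \<Gamma>" "functional_rel \<Gamma>"
    "\<And>x. x \<in> Domain \<Gamma> \<or> (inverse x, 0) \<in> \<Gamma>"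
    by (rule place_extension) blast
  have "(lookup G \<mu>, lookup f \<mu>) \<in> \<Gamma>" for \<mu>
    using \<Gamma>0I[of "Var \<mu>"] \<Gamma>(1) by (auto simp: i.mp_subst_Var e.mp_subst_Var)
  then have "place_rel.prel \<Gamma> G f" by (simp add: place_rel.prel_def[OF \<Gamma>(2)])
  with \<Gamma> M(1) show ?thesis
    by (intro that[of \<Gamma> M]) (auto simp: valuation_place_def valuation_place_axioms_def G_def)
qed

section \<open>Limits in the closed orbit\<close>

text \<open>Over a finite field the product of all \<open>X - a\<close>, increased by 1, would be
  nonconstant without a root.\<close>

lemma infinite_UNIV_alg_closed: "infinite (UNIV :: 'a::alg_closed_field set)"
proof
  assume fin: "finite (UNIV :: 'a set)"
  define p where "p = (\<Prod>a\<in>UNIV. [:- a, 1:]) + (1 :: 'a poly)"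
  have "poly (\<Prod>a\<in>UNIV. [:- a, 1:]) x = 0" for x :: 'a
    unfolding poly_prod by (rule prod_zero[OF fin]) auto
  then have no: "poly p x = 1" for x by (simp add: p_def)
  then have "p \<noteq> [:c:]" if "c \<noteq> 1" for c using that by (metis poly_pCons poly_0 mult_zero_right add.right_neutral)
  moreover have "p \<noteq> 1"
    using fin by (simp add: p_def)
  ultimately have "degree p > 0"
    by (metis degree_eq_zeroE gr0I one_pCons)
  then show False using alg_closed_imp_poly_has_root no by (metis zero_neq_one)
qed

lemma poly_eq_zero_if_nonzero_roots:
  fixes p :: "'a::alg_closed_field poly"
  assumes "\<And>t. t \<noteq> 0 \<Longrightarrow> poly p t = 0"
  shows "p = 0"
proof (rule ccontr)
  assume "p \<noteq> 0"
  then have "finite {t. poly p t = 0}" by (rule poly_roots_finite)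
  moreover have "UNIV - {0} \<subseteq> {t. poly p t = 0}" using assms by auto
  ultimately have "finite (UNIV - {0 :: 'a})" by (rule rev_finite_subset)
  then show False using infinite_UNIV_alg_closed[where 'a = 'a] by simp
qed

lemma comm_ring_hom_poly: "comm_ring_hom (\<lambda>p. poly p t)"
  by unfold_locales auto

text \<open>An equation of \<open>S\<close>, pulled back to the polynomial curve \<open>q\<close>,
  is a univariate polynomial vanishing at all nonzero \<open>t\<close>, hence also at 0.\<close>

lemma in_zariski_closure_at_zero:
  fixes q :: "(nat \<Rightarrow>\<^sub>0 nat) \<Rightarrow> 'a::alg_closed_field poly"
  assumes q: "\<And>t. t \<noteq> 0 \<Longrightarrow> \<exists>h\<in>S. \<forall>\<mu>. poly (q \<mu>) t = lookup h \<mu>"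
    and c: "\<And>\<mu>. poly (q \<mu>) 0 = lookup c \<mu>"
  shows "c \<in> zariski_closure S"
  unfolding zariski_closure_def
proof (intro CollectI allI impI)
  fix P :: "(nat \<Rightarrow>\<^sub>0 nat, 'a) mpol"
  assume P: "\<forall>h\<in>S. mp_subst id (lookup h) P = 0"
  define Q where "Q = mp_subst (\<lambda>c. [:c:]) q P"
  have eval: "poly Q t = mp_subst id (\<lambda>\<mu>. poly (q \<mu>) t) P" for t
    unfolding Q_def hom_mp_subst[OF comm_ring_hom_poly] by (simp add: id_def)
  have "Q = 0"
  proof (rule poly_eq_zero_if_nonzero_roots)
    fix t :: 'a assume "t \<noteq> 0"
    then obtain h where "h \<in> S" "(\<lambda>\<mu>. poly (q \<mu>) t) = lookup h" using q by blast
    with P show "poly Q t = 0" unfolding eval by simp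
  qed
  with eval[of 0] show "mp_subst id (lookup c) P = 0" by (simp add: c)
qed

definition weight :: "nat \<Rightarrow> (nat \<Rightarrow> int) \<Rightarrow> (nat \<Rightarrow>\<^sub>0 nat) \<Rightarrow> int" where
  "weight m k \<mu> = (\<Sum>i<m. int (lookup \<mu> i) * k i)"

lemma monom_eval_power_int:
  assumes "keys \<mu> \<subseteq> {..<m}" "t \<noteq> (0 :: 'a::field)"
  shows "monom_eval (\<lambda>i. t powi k i) \<mu> = t powi weight m k \<mu>"
proof -
  have pw: "(t powi a) ^ n = t powi (int n * a)" for a n
    by (simp add: power_int_mult mult.commute flip: power_int_of_nat)
  have "(\<Prod>i\<in>S. t powi e i) = t powi (\<Sum>i\<in>S. e i)" for S and e :: "nat \<Rightarrow> int"
    using assms(2) by (induction S rule: infinite_finite_induct) (auto simp: power_int_add)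
  then show ?thesis
    using assms by (simp add: monom_eval_superset[of "{..<m}"] weight_def pw)
qed

text \<open>The point \<open>c\<close> is the weight zero part of \<open>a = g(A x)\<close>.
  Rescaling \<open>y = f(B x)\<close> by the diagonal matrices with entries
  \<open>inverse (s i) * t powi (- k i)\<close> stays in the orbit of \<open>f\<close>; since
  \<open>y\<close> has no positive weights, this curve extends to \<open>t = 0\<close> with value
  \<open>c\<close>, and closedness of the orbit puts \<open>c\<close> into it.\<close>

theorem exists_limit:
  fixes f g :: "(nat, 'a::alg_closed_field) mpol"
  assumes f: "f \<in> mpols m" and g: "g \<in> mpols m" and orb: "in_closed_orbit m g f"
  obtains A c and k :: "nat \<Rightarrow> int" where "A \<in> SL m" "c \<in> orbit m f" "(\<Sum>i<m. k i) = 0"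
    "\<And>i. i < m \<Longrightarrow> \<bar>k i\<bar> \<le> int m * (fact m * int (max 1 (mdeg g)) ^ m)"
    "\<And>\<mu>. lookup (lsub m id A g) \<mu> \<noteq> 0 \<Longrightarrow> 0 \<le> weight m k \<mu>"
    "\<And>\<mu>. lookup c \<mu> = (if weight m k \<mu> = 0 then lookup (lsub m id A g) \<mu> else 0)"
proof -
  obtain h where h: "h \<in> mpols m" "orbit m h \<subseteq> zariski_closure (orbit m g)"
    "zariski_closure (orbit m h) = orbit m h" "f \<in> orbit m h"
    using orb by (auto simp: in_closed_orbit_def)
  have fh: "orbit m f = orbit m h" by (rule orbit_eq_if_mem[OF h(1,4)])
  have "f \<in> zariski_closure (orbit m g)" using h by blast
  then obtain \<Gamma> and M :: "(nat, 'a) mpol fract mat" where \<Gamma>: "valuation_place (\<lambda>c. to_fract (Cst c)) \<Gamma>" and M: "M \<in> SL m"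
    and rel: "place_rel.prel \<Gamma> (lsub m (\<lambda>c. to_fract (Cst c)) M g) f"
    by (rule generic_place[OF g]) blast
  obtain A B s and k :: "nat \<Rightarrow> int" where A: "A \<in> SL m" and B: "B \<in> SL m"
    and s: "\<And>i. i < m \<Longrightarrow> s i \<noteq> 0" "(\<Prod>i<m. s i) = 1"
    and k: "(\<Sum>i<m. k i) = 0" "\<And>i. i < m \<Longrightarrow> \<bar>k i\<bar> \<le> int m * (fact m * int (max 1 (mdeg g)) ^ m)"
    and neg: "\<And>\<mu>. keys \<mu> \<subseteq> {..<m} \<Longrightarrow> weight m k \<mu> < 0 \<Longrightarrow> lookup (lsub m id A g) \<mu> = 0"
    and pos: "\<And>\<mu>. keys \<mu> \<subseteq> {..<m} \<Longrightarrow> weight m k \<mu> > 0 \<Longrightarrow> lookup (lsub m id B f) \<mu> = 0"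
    and zer: "\<And>\<mu>. keys \<mu> \<subseteq> {..<m} \<Longrightarrow> weight m k \<mu> = 0 \<Longrightarrow>
      lookup (lsub m id B f) \<mu> = monom_eval s \<mu> * lookup (lsub m id A g) \<mu>"
    using valuation_place.exists_weights[OF \<Gamma> M g f rel] unfolding weight_def by blast
  define a where "a = lsub m id A g"
  define y where "y = lsub m id B f"
  have am: "a \<in> mpols m" and ym: "y \<in> mpols m" using f g by (auto simp: a_def y_def mpols_lsub)
  have supp: "lookup p \<mu> = 0" if "p \<in> mpols m" "\<not> keys \<mu> \<subseteq> {..<m}" for p :: "(nat, 'a) mpol" and \<mu>
    using that by (auto simp: mpols_def in_keys_iff)
  define c where "c = (\<Sum>\<mu>\<in>{\<mu>\<in>keys a. weight m k \<mu> = 0}. Poly_Mapping.single \<mu> (lookup a \<mu>))"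
  have c: "lookup c \<mu> = (if weight m k \<mu> = 0 then lookup a \<mu> else 0)" for \<mu>
  proof -
    have "lookup c \<mu> = (\<Sum>\<nu>\<in>{\<nu>\<in>keys a. weight m k \<nu> = 0}. if \<nu> = \<mu> then lookup a \<mu> else 0)"
      unfolding c_def lookup_sum by (intro sum.cong refl) (auto simp: lookup_single when_def)
    then show ?thesis by (auto simp: in_keys_iff)
  qed
  have "c \<in> zariski_closure (orbit m f)"
  proof (rule in_zariski_closure_at_zero)
    \<comment> \<open>In positive weight the coefficient of \<open>y\<close> vanishes, so truncating
      the exponent to a natural number is harmless.\<close>
    define q where "q \<mu> = monom (monom_eval (\<lambda>i. inverse (s i)) \<mu> * lookup y \<mu>) (nat (- weight m k \<mu>))" for \<mu>
    show "\<exists>h\<in>orbit m f. \<forall>\<mu>. poly (q \<mu>) t = lookup h \<mu>" if t: "t \<noteq> 0" for t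
    proof -
      define r where "r i = inverse (s i) * t powi (- k i)" for i
      have pr: "(\<Prod>i<m. t powi e i) = t powi (\<Sum>i<m. e i)" for e :: "nat \<Rightarrow> int"
        using t by (induction m) (auto simp: power_int_add)
      have "(\<Prod>i<m. r i) = 1"
        using s(2) k(1) prod_inversef[of s "{..<m}"]
        by (simp add: r_def prod.distrib pr sum_negf o_def)
      moreover have "det (mat_diag m r) = (\<Prod>i<m. r i)"
        by (subst det_upper_triangular[of _ m]) (auto simp: mat_diag_def prod_list_diag_prod atLeast0LessThan)
      ultimately have D: "mat_diag m r \<in> SL m" by (simp add: SL_def)
      have "lsub m id (mat_diag m r) y = lsub m id (B * mat_diag m r) f"
        unfolding y_def by (rule lsub_id_lsub) (use B f in \<open>auto simp: SL_def\<close>)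
      then have "lsub m id (mat_diag m r) y \<in> orbit m f"
        unfolding orbit_eq_lsub using SL_mult[OF B D] by blast
      moreover have "poly (q \<mu>) t = lookup (lsub m id (mat_diag m r) y) \<mu>" for \<mu>
      proof (cases "lookup y \<mu> = 0")
        case True
        then show ?thesis by (simp add: q_def lookup_lsub_diag[OF ym comm_ring_hom_id])
      next
        case False
        then have \<mu>: "keys \<mu> \<subseteq> {..<m}" using supp[OF ym] by blast
        with False pos have "weight m k \<mu> \<le> 0" by (force simp: y_def)
        then have "t ^ nat (- weight m k \<mu>) = t powi weight m (\<lambda>i. - k i) \<mu>"
          by (simp add: power_int_def weight_def sum_negf)
        then show ?thesis
          unfolding lookup_lsub_diag[OF ym comm_ring_hom_id] r_def monom_eval_mult monom_eval_power_int[OF \<mu> t]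
          by (simp add: q_def poly_monom ac_simps)
      qed
      ultimately show ?thesis by blast
    qed
    show "poly (q \<mu>) 0 = lookup c \<mu>" for \<mu>
    proof (cases "keys \<mu> \<subseteq> {..<m}")
      case False
      then show ?thesis using supp[OF am] supp[OF ym] by (simp add: q_def c)
    next
      case \<mu>: True
      have "monom_eval (\<lambda>i. inverse (s i)) \<mu> * monom_eval s \<mu> = 1"
        unfolding monom_eval_mult[symmetric]
        using s(1) \<mu> by (simp add: monom_eval_def subset_iff)
      then have "weight m k \<mu> = 0 \<Longrightarrow> monom_eval (\<lambda>i. inverse (s i)) \<mu> * lookup y \<mu> = lookup a \<mu>"
        using zer[OF \<mu>] by (simp add: y_def a_def mult.assoc[symmetric])
      then show ?thesis
        using pos[OF \<mu>] by (cases "weight m k \<mu>" "0 :: int" rule: linorder_cases)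
          (auto simp: q_def c poly_monom y_def zero_power)
    qed
  qed
  then have "c \<in> orbit m f" using h(3) fh by simp
  moreover have "0 \<le> weight m k \<mu>" if "lookup a \<mu> \<noteq> 0" for \<mu>
    using that neg[of \<mu>] supp[OF am, of \<mu>] by (force simp: a_def)
  ultimately show ?thesis
    using that[OF A _ k] c unfolding a_def by blast
qed

section \<open>One-parameter subgroups\<close>

text \<open>Laurent polynomials without pole at 0, together with their value there. They form a
  \<open>place_rel\<close>, which makes the limit at \<open>t = 0\<close> another instance of
  specialization.\<close>

definition nonneg_laurent :: "('a::field laurent \<times> 'a) set" where
  "nonneg_laurent = {(p, c). (\<forall>k<0. lookup p k = 0) \<and> lookup p 0 = c}"

lemma place_rel_nonneg_laurent: "place_rel lconst (nonneg_laurent :: ('a::field laurent \<times> 'a) set)"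
proof (rule place_rel.intro[OF comm_ring_hom_lconst])
  show "(lconst c, c) \<in> nonneg_laurent" for c :: 'a
    by (simp add: nonneg_laurent_def lconst_def lookup_single)
  fix p q :: "'a laurent" and x y
  assume "(p, x) \<in> nonneg_laurent" "(q, y) \<in> nonneg_laurent"
  then have p: "\<And>k. k < 0 \<Longrightarrow> lookup p k = 0" "lookup p 0 = x"
    and q: "\<And>k. k < 0 \<Longrightarrow> lookup q k = 0" "lookup q 0 = y" by (auto simp: nonneg_laurent_def)
  show "(p + q, x + y) \<in> nonneg_laurent" using p q by (simp add: nonneg_laurent_def lookup_add)
  have kp: "0 \<le> k" if "k \<in> keys p" for k using p(1)[of k] that by (force simp: in_keys_iff)
  have kq: "0 \<le> k" if "k \<in> keys q" for k using q(1)[of k] that by (force simp: in_keys_iff)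
  have "lookup (p * q) k = 0" if "k < 0" for k
  proof (rule ccontr)
    assume "lookup (p * q) k \<noteq> 0"
    then have "k \<in> keys (p * q)" by (simp add: in_keys_iff)
    then obtain a b where "k = a + b" "a \<in> keys p" "b \<in> keys q" using keys_mult[of p q] by blast
    with kp[of a] kq[of b] that show False by simp
  qed
  moreover have "lookup (p * q) 0 = x * y"
  proof -
    \<comment> \<open>Without its value at 0, \<open>p\<close> has only positive exponents, so the
      product with \<open>q\<close> has no constant term.\<close>
    define p' where "p' = p - lconst x"
    have kp': "0 < k" if "k \<in> keys p'" for k
    proof -
      have "lookup p' k \<noteq> 0" using that by (simp add: in_keys_iff)
      then show ?thesis using p
        by (cases k "0 :: int" rule: linorder_cases)
          (auto simp: p'_def lookup_minus lconst_def lookup_single when_def)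
    qed
    have "lookup (p' * q) 0 = 0"
    proof (rule ccontr)
      assume "lookup (p' * q) 0 \<noteq> 0"
      then have "0 \<in> keys (p' * q)" by (simp add: in_keys_iff)
      then obtain a b where "0 = a + b" "a \<in> keys p'" "b \<in> keys q" using keys_mult[of p' q] by blast
      with kp'[of a] kq[of b] show False by simp
    qed
    moreover have "p * q = lconst x * q + p' * q" by (simp add: p'_def algebra_simps)
    moreover have "lookup (lconst x * q) 0 = x * y"
      unfolding q(2)[symmetric] lconst_def
      by (simp flip: mult_map_scale_conv_mult add: Poly_Mapping.map.rep_eq when_def)
    ultimately show ?thesis by (simp add: lookup_add)
  qed
  ultimately show "(p * q, x * y) \<in> nonneg_laurent" by (simp add: nonneg_laurent_def)
qed

interpretation lim: place_rel lconst nonneg_laurent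
  by (rule place_rel_nonneg_laurent)

lemma has_limit_iff_prel: "has_limit f F \<longleftrightarrow> lim.prel F f"
  unfolding has_limit_def lim.prel_def by (auto simp: nonneg_laurent_def)

lemma tpow_add: "tpow (a + b) = (tpow a * tpow b :: 'a::comm_ring_1 laurent)"
  by (simp add: tpow_def mult_single)

lemma tpow_zero: "tpow 0 = (1 :: 'a::comm_ring_1 laurent)"
  by (simp add: tpow_def)

lemma tpow_sum: "(\<Prod>i\<in>S. tpow (e i)) = (tpow (\<Sum>i\<in>S. e i) :: 'a::comm_ring_1 laurent)"
  by (induction S rule: infinite_finite_induct) (auto simp: tpow_add tpow_zero)

lemma tpow_power: "tpow a ^ n = (tpow (int n * a) :: 'a::comm_ring_1 laurent)"
  by (induction n) (auto simp: tpow_zero algebra_simps tpow_add)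

lemma monom_eval_tpow:
  assumes "keys \<mu> \<subseteq> {..<m}"
  shows "monom_eval (\<lambda>i. tpow (k i)) \<mu> = (tpow (weight m k \<mu>) :: 'a::comm_ring_1 laurent)"
  using assms by (simp add: monom_eval_superset[of "{..<m}"] weight_def tpow_power tpow_sum)

text \<open>In \<open>g(A t^k x)\<close> the coefficient at \<open>\<mu>\<close> acquires the factor
  \<open>tpow (weight m k \<mu>)\<close>, so only weight zero survives at \<open>t = 0\<close>. The
  factor \<open>N\<close> is constant and passes through the limit.\<close>

lemma has_limit_torus:
  fixes g :: "(nat, 'a::field) mpol"
  assumes A: "A \<in> carrier_mat m m" and N: "N \<in> carrier_mat m m" and g: "g \<in> mpols m"
    and nonneg: "\<And>\<mu>. lookup (lsub m id A g) \<mu> \<noteq> 0 \<Longrightarrow> 0 \<le> weight m k \<mu>"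
    and c: "\<And>\<mu>. lookup c \<mu> = (if weight m k \<mu> = 0 then lookup (lsub m id A g) \<mu> else 0)"
  shows "has_limit (lsub m id N c)
    (lsub m lconst (map_mat lconst A * mat_diag m (\<lambda>j. tpow (k j)) * map_mat lconst N) g)"
proof -
  let ?D = "mat_diag m (\<lambda>j. tpow (k j) :: 'a laurent)"
  define a where "a = lsub m id A g"
  have am: "a \<in> mpols m" using g by (simp add: a_def mpols_lsub)
  have cm: "c \<in> mpols m"
    using am by (auto simp: mpols_def in_keys_iff c a_def[symmetric] split: if_splits)
  have carA: "map_mat lconst A \<in> carrier_mat m m" and carN: "map_mat lconst N \<in> carrier_mat m m"
    and carD: "?D \<in> carrier_mat m m"
    using A N by simp_all
  have "lsub m lconst (map_mat lconst A * ?D * map_mat lconst N) g =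
      lsub m id (map_mat lconst N) (lsub m lconst (map_mat lconst A * ?D) g)"
    by (rule lsub_id_lsub[OF mult_carrier_mat[OF carA carD] carN g, symmetric])
  moreover have eq: "lsub m lconst (map_mat lconst A * ?D) g = lsub m lconst ?D a"
    unfolding a_def using lsub_lsub[OF comm_ring_hom_lconst A carD g, of id] by simp
  moreover have "lim.prel (lsub m lconst ?D a) c"
    unfolding lim.prel_def
  proof
    fix \<mu>
    have l: "lookup (lsub m lconst ?D a) \<mu> = monom_eval (\<lambda>j. tpow (k j)) \<mu> * lconst (lookup a \<mu>)"
      by (rule lookup_lsub_diag[OF am comm_ring_hom_lconst])
    show "(lookup (lsub m lconst ?D a) \<mu>, lookup c \<mu>) \<in> nonneg_laurent"
    proof (cases "lookup a \<mu> = 0")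
      case True
      then show ?thesis unfolding l c a_def[symmetric] by (simp add: nonneg_laurent_def lconst_def)
    next
      case False
      then have "keys \<mu> \<subseteq> {..<m}" using am by (auto simp: mpols_def in_keys_iff)
      then have "lookup (lsub m lconst ?D a) \<mu> = Poly_Mapping.single (weight m k \<mu>) (lookup a \<mu>)"
        unfolding l by (simp add: monom_eval_tpow) (simp add: tpow_def lconst_def mult_single)
      moreover have "0 \<le> weight m k \<mu>" using nonneg False by (simp add: a_def)
      ultimately show ?thesis
        by (auto simp: nonneg_laurent_def lookup_single when_def c a_def[symmetric])
    qed
  qed
  moreover have "lim.mrel m (map_mat lconst N) N"
    using N by (auto simp: lim.mrel_def lim.const)
  ultimately show ?thesis
    unfolding has_limit_iff_prel by (simp add: lim.prel_lsub_id cm mpols_lsub[OF am])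
qed

lemma lookup_to_laurent: "lookup (to_laurent f) \<mu> = lconst (lookup f \<mu>)"
  by (simp add: to_laurent_def Poly_Mapping.map.rep_eq when_def lconst_def)

lemma lsub_to_laurent: "lsub m id M (to_laurent g) = lsub m lconst M g"
proof -
  interpret C: comm_ring_hom "Cst :: 'a laurent \<Rightarrow> _" by (rule comm_ring_hom_Cst)
  have "keys (to_laurent g) \<subseteq> keys g"
    by (auto simp: in_keys_iff lookup_to_laurent lconst_def)
  then show ?thesis
    unfolding lsub_def
    by (subst (1 2) mp_subst_superset[of _ "keys g"]) (auto simp: lookup_to_laurent lconst_def)
qed

section \<open>Evaluation of Laurent polynomials\<close>

lemma leval_superset:
  "finite S \<Longrightarrow> keys p \<subseteq> S \<Longrightarrow> leval t p = (\<Sum>k\<in>S. lookup p k * t powi k)"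
  unfolding leval_def by (rule sum.mono_neutral_left) (auto simp: in_keys_iff)

lemma leval_add: "leval t (p + q) = leval t p + leval t q"
proof -
  let ?S = "keys p \<union> keys q"
  have "leval t (p + q) = (\<Sum>k\<in>?S. lookup (p + q) k * t powi k)"
    by (rule leval_superset) (auto dest: subsetD[OF keys_add])
  then show ?thesis
    by (simp add: lookup_add distrib_right sum.distrib leval_superset[of ?S])
qed

lemma leval_single: "leval t (Poly_Mapping.single k c) = c * t powi k"
  by (cases "c = 0") (auto simp: leval_def)

lemma leval_zero: "leval t 0 = 0"
  by (simp add: leval_def)

lemma leval_sum: "leval t (\<Sum>x\<in>S. F x) = (\<Sum>x\<in>S. leval t (F x))"
  by (induction S rule: infinite_finite_induct) (auto simp: leval_add leval_zero)

lemma comm_ring_hom_leval: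
  assumes "t \<noteq> 0"
  shows "comm_ring_hom (leval t)"
proof
  fix p q :: "'a laurent"
  have "p * q = (\<Sum>k\<in>keys p. \<Sum>l\<in>keys q. Poly_Mapping.single (k + l) (lookup p k * lookup q l))"
    by (subst (1) poly_mapping_expand[of "keys p" p], simp, simp,
        subst (1) poly_mapping_expand[of "keys q" q], simp, simp)
      (simp add: sum_product mult_single)
  then have "leval t (p * q) = (\<Sum>k\<in>keys p. \<Sum>l\<in>keys q. (lookup p k * t powi k) * (lookup q l * t powi l))"
    using assms by (simp add: leval_sum leval_single power_int_add ac_simps)
  then show "leval t (p * q) = leval t p * leval t q"
    by (simp add: sum_product leval_def)
next
  show "leval t 1 = 1" using leval_single[of t 0 1] by simp
qed (simp_all add: leval_add leval_zero)

section \<open>Conjugates of diagonal one-parameter subgroups\<close>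

definition torus :: "nat \<Rightarrow> 'a::field mat \<Rightarrow> (nat \<Rightarrow> int) \<Rightarrow> 'a laurent mat" where
  "torus m A k = map_mat lconst A * mat_diag m (\<lambda>j. tpow (k j)) * map_mat lconst (minv A)"

lemma mat_diag_mult: "mat_diag m a * mat_diag m b = mat_diag m (\<lambda>i. a i * b i)"
  for a b :: "nat \<Rightarrow> 'b::comm_ring_1"
  by (subst mat_diag_mult_left[of _ m m]) (auto simp: mat_diag_def intro!: eq_matI)

lemma conj_mult:
  fixes A B D E :: "'b::comm_ring_1 mat"
  assumes "A \<in> carrier_mat m m" "B \<in> carrier_mat m m" "D \<in> carrier_mat m m" "E \<in> carrier_mat m m"
    "B * A = 1\<^sub>m m"
  shows "(A * D * B) * (A * E * B) = A * (D * E) * B"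
proof -
  have "(A * D * B) * (A * E * B) = A * D * (B * (A * (E * B)))"
    using assms(1-4) by (simp add: assoc_mult_mat[of _ m m _ m _ m])
  also have "B * (A * (E * B)) = (B * A) * (E * B)"
    by (rule assoc_mult_mat[symmetric]) (use assms in auto)
  also have "\<dots> = E * B" unfolding assms(5) using assms by simp
  also have "A * D * (E * B) = A * (D * E) * B"
    using assms(1-4) by (simp add: assoc_mult_mat[of _ m m _ m _ m])
  finally show ?thesis .
qed

context
  fixes A :: "'a::field mat" and m :: nat
  assumes A: "A \<in> SL m"
begin

lemma A_carrier: "A \<in> carrier_mat m m" "minv A \<in> carrier_mat m m"
  using A SL_minv(1)[OF A] by (auto simp: SL_def)

lemma hom_conj:
  assumes "comm_ring_hom (h :: 'a \<Rightarrow> 'b::comm_ring_1)"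
  shows "map_mat h A \<in> carrier_mat m m" "map_mat h (minv A) \<in> carrier_mat m m"
    "map_mat h A * map_mat h (minv A) = 1\<^sub>m m" "map_mat h (minv A) * map_mat h A = 1\<^sub>m m"
    "det (map_mat h A) = 1" "det (map_mat h (minv A)) = 1"
proof -
  interpret comm_ring_hom h by fact
  show "map_mat h A \<in> carrier_mat m m" "map_mat h (minv A) \<in> carrier_mat m m"
    using A_carrier by auto
  show "map_mat h A * map_mat h (minv A) = 1\<^sub>m m" "map_mat h (minv A) * map_mat h A = 1\<^sub>m m"
    using mat_hom_mult[OF A_carrier] mat_hom_mult[OF A_carrier(2,1)] SL_minv(2,3)[OF A] mat_hom_one
    by metis+
  show "det (map_mat h A) = 1" "det (map_mat h (minv A)) = 1"
    using A SL_minv(1)[OF A] by (simp_all add: SL_def)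
qed

lemma torus_SL:
  assumes "(\<Sum>i<m. k i) = 0"
  shows "torus m A k \<in> SL m"
proof -
  note c = hom_conj[OF comm_ring_hom_lconst]
  have "det (mat_diag m (\<lambda>j. tpow (k j))) = (\<Prod>i<m. tpow (k i) :: 'a laurent)"
    by (subst det_upper_triangular[of _ m]) (auto simp: mat_diag_def prod_list_diag_prod atLeast0LessThan)
  then have "det (mat_diag m (\<lambda>j. tpow (k j) :: 'a laurent)) = 1"
    by (simp add: tpow_sum assms tpow_zero)
  then show ?thesis
    unfolding torus_def SL_def
    using c det_mult[OF mult_carrier_mat[OF c(1) mat_diag_dim] c(2)] det_mult[OF c(1) mat_diag_dim]
    by auto
qed

lemma minv_torus: "minv (torus m A k) = torus m A (\<lambda>i. - k i)"
proof -
  note c = hom_conj[OF comm_ring_hom_lconst]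
  have D: "mat_diag m (\<lambda>j. tpow (a j)) * mat_diag m (\<lambda>j. tpow (b j)) = (1\<^sub>m m :: 'a laurent mat)"
    if "\<And>j. a j + b j = 0" for a b
    unfolding mat_diag_mult tpow_add[symmetric] that tpow_zero by simp
  have *: "torus m A a * torus m A b = 1\<^sub>m m" if "\<And>j. a j + b j = 0" for a b
    unfolding torus_def conj_mult[OF c(1,2) mat_diag_dim mat_diag_dim c(4)] D[OF that]
    using c by simp
  show ?thesis
    by (rule minv_eq[of _ m]) (use c * in \<open>auto simp: torus_def\<close>)
qed

lemma map_mat_leval_torus:
  assumes "t \<noteq> 0"
  shows "map_mat (leval t) (torus m A k) = A * mat_diag m (\<lambda>j. t powi k j) * minv A"
proof -
  interpret comm_ring_hom "leval t" by (rule comm_ring_hom_leval) fact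
  note c = hom_conj[OF comm_ring_hom_lconst]
  have id: "map_mat (leval t) (map_mat lconst B) = B" for B :: "'a mat"
    by (rule eq_matI) (auto simp: lconst_def leval_single)
  have "map_mat (leval t) (mat_diag m (\<lambda>j. tpow (k j))) = mat_diag m (\<lambda>j. t powi k j)"
    by (rule eq_matI) (auto simp: mat_diag_def tpow_def leval_single)
  then show ?thesis
    unfolding torus_def
    by (simp add: mat_hom_mult[OF mult_carrier_mat[OF c(1) mat_diag_dim] c(2)]
        mat_hom_mult[OF c(1) mat_diag_dim] id)
qed

lemma one_param_subgroup_torus:
  assumes "(\<Sum>i<m. k i) = 0"
  shows "one_param_subgroup m (torus m A k)"
  unfolding one_param_subgroup_def
proof (intro conjI allI impI torus_SL assms)
  fix s t :: 'a assume "s \<noteq> 0" "t \<noteq> 0"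
  then show "map_mat (leval (s * t)) (torus m A k) =
      map_mat (leval s) (torus m A k) * map_mat (leval t) (torus m A k)"
    using A_carrier SL_minv(3)[OF A]
    by (simp add: map_mat_leval_torus conj_mult[of _ m] mat_diag_mult power_int_mult_distrib)
qed

end

section \<open>The exponential bound for the total degree\<close>

lemma less_two_power_blen: "n < 2 ^ blen n"
  using bitlen_bounds[of "int n"] by (cases "n = 0") (auto simp: blen_def nat_less_iff zless_nat_eq_int_zless)

text \<open>The left side is \<open>m\<close> times the bound for a single weight; the estimates are
  \<open>m \<le> 2 ^ m\<close>, \<open>fact m \<le> m ^ m\<close> and
  \<open>D < 2 ^ blen D\<close>.\<close>

lemma weight_bound:
  "m * (m * (fact m * max 1 D ^ m)) \<le> 2 ^ (2 * m + m ^ 2 + m * blen D)"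
proof -
  have m: "m \<le> 2 ^ m" by simp
  have "fact m \<le> m ^ m" using fact_le_power[of m, where 'a = nat] by simp
  also have "\<dots> \<le> (2 ^ m) ^ m" using m by (rule power_mono) simp
  finally have fm: "fact m \<le> (2 :: nat) ^ (m * m)" by (simp add: power_mult)
  have "max 1 D \<le> 2 ^ blen D" using less_two_power_blen[of D] by simp
  then have "max 1 D ^ m \<le> (2 ^ blen D) ^ m" by (rule power_mono) simp
  also have "(2 ^ blen D) ^ m = (2 :: nat) ^ (m * blen D)" by (simp add: mult.commute flip: power_mult)
  finally have "max 1 D ^ m \<le> 2 ^ (m * blen D)" .
  with fm m have "m * (m * (fact m * max 1 D ^ m)) \<le> 2 ^ m * (2 ^ m * (2 ^ (m * m) * 2 ^ (m * blen D)))"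
    by (intro mult_mono) auto
  also have "\<dots> = 2 ^ (2 * m + m ^ 2 + m * blen D)"
    by (simp add: power_add power2_eq_square mult_2)
  finally show ?thesis .
qed

text \<open>The exponent in \<open>weight_bound\<close>: the outer variable is the bit length, and
  the coefficients are polynomials in the number of variables.\<close>

definition weight_poly :: "nat poly poly" where
  "weight_poly = [:[:0, 2, 1:], [:0, 1:]:]"

lemma poly2_weight_poly: "poly2 weight_poly m b = 2 * m + m ^ 2 + m * b"
  by (simp add: poly2_def weight_poly_def algebra_simps power2_eq_square)

text \<open>The right factor \<open>B\<close> is left free because it is chosen in two ways: the
  inverse of \<open>A\<close> yields a one-parameter subgroup, the inverse of \<open>N\<close> makes
  the limit equal to \<open>f\<close>.\<close>

theorem exists_torus_limit:
  fixes f g :: "(nat, 'a::alg_closed_field) mpol"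
  assumes f: "f \<in> mpols m" and g: "g \<in> mpols m" and orb: "in_closed_orbit m g f"
  obtains A N and k :: "nat \<Rightarrow> int" where "A \<in> SL m" "N \<in> SL m" "(\<Sum>i<m. k i) = 0"
    "(\<Sum>i<m. \<bar>k i\<bar>) \<le> 2 ^ poly2 weight_poly m (blen (mdeg g))"
    "\<And>B. B \<in> SL m \<Longrightarrow> has_limit (lsub m id (N * B) f)
      (lsub m lconst (map_mat lconst A * mat_diag m (\<lambda>j. tpow (k j)) * map_mat lconst B) g)"
proof -
  obtain A c and k :: "nat \<Rightarrow> int" where A: "A \<in> SL m" and c: "c \<in> orbit m f" and k: "(\<Sum>i<m. k i) = 0"
    "\<And>i. i < m \<Longrightarrow> \<bar>k i\<bar> \<le> int m * (fact m * int (max 1 (mdeg g)) ^ m)"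
    and lim: "\<And>\<mu>. lookup (lsub m id A g) \<mu> \<noteq> 0 \<Longrightarrow> 0 \<le> weight m k \<mu>"
    "\<And>\<mu>. lookup c \<mu> = (if weight m k \<mu> = 0 then lookup (lsub m id A g) \<mu> else 0)"
    by (rule exists_limit[OF assms]) blast
  obtain N where N: "N \<in> SL m" "c = lsub m id N f" using c unfolding orbit_eq_lsub by blast
  have car: "B \<in> carrier_mat m m" if "B \<in> SL m" for B :: "'a mat" using that by (simp add: SL_def)
  have "has_limit (lsub m id (N * B) f)
      (lsub m lconst (map_mat lconst A * mat_diag m (\<lambda>j. tpow (k j)) * map_mat lconst B) g)"
    if "B \<in> SL m" for B
    using has_limit_torus[OF car[OF A] car[OF that] g lim]
    unfolding N(2) lsub_id_lsub[OF car[OF N(1)] car[OF that] f] .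
  moreover have "(\<Sum>i<m. \<bar>k i\<bar>) \<le> 2 ^ poly2 weight_poly m (blen (mdeg g))"
  proof -
    have "(\<Sum>i<m. \<bar>k i\<bar>) \<le> (\<Sum>i<m. int m * (fact m * int (max 1 (mdeg g)) ^ m))"
      by (rule sum_mono) (use k(2) in auto)
    also have "\<dots> = int (m * (m * (fact m * max 1 (mdeg g) ^ m)))" by simp
    also have "\<dots> \<le> int (2 ^ poly2 weight_poly m (blen (mdeg g)))"
      unfolding poly2_weight_poly by (rule of_nat_mono[OF weight_bound])
    finally show ?thesis by simp
  qed
  ultimately show ?thesis using that[OF A N(1) k(1)] by blast
qed

theorem one_param_degeneration:
  fixes f g :: "(nat, 'a::alg_closed_field) mpol"
  assumes f: "f \<in> mpols m" and g: "g \<in> mpols m" and orb: "in_closed_orbit m g f"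
  shows "\<exists>\<Lambda> d. one_param_subgroup m \<Lambda> \<and>
    (\<exists>\<sigma>\<in>SL m. has_limit (act m \<sigma> f) (act m \<Lambda> (to_laurent g))) \<and>
    has_total_degree m \<Lambda> d \<and> d \<le> 2 ^ poly2 weight_poly m (blen (mdeg g))"
proof -
  obtain A N and k :: "nat \<Rightarrow> int" where A: "A \<in> SL m" and N: "N \<in> SL m" and k: "(\<Sum>i<m. k i) = 0"
    "(\<Sum>i<m. \<bar>k i\<bar>) \<le> 2 ^ poly2 weight_poly m (blen (mdeg g))"
    and lim: "\<And>B. B \<in> SL m \<Longrightarrow> has_limit (lsub m id (N * B) f)
      (lsub m lconst (map_mat lconst A * mat_diag m (\<lambda>j. tpow (k j)) * map_mat lconst B) g)"
    by (rule exists_torus_limit[OF assms]) blast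
  \<comment> \<open>The action substitutes the inverse matrix, so the weights change sign; the total
    degree is unaffected.\<close>
  define \<Lambda> where "\<Lambda> = torus m A (\<lambda>i. - k i)"
  define d where "d = nat (\<Sum>i<m. \<bar>k i\<bar>)"
  have d: "int d = (\<Sum>i<m. \<bar>k i\<bar>)" by (simp add: d_def sum_nonneg)
  have NA: "N * minv A \<in> SL m" by (rule SL_mult[OF N SL_minv(1)[OF A]])
  have "minv \<Lambda> = torus m A k" by (simp add: \<Lambda>_def minv_torus[OF A])
  then have "has_limit (act m (minv (N * minv A)) f) (act m \<Lambda> (to_laurent g))"
    using lim[OF SL_minv(1)[OF A]]
    by (simp add: act_eq_lsub lsub_to_laurent torus_def SL_minv(4)[OF NA])
  moreover have "one_param_subgroup m \<Lambda>"
    unfolding \<Lambda>_def by (rule one_param_subgroup_torus[OF A]) (simp add: sum_negf k)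
  moreover have "has_total_degree m \<Lambda> d"
    unfolding has_total_degree_def
    by (intro bexI[OF _ A] exI[of _ "\<lambda>i. - k i"]) (simp add: \<Lambda>_def torus_def d)
  moreover have "d \<le> 2 ^ poly2 weight_poly m (blen (mdeg g))"
    using k(2) unfolding d[symmetric] by (metis of_nat_le_iff of_nat_numeral of_nat_power)
  ultimately show ?thesis using SL_minv(1)[OF NA] by blast
qed

section \<open>Circuits\<close>

text \<open>Trees allow structural induction. They are laid out in postorder, so a subtree of size
  \<open>s\<close> placed at position \<open>p\<close> has its result at position
  \<open>p + s - 1\<close>.\<close>

datatype 'a expr = EInput nat | EConst 'a | EPlus "'a expr" "'a expr" | ETimes "'a expr" "'a expr"

fun expr_val :: "(nat \<Rightarrow> 'a::comm_semiring_1) \<Rightarrow> 'a expr \<Rightarrow> 'a" where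
  "expr_val \<rho> (EInput v) = \<rho> v"
| "expr_val \<rho> (EConst c) = c"
| "expr_val \<rho> (EPlus a b) = expr_val \<rho> a + expr_val \<rho> b"
| "expr_val \<rho> (ETimes a b) = expr_val \<rho> a * expr_val \<rho> b"

fun expr_size :: "'a expr \<Rightarrow> nat" where
  "expr_size (EInput v) = 1"
| "expr_size (EConst c) = 1"
| "expr_size (EPlus a b) = expr_size a + expr_size b + 1"
| "expr_size (ETimes a b) = expr_size a + expr_size b + 1"

fun expr_inputs :: "'a expr \<Rightarrow> nat set" where
  "expr_inputs (EInput v) = {v}"
| "expr_inputs (EConst c) = {}"
| "expr_inputs (EPlus a b) = expr_inputs a \<union> expr_inputs b"
| "expr_inputs (ETimes a b) = expr_inputs a \<union> expr_inputs b"

text \<open>\<open>p\<close> is the position at which the first gate is placed.\<close>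

fun gates :: "nat \<Rightarrow> 'a expr \<Rightarrow> 'a gate list" where
  "gates p (EInput v) = [Input v]"
| "gates p (EConst c) = [Constant c]"
| "gates p (EPlus a b) = gates p a @ gates (p + expr_size a) b @
     [Plus (p + expr_size a - 1) (p + expr_size a + expr_size b - 1)]"
| "gates p (ETimes a b) = gates p a @ gates (p + expr_size a) b @
     [Times (p + expr_size a - 1) (p + expr_size a + expr_size b - 1)]"

lemma expr_size_pos: "expr_size e > 0"
  by (induction e) auto

lemma length_gates: "length (gates p e) = expr_size e"
  by (induction e arbitrary: p) auto

definition run :: "(nat \<Rightarrow> 'a::comm_semiring_1) \<Rightarrow> 'a list \<Rightarrow> 'a circuit \<Rightarrow> 'a list" where
  "run \<rho> = foldl (\<lambda>vs G. vs @ [gate_val id \<rho> vs G])"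

lemma run_append: "run \<rho> vs (C @ D) = run \<rho> (run \<rho> vs C) D"
  by (simp add: run_def)

text \<open>The list \<open>vs\<close> of earlier values is arbitrary because the gates of a right
  subtree follow those of the left one and refer to absolute positions.\<close>

lemma run_gates:
  "\<exists>ws. run \<rho> vs (gates (length vs) e) = vs @ ws \<and> length ws = expr_size e \<and> last ws = expr_val \<rho> e"
proof (induction e arbitrary: vs)
  case (EPlus a b)
  obtain u where u: "run \<rho> vs (gates (length vs) a) = vs @ u" "length u = expr_size a" "last u = expr_val \<rho> a"
    using EPlus.IH(1) by blast
  obtain w where w: "run \<rho> (vs @ u) (gates (length (vs @ u)) b) = (vs @ u) @ w" "length w = expr_size b"
    "last w = expr_val \<rho> b"
    using EPlus.IH(2) by blast
  have "u \<noteq> []" "w \<noteq> []" using u(2) w(2) expr_size_pos[of a] expr_size_pos[of b] by auto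
  then have "(vs @ u @ w) ! (length vs + expr_size a - 1) = expr_val \<rho> a"
    "(vs @ u @ w) ! (length vs + expr_size a + expr_size b - 1) = expr_val \<rho> b"
    using u(2,3) w(2,3) expr_size_pos[of a] expr_size_pos[of b]
    by (auto simp: nth_append last_conv_nth)
  then have "run \<rho> vs (gates (length vs) (EPlus a b)) = vs @ (u @ w @ [expr_val \<rho> (EPlus a b)])"
    using u w by (simp add: run_append) (simp add: run_def)
  then show ?case using u(2) w(2) by (intro exI[of _ "u @ w @ [expr_val \<rho> (EPlus a b)]"]) simp
next
  case (ETimes a b)
  obtain u where u: "run \<rho> vs (gates (length vs) a) = vs @ u" "length u = expr_size a" "last u = expr_val \<rho> a"
    using ETimes.IH(1) by blast
  obtain w where w: "run \<rho> (vs @ u) (gates (length (vs @ u)) b) = (vs @ u) @ w" "length w = expr_size b"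
    "last w = expr_val \<rho> b"
    using ETimes.IH(2) by blast
  have "u \<noteq> []" "w \<noteq> []" using u(2) w(2) expr_size_pos[of a] expr_size_pos[of b] by auto
  then have "(vs @ u @ w) ! (length vs + expr_size a - 1) = expr_val \<rho> a"
    "(vs @ u @ w) ! (length vs + expr_size a + expr_size b - 1) = expr_val \<rho> b"
    using u(2,3) w(2,3) expr_size_pos[of a] expr_size_pos[of b]
    by (auto simp: nth_append last_conv_nth)
  then have "run \<rho> vs (gates (length vs) (ETimes a b)) = vs @ (u @ w @ [expr_val \<rho> (ETimes a b)])"
    using u w by (simp add: run_append) (simp add: run_def)
  then show ?case using u(2) w(2) by (intro exI[of _ "u @ w @ [expr_val \<rho> (ETimes a b)]"]) simp
qed (simp_all add: run_def)

lemma circuit_val_gates: "circuit_val id \<rho> (gates 0 e) = expr_val \<rho> e"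
proof -
  obtain ws where "run \<rho> [] (gates 0 e) = ws" "last ws = expr_val \<rho> e"
    using run_gates[of \<rho> "[]" e] by auto
  then show ?thesis by (simp add: circuit_val_def run_def)
qed

definition gate_ok :: "nat \<Rightarrow> nat \<Rightarrow> 'a gate \<Rightarrow> bool" where
  "gate_ok N p G = (case G of Input v \<Rightarrow> v < N | Constant c \<Rightarrow> True
     | Plus a b \<Rightarrow> a < p \<and> b < p | Times a b \<Rightarrow> a < p \<and> b < p)"

lemma gates_ok:
  "expr_inputs e \<subseteq> {..<N} \<Longrightarrow> q < expr_size e \<Longrightarrow> gate_ok N (p + q) (gates p e ! q)"
proof (induction e arbitrary: p q)
  case (EPlus a b)
  consider "q < expr_size a" | "expr_size a \<le> q" "q < expr_size a + expr_size b" | "q = expr_size a + expr_size b"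
    using EPlus.prems by fastforce
  then show ?case
  proof cases
    case 2
    then have "q - expr_size a < expr_size b" by linarith
    with 2 show ?thesis
      using EPlus.IH(2)[of "q - expr_size a" "p + expr_size a"] EPlus.prems by (simp add: nth_append length_gates)
  qed (use EPlus expr_size_pos[of a] expr_size_pos[of b] in \<open>auto simp: nth_append length_gates gate_ok_def\<close>)
next
  case (ETimes a b)
  consider "q < expr_size a" | "expr_size a \<le> q" "q < expr_size a + expr_size b" | "q = expr_size a + expr_size b"
    using ETimes.prems by fastforce
  then show ?case
  proof cases
    case 2
    then have "q - expr_size a < expr_size b" by linarith
    with 2 show ?thesis
      using ETimes.IH(2)[of "q - expr_size a" "p + expr_size a"] ETimes.prems by (simp add: nth_append length_gates)
  qed (use ETimes expr_size_pos[of a] expr_size_pos[of b] in \<open>auto simp: nth_append length_gates gate_ok_def\<close>)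
qed (auto simp: gate_ok_def)

lemma wf_circuit_gates: "expr_inputs e \<subseteq> {..<N} \<Longrightarrow> wf_circuit N (gates 0 e)"
  using gates_ok[of e N _ 0] length_gates[of 0 e] expr_size_pos[of e]
  by (auto simp: wf_circuit_def gate_ok_def)

section \<open>Circuits for lookup tables\<close>

definition lit_expr :: "bool \<Rightarrow> nat \<Rightarrow> 'a::comm_ring_1 expr" where
  "lit_expr b v = (if b then EInput v else EPlus (EConst 1) (ETimes (EConst (- 1)) (EInput v)))"

text \<open>On 0-1 inputs each literal is \<open>x\<close> or \<open>1 - x\<close>, so the product
  is the indicator of a single bit string.\<close>

fun match_expr :: "nat \<Rightarrow> bool list \<Rightarrow> 'a::comm_ring_1 expr" where
  "match_expr v [] = EConst 1"
| "match_expr v (b # bs) = ETimes (lit_expr b v) (match_expr (Suc v) bs)"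

lemma match_expr_val:
  "length ys = length bs \<Longrightarrow>
    expr_val (\<lambda>v. of_bool ((xs @ ys) ! v)) (match_expr (length xs) bs) = of_bool (ys = bs)"
proof (induction bs arbitrary: xs ys)
  case (Cons b bs)
  then obtain y ys' where ys: "ys = y # ys'" "length ys' = length bs" by (cases ys) auto
  show ?case
    using Cons.IH[OF ys(2), of "xs @ [y]"] by (auto simp: ys lit_expr_def nth_append)
qed simp

text \<open>A negated literal has five gates, and one more multiplies it to the rest; the empty
  product takes one.\<close>

lemma match_expr_size: "expr_size (match_expr v bs) \<le> 6 * length bs + 1"
proof (induction bs arbitrary: v)
  case (Cons b bs)
  from Cons[of "Suc v"] show ?case by (simp add: lit_expr_def)
qed simp

lemma match_expr_inputs: "expr_inputs (match_expr v bs) \<subseteq> {..<v + length bs}"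
proof (induction bs arbitrary: v)
  case (Cons b bs)
  from Cons[of "Suc v"] show ?case by (auto simp: lit_expr_def)
qed simp

text \<open>Rows with equal keys add up, as they must when several weights \<open>k r\<close>
  coincide and contribute to the same power of \<open>t\<close>.\<close>

fun table_expr :: "('a \<times> bool list) list \<Rightarrow> 'a::comm_ring_1 expr" where
  "table_expr [] = EConst 0"
| "table_expr ((c, bs) # T) = EPlus (ETimes (EConst c) (match_expr 0 bs)) (table_expr T)"

lemma table_expr_val:
  fixes T :: "('a::comm_ring_1 \<times> bool list) list"
  shows "(\<And>c bs. (c, bs) \<in> set T \<Longrightarrow> length bs = length xs) \<Longrightarrow>
    expr_val (\<lambda>v. of_bool (xs ! v)) (table_expr T) = (\<Sum>(c, bs)\<leftarrow>T. c * of_bool (xs = bs))"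
proof (induction T)
  case (Cons r T)
  obtain c bs where r: "r = (c, bs)" by (cases r)
  have "length xs = length bs" using Cons.prems[of c bs] r by simp
  note match = match_expr_val[OF this, of "[]", where 'a = 'a, simplified]
  have "expr_val (\<lambda>v. of_bool (xs ! v)) (table_expr T) = (\<Sum>(c, bs)\<leftarrow>T. c * of_bool (xs = bs))"
    by (rule Cons.IH) (use Cons.prems in auto)
  with match show ?case by (simp add: r)
qed simp

lemma table_expr_size:
  fixes T :: "('a::comm_ring_1 \<times> bool list) list"
  shows "(\<And>c bs. (c, bs) \<in> set T \<Longrightarrow> length bs = N) \<Longrightarrow>
    expr_size (table_expr T) \<le> length T * (6 * N + 4) + 1"
proof (induction T)
  case (Cons r T)
  obtain c bs where r: "r = (c, bs)" by (cases r)
  have "length bs = N" using Cons.prems[of c bs] r by simp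
  moreover have "expr_size (table_expr T) \<le> length T * (6 * N + 4) + 1"
    by (rule Cons.IH) (use Cons.prems in auto)
  ultimately show ?case using match_expr_size[of 0 bs, where 'a = 'a] by (simp add: r)
qed simp

lemma table_expr_inputs:
  "(\<And>c bs. (c, bs) \<in> set T \<Longrightarrow> length bs = N) \<Longrightarrow> expr_inputs (table_expr T) \<subseteq> {..<N}"
proof (induction T)
  case (Cons r T)
  obtain c bs where r: "r = (c, bs)" by (cases r)
  have "length bs = N" using Cons.prems[of c bs] r by simp
  with match_expr_inputs[of 0 bs] Cons show ?case by (auto simp: r)
qed simp

section \<open>Injectivity of the binary encoding\<close>

lemma bits_inj:
  assumes "x < 2 ^ w" "y < 2 ^ w" "bits w x = bits w y"
  shows "x = y"
proof (rule bit_eqI)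
  fix n
  show "bit x n = bit y n"
  proof (cases "n < w")
    case True
    with assms(3) show ?thesis by (simp add: bits_def)
  next
    case False
    with assms(1,2) have "x < 2 ^ n" "y < 2 ^ n"
      by (meson leI less_le_trans one_le_numeral power_increasing)+
    then show ?thesis by (simp add: bit_iff_odd)
  qed
qed

lemma less_two_power_blen_if_le: "x \<le> l \<Longrightarrow> x < 2 ^ blen l"
  using less_two_power_blen[of l] by simp

text \<open>Fixed block widths make the concatenation split uniquely, and the ranges ensure that
  each number fits into its block.\<close>

lemma encode_inj:
  assumes "i \<le> l" "i' \<le> l" "j \<le> m" "j' \<le> m" "\<bar>k\<bar> \<le> int K" "\<bar>k'\<bar> \<le> int K"
    "encode l m K i j k = encode l m K i' j' k'"
  shows "i = i' \<and> j = j' \<and> k = k'"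
proof -
  have len: "length (bits w x) = w" for w x by (simp add: bits_def)
  have eqs: "bits (blen l) i = bits (blen l) i'" "bits (blen m) j = bits (blen m) j'"
    "(k < 0) = (k' < 0)" "bits (blen K) (nat \<bar>k\<bar>) = bits (blen K) (nat \<bar>k'\<bar>)"
    using assms(7) by (simp_all add: encode_def len)
  have "nat \<bar>k\<bar> \<le> K" "nat \<bar>k'\<bar> \<le> K" using assms by auto
  from bits_inj[OF less_two_power_blen_if_le[OF this(1)] less_two_power_blen_if_le[OF this(2)] eqs(4)]
  have "\<bar>k\<bar> = \<bar>k'\<bar>" by simp
  with eqs(3) have "k = k'" by auto
  with bits_inj[OF less_two_power_blen_if_le[OF assms(1)] less_two_power_blen_if_le[OF assms(2)] eqs(1)]
    bits_inj[OF less_two_power_blen_if_le[OF assms(3)] less_two_power_blen_if_le[OF assms(4)] eqs(2)]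
  show ?thesis by simp
qed

lemma length_encode: "length (encode l m K i j k) = blen l + blen m + 1 + blen K"
  by (simp add: encode_def bits_def)

text \<open>Each triple \<open>(i, j, r)\<close> contributes one term
  \<open>A $$ (i, r) * B $$ (r, j) * tpow (k r)\<close> to the entries of the substitution matrix.
  Indices are shifted by one because the circuit counts from 1 and reserves \<open>j = 0\<close> for
  the constant term.\<close>

definition torus_table :: "nat \<Rightarrow> nat \<Rightarrow> 'a::comm_ring_1 mat \<Rightarrow> 'a mat \<Rightarrow> (nat \<Rightarrow> int) \<Rightarrow> ('a \<times> bool list) list" where
  "torus_table m K A B k = [(A $$ (i, r) * B $$ (r, j), encode m m K (i + 1) (j + 1) (k r)).
     i \<leftarrow> [0..<m], j \<leftarrow> [0..<m], r \<leftarrow> [0..<m]]"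

lemma length_torus_table: "length (torus_table m K A B k) = m ^ 3"
  by (simp add: torus_table_def length_concat comp_def sum_list_triv power3_eq_cube)

lemma torus_table_length: "(c, bs) \<in> set (torus_table m K A B k) \<Longrightarrow> length bs = blen m + blen m + 1 + blen K"
  by (auto simp: torus_table_def length_encode)

lemma sum_list_concat_map: "sum_list (concat (map f xs)) = (\<Sum>x\<leftarrow>xs. sum_list (f x))"
  by (induction xs) auto

text \<open>By injectivity of the encoding an input selects exactly the rows with its indices whose
  weight is \<open>x\<close>. No row has second index 0, so the constant terms vanish.\<close>

lemma torus_coeff:
  fixes A B :: "'a::field mat"
  assumes K: "\<And>r. r < m \<Longrightarrow> \<bar>k r\<bar> \<le> int K" and i: "i < m" and j: "j \<le> m" and x: "\<bar>x\<bar> \<le> int K"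
  shows "circuit_coeff m m K (gates 0 (table_expr (torus_table m K A B k))) (i + 1) j x =
    (\<Sum>r<m. if j \<noteq> 0 \<and> x = k r then A $$ (i, r) * B $$ (r, j - 1) else 0)"
proof -
  have enc: "encode m m K (i + 1) j x = encode m m K (i' + 1) (j' + 1) (k r) \<longleftrightarrow> i' = i \<and> j = j' + 1 \<and> x = k r"
    if "i' < m" "j' < m" "r < m" for i' j' r
    using encode_inj[of "i + 1" m "i' + 1" j m "j' + 1" x K "k r"] that i j x K[of r] by auto
  have "circuit_coeff m m K (gates 0 (table_expr (torus_table m K A B k))) (i + 1) j x =
      (\<Sum>(c, bs)\<leftarrow>torus_table m K A B k. c * of_bool (encode m m K (i + 1) j x = bs))"
    unfolding circuit_coeff_def circuit_val_gates
    by (rule table_expr_val) (auto simp: length_encode dest: torus_table_length)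
  also have "\<dots> = (\<Sum>i'<m. \<Sum>j'<m. \<Sum>r<m. A $$ (i', r) * B $$ (r, j') *
      of_bool (encode m m K (i + 1) j x = encode m m K (i' + 1) (j' + 1) (k r)))"
    by (simp add: torus_table_def map_concat sum_list_concat_map comp_def
        interv_sum_list_conv_sum_set_nat atLeast0LessThan)
  also have "\<dots> = (\<Sum>i'<m. \<Sum>j'<m. \<Sum>r<m. if i' = i \<and> j = j' + 1 \<and> x = k r then A $$ (i, r) * B $$ (r, j') else 0)"
    by (intro sum.cong refl) (simp add: enc[simplified] of_bool_def)
  also have "\<dots> = (\<Sum>i'<m. if i' = i then (\<Sum>j'<m. \<Sum>r<m. if j = j' + 1 \<and> x = k r then A $$ (i, r) * B $$ (r, j') else 0) else 0)"
    by (intro sum.cong refl) simp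
  also have "\<dots> = (\<Sum>j'<m. \<Sum>r<m. if j = j' + 1 \<and> x = k r then A $$ (i, r) * B $$ (r, j') else 0)"
    using i by simp
  also have "\<dots> = (\<Sum>r<m. if j \<noteq> 0 \<and> x = k r then A $$ (i, r) * B $$ (r, j - 1) else 0)"
  proof (cases j)
    case (Suc j0)
    then have "(\<Sum>j'<m. \<Sum>r<m. if j = j' + 1 \<and> x = k r then A $$ (i, r) * B $$ (r, j') else 0) =
      (\<Sum>j'<m. if j' = j0 then (\<Sum>r<m. if x = k r then A $$ (i, r) * B $$ (r, j0) else 0) else 0)"
      by (intro sum.cong refl) auto
    with j show ?thesis unfolding Suc diff_Suc_1 by (simp cong: if_cong)
  qed simp
  finally show ?thesis .
qed

lemma circuit_subst_torus:
  fixes A B :: "'a::field mat"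
  assumes A: "A \<in> carrier_mat m m" and B: "B \<in> carrier_mat m m" and g: "g \<in> mpols m"
    and K: "\<And>r. r < m \<Longrightarrow> \<bar>k r\<bar> \<le> int K"
  defines "C \<equiv> gates 0 (table_expr (torus_table m K A B k))"
  shows "circuit_subst m m K C g =
    lsub m lconst (map_mat lconst A * mat_diag m (\<lambda>j. tpow (k j)) * map_mat lconst B) g"
proof -
  define M where "M = map_mat lconst A * mat_diag m (\<lambda>j. tpow (k j)) * map_mat lconst B"
  interpret l: comm_ring_hom "lconst :: 'a \<Rightarrow> 'a laurent" by (rule comm_ring_hom_lconst)
  interpret Cs: comm_ring_hom "Cst :: 'a laurent \<Rightarrow> (nat, 'a laurent) mpol" by (rule comm_ring_hom_Cst)
  have M: "M $$ (i, j) = (\<Sum>r<m. lconst (A $$ (i, r) * B $$ (r, j)) * tpow (k r))" if "i < m" "j < m" for i j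
  proof -
    have "map_mat lconst A * mat_diag m (\<lambda>j. tpow (k j)) = mat m m (\<lambda>(i, j). lconst (A $$ (i, j)) * tpow (k j))"
      by (subst mat_diag_mult_right[of _ m]) (use A in \<open>auto intro!: eq_matI\<close>)
    then have "M $$ (i, j) = (\<Sum>r<m. mat m m (\<lambda>(i, j). lconst (A $$ (i, j)) * tpow (k j)) $$ (i, r) *
        map_mat lconst B $$ (r, j))"
      unfolding M_def using that B by (simp only:) (rule index_mult_mat_sum[of _ m m _ m], auto)
    also have "\<dots> = (\<Sum>r<m. lconst (A $$ (i, r) * B $$ (r, j)) * tpow (k r))"
      using that B by (intro sum.cong refl) (simp add: l.hom_mult ac_simps)
    finally show ?thesis .
  qed
  have a: "(\<Sum>x = - int K..int K. lconst (circuit_coeff m m K C (i + 1) j x) * tpow x) =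
      (if j = 0 then 0 else M $$ (i, j - 1))" if "i < m" "j \<le> m" for i j
  proof -
    have "(\<Sum>x = - int K..int K. lconst (circuit_coeff m m K C (i + 1) j x) * tpow x) =
      (\<Sum>x = - int K..int K. \<Sum>r<m. if x = k r then (if j = 0 then 0 else lconst (A $$ (i, r) * B $$ (r, j - 1)) * tpow (k r)) else 0)"
    proof (intro sum.cong refl)
      fix x assume "x \<in> {- int K..int K}"
      then have "\<bar>x\<bar> \<le> int K" by auto
      from torus_coeff[OF K that this, where A = A and B = B]
      have "lconst (circuit_coeff m m K C (i + 1) j x) * tpow x =
          (\<Sum>r<m. lconst (if j \<noteq> 0 \<and> x = k r then A $$ (i, r) * B $$ (r, j - 1) else 0) * tpow x)"
        unfolding C_def by (simp only: l.hom_sum sum_distrib_right)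
      also have "\<dots> = (\<Sum>r<m. if x = k r then
          (if j = 0 then 0 else lconst (A $$ (i, r) * B $$ (r, j - 1)) * tpow (k r)) else 0)"
        by (intro sum.cong refl) auto
      finally show "lconst (circuit_coeff m m K C (i + 1) j x) * tpow x = (\<Sum>r<m. if x = k r then
          (if j = 0 then 0 else lconst (A $$ (i, r) * B $$ (r, j - 1)) * tpow (k r)) else 0)" .
    qed
    \<comment> \<open>After exchanging the sums, each \<open>r\<close> contributes at the single
      exponent \<open>k r\<close>, which the bound \<open>K\<close> places in the range of
      summation.\<close>
    also have "\<dots> = (\<Sum>r<m. if j = 0 then 0 else lconst (A $$ (i, r) * B $$ (r, j - 1)) * tpow (k r))"
    proof (subst sum.swap, intro sum.cong refl)
      fix r assume "r \<in> {..<m}"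
      then have "k r \<in> {- int K..int K}" using K[of r] by auto
      then show "(\<Sum>x = - int K..int K. if x = k r then
          (if j = 0 then 0 else lconst (A $$ (i, r) * B $$ (r, j - 1)) * tpow (k r)) else 0) =
          (if j = 0 then 0 else lconst (A $$ (i, r) * B $$ (r, j - 1)) * tpow (k r))"
        by simp
    qed
    also have "\<dots> = (if j = 0 then 0 else M $$ (i, j - 1))"
      using that by (auto simp: M)
    finally show ?thesis .
  qed
  have "circuit_subst m m K C g = lsub m lconst M g"
    unfolding circuit_subst_def Let_def lsub_def
  proof (rule mp_subst_cong)
    fix \<mu> v assume "\<mu> \<in> keys g" "v \<in> keys \<mu>"
    then have v: "v < m" using g by (rule mpolsD[rotated])
    have "(\<Sum>j = 1..m. Cst (\<Sum>x = - int K..int K. lconst (circuit_coeff m m K C (v + 1) j x) * tpow x) * Var (j - 1)) =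
        (\<Sum>j = 1..m. Cst (M $$ (v, j - 1)) * Var (j - 1))"
      by (intro sum.cong refl) (subst a[OF v], auto)
    also have "\<dots> = (\<Sum>j<m. Cst (M $$ (v, j)) * Var j)"
      by (rule sum.reindex_bij_witness[of _ Suc "\<lambda>j. j - 1"]) auto
    finally show "Cst (\<Sum>x = - int K..int K. lconst (circuit_coeff m m K C (v + 1) 0 x) * tpow x) +
        (\<Sum>j = 1..m. Cst (\<Sum>x = - int K..int K. lconst (circuit_coeff m m K C (v + 1) j x) * tpow x) * Var (j - 1)) =
        lin m M v"
      by (simp add: a[OF v, of 0, simplified] lin_def)
  qed simp
  then show ?thesis by (simp add: M_def)
qed

section \<open>Bit lengths and polynomial size\<close>

lemma two_power_blen_le:
  assumes "x > 0"
  shows "2 ^ (blen x - 1) \<le> x"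
proof -
  have "nat (bitlen (int x) - 1) = blen x - 1" unfolding blen_def by arith
  then have "(2 :: int) ^ (blen x - 1) \<le> int x"
    using bitlen_bounds[of "int x"] assms by simp
  then have "int (2 ^ (blen x - 1)) \<le> int x" by simp
  then show ?thesis by (rule of_nat_le_iff[THEN iffD1])
qed

text \<open>This crude estimate is good enough because degree and number of variables are
  polynomially bounded in \<open>VP\<close>.\<close>

lemma blen_le: "blen x \<le> x"
proof (cases "x = 0")
  case False
  then have "2 ^ (blen x - 1) \<le> x" by (intro two_power_blen_le) simp
  moreover have "blen x - 1 < 2 ^ (blen x - 1)" by (rule less_exp)
  ultimately show ?thesis by linarith
qed (simp add: blen_def)

text \<open>The range \<open>K\<close> of exponents is exponential, but its block in the encoding
  has width linear in the exponent, so the circuit has polynomially many inputs.\<close>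

lemma blen_two_power: "blen (2 ^ e) \<le> e + 1"
proof -
  have "(2 :: nat) ^ (blen (2 ^ e) - 1) \<le> 2 ^ e" by (rule two_power_blen_le) simp
  then have "blen (2 ^ e) - 1 \<le> e" by (rule power_le_imp_le_exp[rotated]) simp
  then show ?thesis by linarith
qed

text \<open>With the inverse of \<open>N\<close> as right factor, the group element separating the
  limit from \<open>f\<close> cancels. The substitution is then given by a table of
  \<open>m n ^ 3\<close> rows.\<close>

theorem p_definable_if_stable:
  fixes f g :: "nat \<Rightarrow> (nat, 'a::alg_closed_field) mpol"
  assumes VP: "VP m g" and st: "stable_degeneration m f g"
  shows "p_definable_degeneration m f m g"
proof -
  obtain q1 q2 :: "nat poly" where q1: "\<And>n. m n \<le> poly q1 n" and q2: "\<And>n. mdeg (g n) \<le> poly q2 n"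
    using VP by (auto simp: VP_def poly_bounded_def)
  have f: "f n \<in> mpols (m n)" and g: "g n \<in> mpols (m n)" and orb: "in_closed_orbit (m n) (g n) (f n)" for n
    using st by (auto simp: stable_degeneration_def)
  \<comment> \<open>The exponent of the degree bound, with the number of variables and the bit
    length replaced by polynomial bounds in \<open>n\<close>.\<close>
  define q where "q = 2 * q1 + q1 ^ 2 + q1 * q2"
  define K :: "nat \<Rightarrow> nat" where "K n = 2 ^ poly q n" for n
  \<comment> \<open>A row with a key of width \<open>w\<close> costs \<open>6 * w + 4\<close> gates,
    and the table ends with one constant gate.\<close>
  define qs where "qs = q1 ^ 3 * (6 * (2 * q1 + 1 + (q + 1)) + 4) + 1"
  have qle: "poly2 weight_poly (m n) (blen (mdeg (g n))) \<le> poly q n" for n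
  proof -
    have "blen (mdeg (g n)) \<le> poly q2 n" using blen_le[of "mdeg (g n)"] q2[of n] by simp
    with q1[of n] have "2 * m n + m n ^ 2 + m n * blen (mdeg (g n)) \<le> 2 * poly q1 n + poly q1 n ^ 2 + poly q1 n * poly q2 n"
      by (intro add_mono mult_mono power_mono) auto
    then show ?thesis by (simp add: poly2_weight_poly q_def)
  qed
  have "\<exists>C :: 'a circuit. length C \<le> poly qs n \<and>
      wf_circuit (blen (m n) + blen (m n) + 1 + blen (K n)) C \<and>
      has_limit (f n) (circuit_subst (m n) (m n) (K n) C (g n))" for n
  proof -
    obtain A N and k :: "nat \<Rightarrow> int" where A: "A \<in> SL (m n)" and N: "N \<in> SL (m n)"
      and k: "(\<Sum>i<m n. \<bar>k i\<bar>) \<le> 2 ^ poly2 weight_poly (m n) (blen (mdeg (g n)))"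
      and lim: "\<And>B. B \<in> SL (m n) \<Longrightarrow> has_limit (lsub (m n) id (N * B) (f n))
        (lsub (m n) lconst (map_mat lconst A * mat_diag (m n) (\<lambda>j. tpow (k j)) * map_mat lconst B) (g n))"
      by (rule exists_torus_limit[OF f g orb]) blast
    have kK: "\<bar>k r\<bar> \<le> int (K n)" if "r < m n" for r
    proof -
      have "\<bar>k r\<bar> \<le> (\<Sum>i<m n. \<bar>k i\<bar>)" using that by (intro member_le_sum) auto
      also note k
      also have "(2 :: int) ^ poly2 weight_poly (m n) (blen (mdeg (g n))) \<le> 2 ^ poly q n"
        by (rule power_increasing[OF qle]) simp
      finally show ?thesis by (simp add: K_def)
    qed
    define T where "T = torus_table (m n) (K n) A (minv N) k"
    define C where "C = gates 0 (table_expr T)"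
    note len = torus_table_length[of _ _ "m n" "K n" A "minv N" k, folded T_def]
    have "length C \<le> length T * (6 * (blen (m n) + blen (m n) + 1 + blen (K n)) + 4) + 1"
      unfolding C_def length_gates by (rule table_expr_size[OF len])
    also have "length T = m n ^ 3" unfolding T_def by (rule length_torus_table)
    also have "m n ^ 3 * (6 * (blen (m n) + blen (m n) + 1 + blen (K n)) + 4) + 1
        \<le> poly q1 n ^ 3 * (6 * (2 * poly q1 n + 1 + (poly q n + 1)) + 4) + 1"
    proof -
      have "blen (m n) \<le> poly q1 n" using blen_le[of "m n"] q1[of n] by simp
      moreover have "blen (K n) \<le> poly q n + 1" unfolding K_def by (rule blen_two_power)
      ultimately show ?thesis
        using q1[of n] by (intro add_mono mult_mono power_mono) auto
    qed
    also have "\<dots> = poly qs n" by (simp add: qs_def)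
    finally have "length C \<le> poly qs n" .
    moreover have "wf_circuit (blen (m n) + blen (m n) + 1 + blen (K n)) C"
      unfolding C_def by (rule wf_circuit_gates[OF table_expr_inputs[OF len]])
    moreover have "has_limit (f n) (circuit_subst (m n) (m n) (K n) C (g n))"
    proof -
      have "circuit_subst (m n) (m n) (K n) C (g n) = lsub (m n) lconst
          (map_mat lconst A * mat_diag (m n) (\<lambda>j. tpow (k j)) * map_mat lconst (minv N)) (g n)"
        unfolding C_def T_def
        by (rule circuit_subst_torus) (use A SL_minv(1)[OF N] g kK in \<open>auto simp: SL_def\<close>)
      moreover have "lsub (m n) id (N * minv N) (f n) = f n"
        by (simp add: SL_minv(2)[OF N] lsub_one[OF f])
      ultimately show ?thesis using lim[OF SL_minv(1)[OF N]] by simp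
    qed
    ultimately show ?thesis by blast
  qed
  then obtain C :: "nat \<Rightarrow> 'a circuit" where C: "\<And>n. length (C n) \<le> poly qs n"
    "\<And>n. wf_circuit (blen (m n) + blen (m n) + 1 + blen (K n)) (C n)"
    "\<And>n. has_limit (f n) (circuit_subst (m n) (m n) (K n) (C n) (g n))"
    by metis
  have "(\<lambda>n. real (K n)) \<in> O(\<lambda>n. 2 ^ poly q n)" by (simp add: K_def)
  moreover have "poly_bounded (\<lambda>n. length (C n))" unfolding poly_bounded_def using C(1) by blast
  ultimately show ?thesis
    unfolding p_definable_degeneration_def using f g C(2,3) by blast
qed

theorem theorem4p8:
  shows
    "(\<exists>p :: nat poly poly. \<forall>(m :: nat) (f :: (nat, 'a::alg_closed_field) mpol) (g :: (nat, 'a) mpol).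
        f \<in> mpols m \<longrightarrow> g \<in> mpols m \<longrightarrow> in_closed_orbit m g f \<longrightarrow>
        (\<exists>(\<Lambda> :: 'a laurent mat) (d :: nat).
            one_param_subgroup m \<Lambda> \<and>
            (\<exists>\<sigma>\<in>SL m. has_limit (act m \<sigma> f) (act m \<Lambda> (to_laurent g))) \<and>
            has_total_degree m \<Lambda> d \<and> d \<le> 2 ^ poly2 p m (blen (mdeg g)))) \<and>
     (\<forall>(m :: nat \<Rightarrow> nat) (f :: nat \<Rightarrow> (nat, 'a) mpol) (g :: nat \<Rightarrow> (nat, 'a) mpol).
        VP m g \<longrightarrow> stable_degeneration m f g \<longrightarrow> p_definable_degeneration m f m g)"
  by (intro conjI exI[of _ weight_poly] allI impI one_param_degeneration p_definable_if_stable)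

end
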